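(* Let $\mathfrak{G}$ be a subgroup of the symmetric group on $\{1,\dots,p\}$, let $\Sigma\in\mathbb{R}^{p\times p}$ be a $\mathfrak{G}$-invariant covariance matrix with spectral norm $\psi=\|\Sigma\|$, and let $\Sigma^n$ be the empirical covariance matrix formed from $n$ i.i.d. samples drawn from the Gaussian distribution $\mathcal{N}(0,\Sigma)$. Let $s_i$ and $m_i$ ($i\in\mathcal{I}$) be the block sizes and block multiplicities associated to $\mathfrak{G}$. Then for every $\delta>0$ with $\delta\le 8\psi$ and every $n\ge \max_{i\in\mathcal{I}}\frac{64\, s_i\psi^2}{m_i\delta^2}$, $$\mathbb{P}\left[\|\Sigma-\mathcal{P}_{\mathfrak{G}}(\Sigma^n)\|_F\ge\delta\sqrt{p}\right]\le |\mathcal{I}|\exp\left(-\frac{n\,\min_{i\in\mathcal{I}}m_i\,\delta^2}{128\,\psi^2}\right).$$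
   Context: For $g\in\mathfrak{G}$, $\Pi_g\in\mathbb{R}^{p\times p}$ is the permutation matrix of $g$. A matrix $M$ is $\mathfrak{G}$-invariant if $\Pi_g M\Pi_g^T=M$ for all $g\in\mathfrak{G}$; $\mathcal{W}_{\mathfrak{G}}\subseteq\mathbb{R}^{p\times p}$ is the subspace of all invariant matrices (fixed point subspace), and $\mathcal{P}_{\mathfrak{G}}$ is the Euclidean (Frobenius-orthogonal) projection of $\mathbb{R}^{p\times p}$ onto $\mathcal{W}_{\mathfrak{G}}$. For samples $X^{(1)},\dots,X^{(n)}$ the empirical covariance matrix is $\Sigma^n=\frac1n\sum_{k=1}^n X^{(k)}(X^{(k)})^T$. $\|\cdot\|$ is the spectral norm and $\|M\|_F=(\mathrm{Tr}(M^TM))^{1/2}$ the Frobenius norm. Group parameters: let $\mathcal{I}$ index the (pairwise inequivalent) complex irreducible representations of $\mathfrak{G}$ that occur in the permutation representation $g\mapsto\Pi_g$ on $\mathbb{C}^p$ ("active" irreducibles). By Schur's lemma there is a unitary matrix $T\in\mathbb{C}^{p\times p}$ depending only on $\mathfrak{G}$ such that for every $M\in\mathcal{W}_{\mathfrak{G}}$, $T^*MT=\mathrm{diag}(M_i)_{i\in\mathcal{I}}$, where each $M_i=\mathrm{diag}(B_i,\dots,B_i)$ consists of $m_i$ identical copies of a block $B_i$ of size $s_i\times s_i$. The parameters $s_i$ (block sizes) and $m_i$ (number of repetitions of the block) are those of this decomposition; i.e. $m_i$ is the dimension of the $i$-th irreducible representation and $s_i$ the number of times it occurs in the permutation representation.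 (For example, for $\mathfrak{G}$ the full symmetric group: $|\mathcal{I}|=2$, $s_1=m_1=1$, $s_2=1$, $m_2=p-1$.) *)

theory Defs
  imports "HOL-Probability.Probability" "HOL-Algebra.Bij"
begin

text \<open>
  The set of indices is a finite type \<open>'p\<close>, so that the dimension is \<open>CARD('p)\<close>, and the symmetric
  group on the indices is \<open>BijGroup UNIV\<close>. The permutation matrix sends the basis vector with index
  \<open>j\<close> to the one with index \<open>g j\<close>. It is polymorphic in the entries because it is used both over the
  reals and over the complex numbers.
\<close>

definition perm_matrix :: "('p \<Rightarrow> 'p) \<Rightarrow> 'a::zero_neq_one ^ 'p ^ 'p" where
  "perm_matrix g = (\<chi> i j. if i = g j then 1 else 0)"

definition invariant_matrices :: "('p \<Rightarrow> 'p) set \<Rightarrow> (real ^ 'p ^ 'p) set" where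
  "invariant_matrices G =
     {M. \<forall>g\<in>G. perm_matrix g ** M ** transpose (perm_matrix g) = M}"

definition spectral_norm :: "real ^ 'n ^ 'm \<Rightarrow> real" where
  "spectral_norm M = onorm (\<lambda>x. M *v x)"

definition frobenius_norm :: "real ^ 'n ^ 'm \<Rightarrow> real" where
  "frobenius_norm M = sqrt (trace (transpose M ** M))"

lemma frobenius_norm_eq_norm: "frobenius_norm M = norm M"
proof -
  have "trace (transpose M ** M) = (\<Sum>j\<in>UNIV. \<Sum>i\<in>UNIV. (M $ i $ j)\<^sup>2)"
    by (simp add: trace_def matrix_matrix_mult_def transpose_def power2_eq_square)
  also have "\<dots> = (\<Sum>i\<in>UNIV. \<Sum>j\<in>UNIV. (M $ i $ j)\<^sup>2)"
    by (rule sum.swap)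
  also have "\<dots> = inner M M"
    by (simp add: inner_vec_def power2_eq_square)
  finally show ?thesis
    by (simp add: frobenius_norm_def norm_eq_sqrt_inner)
qed

text \<open>
  By the previous lemma, the distance with respect to which \<^const>\<open>closest_point\<close> is taken on
  matrices is the Frobenius distance, so this is the orthogonal projection for the Frobenius inner
  product onto the linear subspace of invariant matrices.
\<close>

definition proj_invariant :: "('p::finite \<Rightarrow> 'p) set \<Rightarrow> real ^ 'p ^ 'p \<Rightarrow> real ^ 'p ^ 'p" where
  "proj_invariant G M = closest_point (invariant_matrices G) M"

definition covariance_matrix :: "real ^ 'n ^ 'n \<Rightarrow> bool" where
  "covariance_matrix S \<longleftrightarrow> transpose S = S \<and> (\<forall>x. 0 \<le> x \<bullet> (S *v x))"

text \<open>
  The random vector \<open>X\<close> has law \<open>N(0, S)\<close> if it is distributed like \<open>A Z\<close>, where \<open>Z\<close> has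
  independent standard normal components and \<open>A A\<^sup>T = S\<close>. A square \<open>A\<close> (for instance the positive
  semidefinite square root) exists for every positive semidefinite \<open>S\<close>, also for a singular one,
  and the law of \<open>A Z\<close> depends on \<open>S\<close> only.
\<close>

definition std_gaussian :: "(real ^ 'n::finite) measure" where
  "std_gaussian =
     distr (Pi\<^sub>M UNIV (\<lambda>_. density lborel std_normal_density)) borel (\<lambda>z. \<chi> i. z i)"

definition has_gaussian_law :: "'w measure \<Rightarrow> ('w \<Rightarrow> real ^ 'n) \<Rightarrow> real ^ 'n ^ 'n \<Rightarrow> bool" where
  "has_gaussian_law M X S \<longleftrightarrow> X \<in> borel_measurable M \<and>
     (\<exists>A :: real ^ 'n ^ 'n. A ** transpose A = S \<and>
        distr M borel X = distr std_gaussian borel (\<lambda>z. A *v z))"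

definition empirical_covariance ::
    "nat \<Rightarrow> (nat \<Rightarrow> 'w \<Rightarrow> real ^ 'n) \<Rightarrow> 'w \<Rightarrow> real ^ 'n ^ 'n" where
  "empirical_covariance n X \<omega> =
     (1 / real n) *\<^sub>R (\<Sum>k\<in>{1..n}.
       (columnvector (X k \<omega>) :: real ^ 1 ^ 'n) ** transpose (columnvector (X k \<omega>)))"

text \<open>
  The notions \<open>vec.subspace\<close> and \<open>vec.dim\<close> on \<open>complex ^ 'p\<close> are those over the field of complex
  numbers (in contrast to \<open>subspace\<close> and \<open>dim\<close>, which are over the reals).
\<close>

definition invariant_subspace :: "('p \<Rightarrow> 'p) set \<Rightarrow> (complex ^ 'p::finite) set \<Rightarrow> bool" where
  "invariant_subspace G V \<longleftrightarrow>
     vec.subspace V \<and> (\<forall>g\<in>G. \<forall>v\<in>V. perm_matrix g *v v \<in> V)"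

definition irreducible_subspace :: "('p \<Rightarrow> 'p) set \<Rightarrow> (complex ^ 'p::finite) set \<Rightarrow> bool" where
  "irreducible_subspace G V \<longleftrightarrow>
     invariant_subspace G V \<and> V \<noteq> {0} \<and>
     (\<forall>U. invariant_subspace G U \<and> U \<subseteq> V \<longrightarrow> U = {0} \<or> U = V)"

text \<open>
  The intertwiner is a linear map on the whole space whose values outside of \<open>V\<close> are irrelevant;
  every linear map on a subspace extends in this way.
\<close>

definition equivalent_subspaces ::
    "('p \<Rightarrow> 'p) set \<Rightarrow> (complex ^ 'p::finite) set \<Rightarrow> (complex ^ 'p) set \<Rightarrow> bool" where
  "equivalent_subspaces G V W \<longleftrightarrow>
     (\<exists>\<phi>. Vector_Spaces.linear (*s) (*s) \<phi> \<and> bij_betw \<phi> V W \<and>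
          (\<forall>g\<in>G. \<forall>v\<in>V. \<phi> (perm_matrix g *v v) = perm_matrix g *v \<phi> v))"

text \<open>
  An irreducible representation occurring in the permutation representation is represented by the
  equivalence class of all invariant subspaces of \<open>complex ^ 'p\<close> that carry it.
\<close>

definition active_irreps :: "('p \<Rightarrow> 'p) set \<Rightarrow> (complex ^ 'p::finite) set set set" where
  "active_irreps G =
     {V. irreducible_subspace G V} //
     {(V, W). irreducible_subspace G V \<and> irreducible_subspace G W \<and> equivalent_subspaces G V W}"

definition irrep_dim :: "(complex ^ 'p::finite) set set \<Rightarrow> nat" where
  "irrep_dim c = vec.dim (SOME V. V \<in> c)"

definition irreducible_decomposition ::
    "('p \<Rightarrow> 'p) set \<Rightarrow> (complex ^ 'p::finite) set set \<Rightarrow> (complex ^ 'p) set \<Rightarrow> bool" where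
  "irreducible_decomposition G D U \<longleftrightarrow>
     finite D \<and> (\<forall>V\<in>D. irreducible_subspace G V \<and> V \<subseteq> U) \<and>
     (\<forall>u\<in>U. \<exists>!f. f \<in> (\<Pi>\<^sub>E V\<in>D. V) \<and> (\<Sum>V\<in>D. f V) = u)"

text \<open>
  The number of summands in the class \<open>c\<close> does not depend on the decomposition of the whole space
  into a direct sum of irreducible subspaces (Krull--Schmidt). A decomposition exists by
  Maschke's theorem, see \<open>irreducible_decomposition_exists\<close> below.
\<close>

definition irrep_multiplicity ::
    "('p \<Rightarrow> 'p) set \<Rightarrow> (complex ^ 'p::finite) set set \<Rightarrow> nat" where
  "irrep_multiplicity G c = card (c \<inter> (SOME D. irreducible_decomposition G D UNIV))"

lemma perm_matrix_nth:
  assumes "bij g"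
  shows "(perm_matrix g *v (v :: complex ^ 'p::finite)) $ i = v $ (Hilbert_Choice.inv g i)"
proof -
  have "(if i = g j then 1 else 0) * v $ j = (if j = Hilbert_Choice.inv g i then v $ j else 0)" for j
    using assms by (auto simp: bij_inv_eq_iff)
  then show ?thesis
    by (simp add: perm_matrix_def matrix_vector_mult_def)
qed

lemma perm_matrix_inner:
  assumes "bij g"
  shows "(perm_matrix g *v v) \<bullet> (perm_matrix g *v w) = v \<bullet> (w :: complex ^ 'p::finite)"
proof -
  have "(perm_matrix g *v v) \<bullet> (perm_matrix g *v w) = (\<Sum>i\<in>UNIV. v $ Hilbert_Choice.inv g i \<bullet> w $ Hilbert_Choice.inv g i)"
    by (simp add: inner_vec_def perm_matrix_nth[OF assms])
  also have "\<dots> = (\<Sum>i\<in>UNIV. v $ i \<bullet> w $ i)"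
    by (rule sum.reindex_bij_betw[OF bij_imp_bij_inv[OF assms]])
  finally show ?thesis
    by (simp add: inner_vec_def)
qed

lemma subgroup_BijGroup_UNIV_D:
  assumes "subgroup G (BijGroup (UNIV :: 'p set))"
  shows "g \<in> G \<Longrightarrow> bij g" and "g \<in> G \<Longrightarrow> Hilbert_Choice.inv g \<in> G"
proof -
  assume g: "g \<in> G"
  have B: "g \<in> Bij UNIV"
    using subgroup.subset[OF assms] g by (auto simp: BijGroup_def)
  then show "bij g"
    by (simp add: Bij_def)
  have "m_inv (BijGroup UNIV) g \<in> G"
    by (rule subgroup.m_inv_closed[OF assms g])
  then show "Hilbert_Choice.inv g \<in> G"
    using inv_BijGroup[OF B] by (simp only: restrict_UNIV)
qed

lemma complex_inner_scale:
  "(c *s v) \<bullet> w = v \<bullet> (cnj c *s (w :: complex ^ 'p::finite))"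
  by (simp add: inner_vec_def inner_complex_def algebra_simps)

lemma invariant_subspace_orthogonal:
  assumes G: "subgroup G (BijGroup UNIV)"
    and U: "invariant_subspace G (U :: (complex ^ 'p::finite) set)" and V: "invariant_subspace G V"
  shows "invariant_subspace G {u\<in>U. \<forall>v\<in>V. u \<bullet> v = 0}"
  unfolding invariant_subspace_def
proof (intro conjI ballI)
  have sU: "vec.subspace U" and sV: "vec.subspace V"
    using U V by (auto simp: invariant_subspace_def)
  show "vec.subspace {u\<in>U. \<forall>v\<in>V. u \<bullet> v = 0}"
    unfolding vec.subspace_def
    using vec.subspace_0[OF sU] vec.subspace_add[OF sU] vec.subspace_scale[OF sU]
      vec.subspace_scale[OF sV]
    by (auto simp: inner_add_left complex_inner_scale)
next
  fix g u assume g: "g \<in> G" and u: "u \<in> {u\<in>U. \<forall>v\<in>V. u \<bullet> v = 0}"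
  note bij = subgroup_BijGroup_UNIV_D(1)[OF G]
  have "(perm_matrix g *v u) \<bullet> v = 0" if v: "v \<in> V" for v
  proof -
    have ig: "Hilbert_Choice.inv g \<in> G"
      by (rule subgroup_BijGroup_UNIV_D(2)[OF G g])
    then have w: "perm_matrix (Hilbert_Choice.inv g) *v v \<in> V"
      using V v by (auto simp: invariant_subspace_def)
    have "perm_matrix g *v (perm_matrix (Hilbert_Choice.inv g) *v v) = v"
      by (simp add: vec_eq_iff perm_matrix_nth[OF bij[OF g]] perm_matrix_nth[OF bij[OF ig]]
          inv_inv_eq[OF bij[OF g]] bij_is_surj[OF bij[OF g]] surj_f_inv_f)
    then have "(perm_matrix g *v u) \<bullet> v = u \<bullet> (perm_matrix (Hilbert_Choice.inv g) *v v)"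
      using perm_matrix_inner[OF bij[OF g], of u "perm_matrix (Hilbert_Choice.inv g) *v v"] by simp
    then show ?thesis
      using u w by simp
  qed
  then show "perm_matrix g *v u \<in> {u\<in>U. \<forall>v\<in>V. u \<bullet> v = 0}"
    using u g U by (auto simp: invariant_subspace_def)
qed

lemma irreducible_subspace_exists:
  assumes "invariant_subspace G U" "U \<noteq> {0}"
  obtains V where "irreducible_subspace G V" "V \<subseteq> U"
proof -
  define P where "P V \<longleftrightarrow> invariant_subspace G V \<and> V \<noteq> {0} \<and> V \<subseteq> U" for V
  have "P U"
    using assms by (simp add: P_def)
  from ex_has_least_nat[of P, OF this, of vec.dim]
  obtain V where V: "P V" and least: "\<And>W. P W \<Longrightarrow> vec.dim V \<le> vec.dim W"
    by blast
  have "W = V" if W: "invariant_subspace G W" "W \<subseteq> V" "W \<noteq> {0}" for W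
  proof (rule vec.subspace_dim_equal)
    show "vec.subspace W" "vec.subspace V"
      using W V by (auto simp: invariant_subspace_def P_def)
    show "vec.dim W \<ge> vec.dim V"
      by (rule least) (use W V in \<open>auto simp: P_def\<close>)
  qed (fact W)
  then have "irreducible_subspace G V"
    using V by (auto simp: irreducible_subspace_def P_def)
  then show ?thesis
    using that V by (auto simp: P_def)
qed

lemma irreducible_decomposition_insert:
  assumes sV: "vec.subspace V" and sW: "vec.subspace W"
    and V: "irreducible_subspace G V" and dec: "irreducible_decomposition G D W"
    and VW: "V \<inter> W = {0}" and sub: "V \<subseteq> U" "W \<subseteq> U"
    and sum: "\<And>u. u \<in> U \<Longrightarrow> \<exists>v\<in>V. \<exists>w\<in>W. u = v + w"
  shows "irreducible_decomposition G (insert V D) U"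
proof -
  have fin: "finite D" and DW: "\<And>Y. Y \<in> D \<Longrightarrow> Y \<subseteq> W"
    and ex1: "\<And>w. w \<in> W \<Longrightarrow> \<exists>!f. f \<in> (\<Pi>\<^sub>E Y\<in>D. Y) \<and> (\<Sum>Y\<in>D. f Y) = w"
    using dec by (auto simp: irreducible_decomposition_def)
  have "V \<noteq> {0}"
    using V by (simp add: irreducible_subspace_def)
  then have VD: "V \<notin> D"
    using DW VW by blast
  have "\<exists>!f. f \<in> (\<Pi>\<^sub>E Y\<in>insert V D. Y) \<and> (\<Sum>Y\<in>insert V D. f Y) = u" if u: "u \<in> U" for u
  proof -
    obtain v w where vw: "v \<in> V" "w \<in> W" "u = v + w"
      using sum[OF u] by blast
    from ex1[OF vw(2)] obtain f where f0: "f \<in> (\<Pi>\<^sub>E Y\<in>D. Y) \<and> (\<Sum>Y\<in>D. f Y) = w"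
      and f1: "\<forall>h. h \<in> (\<Pi>\<^sub>E Y\<in>D. Y) \<and> (\<Sum>Y\<in>D. h Y) = w \<longrightarrow> h = f"
      by (rule ex1E)
    note f = f0[THEN conjunct1] f0[THEN conjunct2]
    note f_unique = f1[rule_format, OF conjI]
    show ?thesis
    proof (rule ex1I[of _ "f(V := v)"], rule conjI)
      show "f(V := v) \<in> (\<Pi>\<^sub>E Y\<in>insert V D. Y)"
        by (rule PiE_fun_upd) (use vw f in auto)
      have "(\<Sum>Y\<in>D. (f(V := v)) Y) = (\<Sum>Y\<in>D. f Y)"
        by (rule sum.cong) (use VD in auto)
      then show "(\<Sum>Y\<in>insert V D. (f(V := v)) Y) = u"
        using fin VD vw f by simp
    next
      fix h assume h: "h \<in> (\<Pi>\<^sub>E Y\<in>insert V D. Y) \<and> (\<Sum>Y\<in>insert V D. h Y) = u"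
      have hV: "h V \<in> V"
        using h by auto
      have hD: "(\<Sum>Y\<in>D. h Y) \<in> W"
        proof (rule vec.subspace_sum[OF sW])
        fix Y assume Y: "Y \<in> D"
        then have "h Y \<in> Y"
          using h PiE_mem[of h "insert V D" "\<lambda>Y. Y" Y] by simp
        then show "h Y \<in> W"
          using DW[OF Y] by blast
      qed
      have eq: "h V + (\<Sum>Y\<in>D. h Y) = v + w"
        using h fin VD vw by simp
      have "h V - v \<in> V"
        using sV hV vw by (simp add: vec.subspace_diff)
      moreover have "h V - v = w - (\<Sum>Y\<in>D. h Y)"
        using eq by (simp add: algebra_simps)
      then have "h V - v \<in> W"
        using sW hD vw by (simp add: vec.subspace_diff)
      ultimately have "h V - v \<in> V \<inter> W"
        by blast
      then have hv: "h V = v"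
        unfolding VW by simp
      have "h(V := undefined) = f"
      proof (rule f_unique)
        show "h(V := undefined) \<in> (\<Pi>\<^sub>E Y\<in>D. Y)"
          using h VD by (intro fun_upd_in_PiE) auto
        have "(\<Sum>Y\<in>D. (h(V := undefined)) Y) = (\<Sum>Y\<in>D. h Y)"
          by (rule sum.cong) (use VD in auto)
        then show "(\<Sum>Y\<in>D. (h(V := undefined)) Y) = w"
          using eq hv by simp
      qed
      then show "h = f(V := v)"
        using hv by auto
    qed
  qed
  moreover have "irreducible_subspace G Y \<and> Y \<subseteq> U" if "Y \<in> insert V D" for Y
    using that dec V sub by (auto simp: irreducible_decomposition_def)
  ultimately show ?thesis
    unfolding irreducible_decomposition_def using fin by simp
qed

lemma irreducible_decomposition_exists_aux:
  assumes G: "subgroup G (BijGroup UNIV)"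
  shows "invariant_subspace G (U :: (complex ^ 'p::finite) set) \<Longrightarrow>
         \<exists>D. irreducible_decomposition G D U"
proof (induction "vec.dim U" arbitrary: U rule: less_induct)
  case less
  show ?case
  proof (cases "U = {0}")
    case True
    then have "irreducible_decomposition G {} U"
      by (simp add: irreducible_decomposition_def)
    then show ?thesis ..
  next
    case False
    then obtain V where V: "irreducible_subspace G V" "V \<subseteq> U"
      using irreducible_subspace_exists less.prems by blast
    define W where "W = {u\<in>U. \<forall>v\<in>V. u \<bullet> v = 0}"
    have iV: "invariant_subspace G V"
      using V by (simp add: irreducible_subspace_def)
    have iW: "invariant_subspace G W"
      unfolding W_def by (rule invariant_subspace_orthogonal[OF G less.prems iV])
    have sU: "vec.subspace U" and sV: "vec.subspace V" and sW: "vec.subspace W"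
      using less.prems iV iW by (auto simp: invariant_subspace_def)
    have VW: "V \<inter> W = {0}"
      using vec.subspace_0[OF sV] vec.subspace_0[OF sW] by (auto simp: W_def)
    have WU: "W \<subseteq> U"
      by (auto simp: W_def)
    have "W \<noteq> U"
      using VW V by (auto simp: irreducible_subspace_def)
    then have "vec.dim W < vec.dim U"
      using vec.subspace_dim_equal[OF sW sU WU] by linarith
    then obtain D where D: "irreducible_decomposition G D W"
      using less.hyps iW by blast
    have real: "c *\<^sub>R v = complex_of_real c *s v" for c and v :: "complex ^ 'p"
      by (simp add: vec_eq_iff complex_eq_iff)
    have "subspace V"
    proof (rule subspaceI)
      show "c *\<^sub>R x \<in> V" if "x \<in> V" for c x
        unfolding real by (rule vec.subspace_scale[OF sV that])
    qed (use vec.subspace_0[OF sV] vec.subspace_add[OF sV] in blast)+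
    then have spanV: "span V = V"
      by (rule span_eq_iff[THEN iffD2])
    have "\<exists>v\<in>V. \<exists>w\<in>W. u = v + w" if u: "u \<in> U" for u
    proof -
      obtain v w where vw: "v \<in> span V" "\<And>x. x \<in> span V \<Longrightarrow> orthogonal w x" "u = v + w"
        using orthogonal_subspace_decomp_exists[of V u] by blast
      then have v: "v \<in> V" and w: "\<And>x. x \<in> V \<Longrightarrow> w \<bullet> x = 0"
        by (auto simp: spanV orthogonal_def)
      have "w = u - v"
        using vw by simp
      then have "w \<in> U"
        using u v V sU by (auto intro: vec.subspace_diff)
      then show ?thesis
        using v w vw by (auto simp: W_def)
    qed
    then have "irreducible_decomposition G (insert V D) U"
      by (intro irreducible_decomposition_insert[OF sV sW V(1) D VW V(2) WU])
    then show ?thesis ..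
  qed
qed

lemma irreducible_decomposition_exists:
  assumes "subgroup G (BijGroup (UNIV :: 'p::finite set))"
  shows "\<exists>D :: (complex ^ 'p) set set. irreducible_decomposition G D UNIV"
  by (rule irreducible_decomposition_exists_aux[OF assms])
     (simp add: invariant_subspace_def)

end

theory Submission
  imports Defs
begin

text \<open>
  Write \<open>D\<close> for the difference of \<open>\<Sigma>\<close> and the projected empirical covariance matrix, and choose an
  orthogonal decomposition of \<open>complex ^ 'p\<close> into irreducible subspaces \<open>V\<close> with orthogonal
  projections \<open>P V\<close>. Then \<open>|D|\<^sup>2\<close> is the sum of the \<open>|D P V|\<^sup>2\<close> (Frobenius norms) and \<open>p\<close> is the sum
  of the dimensions \<open>m V\<close>. If \<open>|D| \<ge> \<delta> sqrt p\<close>, then for at least one equivalence class of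
  representations the average of \<open>|D P V|\<^sup>2 / (\<delta>\<^sup>2 m V)\<close> over the \<open>V\<close> in this class is at least \<open>1\<close>.
  The union bound over the classes yields the factor \<open>|I|\<close>. For one class, Markov's inequality for
  a \<open>k\<close>-th power and convexity (\<open>measure_sum_ge_card_le\<close>) reduce the claim to an estimate of the
  \<open>k\<close>-th moment of \<open>|D P V|\<^sup>2\<close> for a single \<open>V\<close>.

  The matrix \<open>D\<close> commutes with the permutations, so \<open>D P V\<close> is an intertwiner from \<open>V\<close> to the whole
  space. Schur's lemma says two things about the space of these intertwiners. Its real dimension is
  at most \<open>2 s\<close>, where \<open>s\<close> is the multiplicity of \<open>V\<close> (\<open>dim_intertwiners_le\<close>). And every
  intertwiner \<open>Y\<close> is a multiple of an isometry on \<open>V\<close>, so that its operator norm is only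
  \<open>|Y| / sqrt m\<close> (\<open>intertwiner_norm\<close>); this is where the repetition of the blocks enters.
  Expanding \<open>D P V\<close> in an orthonormal basis gives \<open>|D P V|\<^sup>2\<close> as the sum of the
  \<open>(Q b \<bullet> D)\<^sup>2\<close>, where the \<open>Q b\<close> are real invariant matrices, whence
  \<open>Q b \<bullet> D = Q b \<bullet> (\<Sigma> - \<Sigma>\<^sub>n)\<close> with the empirical covariance matrix \<open>\<Sigma>\<^sub>n\<close> itself
  (\<open>intertwiner_basis\<close>). Representations of real, complex and quaternionic type are treated alike.

  For a linear combination \<open>Q\<close> of the \<open>Q b\<close>, \<open>Q \<bullet> (\<Sigma> - \<Sigma>\<^sub>n)\<close> is a centred average of independent
  Gaussian quadratic forms. Its Laplace transform is controlled by the Frobenius norm of \<open>Q\<close>, as long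
  as the argument times the operator norm of \<open>Q\<close> is small
  (\<open>gaussian_quadratic_form_mgf\<close>), which bounds its moments of order \<open>2 k\<close>. To pass from the
  single linear combinations to the sum of squares without a net, take the vector \<open>v\<close> of coefficients
  standard Gaussian and independent of the sample: for fixed numbers \<open>y b\<close> the mean of
  \<open>(\<Sum>b. v b * y b) ^ (2 * k)\<close> is \<open>(2 k)! / (2 ^ k k!)\<close> times the \<open>k\<close>-th power of
  \<open>\<Sum>b. (y b)\<^sup>2\<close> (\<open>power_sum_squares_moment_le\<close>).

  Finally \<open>k\<close> is the integer part of \<open>n m \<delta>\<^sup>2 / (64 \<psi>\<^sup>2)\<close>. The hypothesis on \<open>n\<close> says exactly that
  \<open>s \<le> k\<close>, and then the resulting bound is a numerical inequality
  (\<open>moment_bound_le_exp\<close>).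
\<close>

section \<open>Symmetric matrices\<close>

text \<open>
  A maximiser of the Rayleigh quotient on the unit sphere of the subspace is an eigenvector: otherwise
  the quotient would increase in the direction \<open>f x - c x\<close>.
\<close>
lemma self_adjoint_eigenvector:
  fixes f :: "'a::euclidean_space \<Rightarrow> 'a"
  assumes lin: "linear f" and adj: "\<And>x y. f x \<bullet> y = x \<bullet> f y"
    and S: "subspace S" "S \<noteq> {0}" "f ` S \<subseteq> S"
  obtains x c where "x \<in> S" "norm x = 1" "f x = c *\<^sub>R x"
proof -
  have comp: "compact (S \<inter> sphere 0 1)"
    using closed_subspace[OF S(1)] by (intro closed_Int_compact) auto
  obtain z where z: "z \<in> S" "z \<noteq> 0"
    using S subspace_0 by blast
  then have "z /\<^sub>R norm z \<in> S \<inter> sphere 0 1"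
    using S(1) by (simp add: subspace_scale)
  then have ne: "S \<inter> sphere 0 1 \<noteq> {}"
    by blast
  have "continuous_on (S \<inter> sphere 0 1) (\<lambda>x. x \<bullet> f x)"
    using lin by (intro continuous_intros linear_continuous_on) (simp add: linear_conv_bounded_linear)
  from continuous_attains_sup[OF comp ne this]
  obtain x where x: "x \<in> S" "norm x = 1"
    and max: "\<And>y. y \<in> S \<Longrightarrow> norm y = 1 \<Longrightarrow> y \<bullet> f y \<le> x \<bullet> f x"
    by auto
  define c where "c = x \<bullet> f x"
  define g where "g y = c * (y \<bullet> y) - y \<bullet> f y" for y
  have g: "g y \<ge> 0" if "y \<in> S" for y
  proof (cases "y = 0")
    case True
    then show ?thesis using linear_0[OF lin] by (simp add: g_def)
  next
    case False
    have "(y /\<^sub>R norm y) \<bullet> f (y /\<^sub>R norm y) \<le> c"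
      unfolding c_def using False that S(1) by (intro max) (auto simp: subspace_scale)
    also have "(y /\<^sub>R norm y) \<bullet> f (y /\<^sub>R norm y) = (y \<bullet> f y) / (y \<bullet> y)"
      by (simp add: linear_cmul[OF lin] dot_square_norm power2_eq_square divide_inverse)
    finally show ?thesis
      using False by (simp add: g_def field_simps)
  qed
  define w where "w = c *\<^sub>R x - f x"
  have w: "w \<in> S"
    unfolding w_def using x S by (auto intro!: subspace_diff subspace_scale)
  define a b where "a = w \<bullet> w" and "b = g w"
  have b: "b \<ge> 0" using g[OF w] by (simp add: b_def)
  have expand: "g (x + t *\<^sub>R w) = 2 * t * a + t\<^sup>2 * b" for t
  proof -
    have "x \<bullet> f w = w \<bullet> f x"
      using adj[of x w] by (simp add: inner_commute)
    moreover have "x \<bullet> x = 1" using x by (simp add: dot_square_norm)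
    moreover have key: "a = c * (w \<bullet> x) - w \<bullet> f x"
      by (simp add: a_def w_def inner_diff_right)
    moreover have "x \<bullet> f x = c" by (simp add: c_def)
    ultimately show ?thesis
      unfolding key
      by (simp add: g_def b_def linear_add[OF lin] linear_cmul[OF lin] inner_add_left inner_add_right
          algebra_simps power2_eq_square inner_commute[of x w])
  qed
  have "a = 0"
  proof (rule ccontr)
    assume "a \<noteq> 0"
    then have a: "a > 0" by (simp add: a_def)
    \<comment> \<open>For small negative \<open>t\<close> the linear term of \<open>2 * t * a + t\<^sup>2 * b\<close> prevails; this \<open>t\<close> is small enough.\<close>
    define t where "t = - a / (b + 1)"
    have "0 \<le> g (x + t *\<^sub>R w)"
      using x w S(1) by (intro g) (auto intro: subspace_add subspace_scale)
    also have "\<dots> = - (a\<^sup>2 * (b + 2)) / (b + 1)\<^sup>2"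
      using b unfolding expand t_def by (simp add: power2_eq_square divide_simps) (simp add: algebra_simps)
    also have "\<dots> < 0"
      using a b by (simp add: divide_neg_pos)
    finally show False by simp
  qed
  then have "f x = c *\<^sub>R x"
    by (simp add: a_def w_def)
  with x that show ?thesis by blast
qed

text \<open>
  The orthogonal complement of an eigenvector is again an invariant subspace, so eigenvectors can be
  split off one at a time.
\<close>
lemma self_adjoint_eigenbasis:
  fixes f :: "'a::euclidean_space \<Rightarrow> 'a"
  assumes lin: "linear f" and adj: "\<And>x y. f x \<bullet> y = x \<bullet> f y"
  shows "subspace S \<Longrightarrow> f ` S \<subseteq> S \<Longrightarrow>
    \<exists>B. B \<subseteq> S \<and> finite B \<and> pairwise orthogonal B \<and> (\<forall>b\<in>B. norm b = 1) \<and> S \<subseteq> span B \<and>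
        (\<forall>b\<in>B. \<exists>c. f b = c *\<^sub>R b)"
proof (induction "dim S" arbitrary: S rule: less_induct)
  case less
  show ?case
  proof (cases "S = {0}")
    case True
    then show ?thesis by (intro exI[of _ "{}"]) auto
  next
    case False
    obtain x c where x: "x \<in> S" "norm x = 1" "f x = c *\<^sub>R x"
      using self_adjoint_eigenvector[OF lin adj less.prems(1) False less.prems(2)] by blast
    define T where "T = {y \<in> S. x \<bullet> y = 0}"
    have T: "subspace T"
      unfolding T_def using less.prems(1)
      by (auto simp: subspace_def inner_add_right)
    have fT: "f ` T \<subseteq> T"
      using less.prems(2) adj[of x] x(3) by (auto simp: T_def simp flip: adj)
    have "x \<notin> T" using x by (auto simp: T_def)
    moreover have "T \<subseteq> S" by (auto simp: T_def)
    ultimately have "T \<subset> S" using x(1) by blast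
    then have "dim T < dim S"
      using T less.prems(1) by (metis dim_psubset span_eq_iff)
    from less.hyps[OF this T fT] obtain B where B: "B \<subseteq> T" "finite B" "pairwise orthogonal B"
      "\<forall>b\<in>B. norm b = 1" "T \<subseteq> span B" "\<forall>b\<in>B. \<exists>c. f b = c *\<^sub>R b"
      by blast
    have "S \<subseteq> span (insert x B)"
    proof
      fix y assume y: "y \<in> S"
      have "y - (x \<bullet> y) *\<^sub>R x \<in> T"
        using y x less.prems(1) by (auto simp: T_def subspace_diff subspace_scale inner_diff_right dot_square_norm)
      then have "y - (x \<bullet> y) *\<^sub>R x \<in> span B" using B by blast
      then show "y \<in> span (insert x B)"
        unfolding span_insert by blast
    qed
    moreover have "pairwise orthogonal (insert x B)"
      using B by (auto simp: pairwise_insert T_def orthogonal_def inner_commute)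
    ultimately show ?thesis
      using B x by (intro exI[of _ "insert x B"]) (auto simp: T_def)
  qed
qed

text \<open>
  The form of the spectral theorem that is used for quadratic forms: the eigenvectors are the rows of
  \<open>Q\<close>, so \<open>Q *v x\<close> are the coordinates of \<open>x\<close> with respect to them.
\<close>
lemma symmetric_matrix_diagonalization:
  fixes K :: "real ^ 'n ^ 'n"
  assumes "transpose K = K"
  obtains Q :: "real ^ 'n ^ 'n" and \<mu> where "orthogonal_matrix Q"
    "\<And>i. norm (row i Q) = 1" "\<And>i. K *v row i Q = \<mu> i *\<^sub>R row i Q"
    "\<And>x. x \<bullet> (K *v x) = (\<Sum>i\<in>UNIV. \<mu> i * ((Q *v x) $ i)\<^sup>2)"
    "trace K = (\<Sum>i\<in>UNIV. \<mu> i)" "(norm K)\<^sup>2 = (\<Sum>i\<in>UNIV. (\<mu> i)\<^sup>2)"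
proof -
  let ?f = "\<lambda>x. K *v x"
  have adj: "?f x \<bullet> y = x \<bullet> ?f y" for x y
    by (metis assms dot_lmul_matrix vector_transpose_matrix)
  obtain B where B: "finite B" "pairwise orthogonal B" "\<forall>b\<in>B. norm b = 1" "UNIV \<subseteq> span B"
      "\<forall>b\<in>B. \<exists>c. K *v b = c *\<^sub>R b"
    using self_adjoint_eigenbasis[OF matrix_vector_mul_linear[of K] adj subspace_UNIV] by auto
  have "0 \<notin> B" using B(3) by auto
  then have ind: "independent B"
    using B(2) by (rule pairwise_orthogonal_independent[rotated])
  have "card B = CARD('n)"
    using basis_card_eq_dim[of B UNIV] B(4) ind by simp
  then obtain w :: "'n \<Rightarrow> real ^ 'n" where w: "bij_betw w UNIV B"
    using B(1) finite_same_card_bij[of "UNIV :: 'n set" B] by auto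
  have wB: "w i \<in> B" for i using w by (auto simp: bij_betw_def)
  have "\<forall>i. \<exists>c. K *v w i = c *\<^sub>R w i" using B(5) wB by blast
  from choice[OF this] obtain \<mu> where \<mu>: "\<And>i. K *v w i = \<mu> i *\<^sub>R w i"
    by blast
  have orth: "w i \<bullet> w j = (if i = j then 1 else 0)" for i j
  proof (cases "i = j")
    case True
    then show ?thesis using B(3) wB by (simp add: dot_square_norm)
  next
    case False
    then have "w i \<noteq> w j" using w by (auto simp: bij_betw_def inj_on_def)
    then show ?thesis using B(2) wB[of i] wB[of j] False by (auto simp: pairwise_def orthogonal_def)
  qed
  define Q :: "real ^ 'n ^ 'n" where "Q = (\<chi> i. w i)"
  have row: "row i Q = w i" for i by (simp add: Q_def row_def)
  have "orthogonal_matrix Q"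
    unfolding orthogonal_matrix_orthonormal_rows row
    using orth by (auto simp: norm_eq_1 orthogonal_def)
  then have QQ: "transpose Q ** Q = mat 1" and oQ: "orthogonal_matrix Q" by (auto simp: orthogonal_matrix)
  have KQ: "K = transpose Q ** (\<chi> i j. if i = j then \<mu> i else 0) ** Q"
  proof -
    have "K ** transpose Q = transpose Q ** (\<chi> i j. if i = j then \<mu> i else 0)"
    proof -
      have "(K ** transpose Q) $ i $ j = (transpose Q ** (\<chi> i j. if i = j then \<mu> i else 0)) $ i $ j" for i j
      proof -
        have "(K ** transpose Q) $ i $ j = (K *v w j) $ i"
          by (simp add: matrix_matrix_mult_def matrix_vector_mult_def transpose_def Q_def)
        also have "\<dots> = \<mu> j * w j $ i" using \<mu> by simp
        finally show ?thesis
          by (simp add: matrix_matrix_mult_def transpose_def Q_def if_distrib[of "\<lambda>x. _ * x"] cong: if_cong)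
      qed
      then show ?thesis by (simp add: vec_eq_iff)
    qed
    then have "K ** transpose Q ** Q = transpose Q ** (\<chi> i j. if i = j then \<mu> i else 0) ** Q" by simp
    then show ?thesis by (simp add: QQ flip: matrix_mul_assoc)
  qed
  have quad: "x \<bullet> (K *v x) = (\<Sum>i\<in>UNIV. \<mu> i * ((Q *v x) $ i)\<^sup>2)" for x
  proof -
    have diag: "((\<chi> i j. if i = j then \<mu> i else 0) *v y) $ i = \<mu> i * y $ i" for y i
    proof -
      have "(if i = j then \<mu> i else 0) * y $ j = (if i = j then \<mu> i * y $ i else 0)" for j
        by simp
      then show ?thesis by (simp add: matrix_vector_mult_def)
    qed
    have dual: "x \<bullet> (transpose Q *v y) = (Q *v x) \<bullet> y" for y
      using dot_lmul_matrix[of x "transpose Q" y] by simp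
    have "x \<bullet> (K *v x) = (Q *v x) \<bullet> ((\<chi> i j. if i = j then \<mu> i else 0) *v (Q *v x))"
      unfolding KQ matrix_vector_mul_assoc[symmetric]
      by (rule dual)
    also have "\<dots> = (\<Sum>i\<in>UNIV. \<mu> i * ((Q *v x) $ i)\<^sup>2)"
      by (simp add: inner_vec_def diag power2_eq_square mult_ac)
    finally show ?thesis .
  qed
  have tr: "trace K = (\<Sum>i\<in>UNIV. \<mu> i)"
  proof -
    have "trace K = trace (Q ** (transpose Q ** (\<chi> i j. if i = j then \<mu> i else 0)))"
      unfolding KQ by (rule trace_mul_sym)
    also have "\<dots> = trace (\<chi> i j. if i = j then \<mu> i else (0::real))"
      using oQ by (simp add: matrix_mul_assoc orthogonal_matrix_def)
    finally show ?thesis by (simp add: trace_def)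
  qed
  have nrm: "(norm K)\<^sup>2 = (\<Sum>i\<in>UNIV. (\<mu> i)\<^sup>2)"
  proof -
    let ?D = "\<chi> i j. if i = j then \<mu> i else (0::real)"
    have "(norm K)\<^sup>2 = trace (K ** K)"
      using assms frobenius_norm_eq_norm[of K]
      by (metis frobenius_norm_def norm_ge_zero real_sqrt_ge_0_iff real_sqrt_pow2)
    also have "K ** K = transpose Q ** (?D ** ?D ** Q)"
    proof -
      have "K ** K = transpose Q ** ?D ** (Q ** transpose Q) ** ?D ** Q"
        unfolding KQ by (simp add: matrix_mul_assoc)
      moreover have "Q ** transpose Q = mat 1" using oQ by (simp add: orthogonal_matrix_def)
      ultimately show ?thesis by (simp only: matrix_mul_rid) (simp add: matrix_mul_assoc)
    qed
    also have "trace \<dots> = trace (?D ** ?D ** Q ** transpose Q)"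
      by (rule trace_mul_sym)
    also have "\<dots> = trace (?D ** ?D)"
      using oQ by (simp add: orthogonal_matrix_def flip: matrix_mul_assoc)
    also have "\<dots> = (\<Sum>i\<in>UNIV. (\<mu> i)\<^sup>2)"
    proof -
      have "(if i = k then \<mu> i else 0) * (if k = i then \<mu> k else 0) = (if i = k then \<mu> i * \<mu> i else 0)" for i k
        by simp
      then show ?thesis
        by (simp add: trace_def matrix_matrix_mult_def power2_eq_square)
    qed
    finally show ?thesis .
  qed
  show ?thesis
    using that[OF oQ _ _ quad tr nrm] \<mu> B(3) wB by (auto simp: row)
qed

section \<open>The Laplace transform of Gaussian quadratic forms\<close>

lemma measurable_vec_of_PiM:
  assumes "sets M = sets borel"
  shows "(\<lambda>z. (\<chi> i. z i) :: real ^ 'n::finite) \<in> borel_measurable (Pi\<^sub>M UNIV (\<lambda>_::'n. M))"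
proof (rule borel_measurable_euclidean_space[THEN iffD2], rule ballI)
  have [measurable_cong]: "sets M = sets borel" by fact
  fix b :: "real ^ 'n" assume "b \<in> Basis"
  then obtain j where b: "b = axis j 1" by (auto simp: Basis_vec_def)
  have "(\<lambda>z. z j) \<in> borel_measurable (Pi\<^sub>M UNIV (\<lambda>_::'n. M))"
    by measurable
  then show "(\<lambda>z. ((\<chi> i. z i) :: real ^ 'n) \<bullet> b) \<in> borel_measurable (Pi\<^sub>M UNIV (\<lambda>_::'n. M))"
    by (simp add: b inner_axis)
qed

text \<open>
  The library defines \<^term>\<open>lborel\<close> through the basis vectors of a Euclidean space; this connects it to
  products that are indexed by the coordinates, as in the definition of the standard Gaussian law.
\<close>
lemma lborel_vec_eq_distr_PiM:
  "distr (Pi\<^sub>M UNIV (\<lambda>_::'n::finite. lborel)) borel (\<lambda>z. \<chi> i. z i) = (lborel :: (real ^ 'n) measure)"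
proof (rule lborel_eqI[symmetric])
  interpret product_sigma_finite "\<lambda>_::'n. lborel :: real measure" ..
  have meas: "(\<lambda>z. (\<chi> i. z i) :: real ^ 'n) \<in> borel_measurable (Pi\<^sub>M UNIV (\<lambda>_::'n. lborel))"
    by (rule measurable_vec_of_PiM) simp
  fix l u :: "real ^ 'n" assume lu: "\<And>b. b \<in> Basis \<Longrightarrow> l \<bullet> b \<le> u \<bullet> b"
  have le: "l $ i \<le> u $ i" for i
    using lu[of "axis i 1"] by (auto simp: Basis_vec_def inner_axis)
  have "(\<lambda>z. \<chi> i. z i) -` box l u \<inter> space (Pi\<^sub>M UNIV (\<lambda>_::'n. lborel :: real measure)) =
      (\<Pi>\<^sub>E i\<in>UNIV. {l $ i<..<u $ i})"
    by (auto simp: space_PiM PiE_def Pi_def mem_box_cart)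
  then have "emeasure (distr (Pi\<^sub>M UNIV (\<lambda>_::'n. lborel)) borel (\<lambda>z. \<chi> i. z i)) (box l u) =
      (\<Prod>i\<in>UNIV. emeasure lborel {l $ i<..<u $ i})"
    using meas by (simp add: emeasure_distr emeasure_PiM)
  also have "\<dots> = ennreal (\<Prod>i\<in>UNIV. u $ i - l $ i)"
    using le by (simp add: prod_ennreal)
  also have "(\<Prod>i\<in>UNIV. u $ i - l $ i) = (\<Prod>b\<in>Basis. (u - l) \<bullet> b)"
  proof -
    have B: "(Basis :: (real ^ 'n) set) = (\<lambda>i. axis i 1) ` UNIV"
      by (auto simp: Basis_vec_def)
    have "inj (\<lambda>i::'n. axis i (1::real))"
      by (auto simp: inj_on_def axis_eq_axis)
    then show ?thesis
      unfolding B by (simp add: prod.reindex inner_axis inner_diff_left)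
  qed
  finally show "emeasure (distr (Pi\<^sub>M UNIV (\<lambda>_::'n. lborel)) borel (\<lambda>z. \<chi> i. z i)) (box l u) =
      ennreal (\<Prod>b\<in>Basis. (u - l) \<bullet> b)" .
qed simp

lemma std_gaussian_eq_density:
  "(std_gaussian :: (real ^ 'n::finite) measure) = density lborel (\<lambda>x. \<Prod>i\<in>UNIV. ennreal (std_normal_density (x $ i)))"
proof -
  let ?N = "density lborel std_normal_density"
  let ?\<phi> = "\<lambda>z. (\<chi> i. z i) :: real ^ 'n"
  interpret L: product_sigma_finite "\<lambda>_::'n. lborel :: real measure" ..
  interpret N: prob_space "?N" by (rule prob_space_normal_density) simp
  interpret N: product_sigma_finite "\<lambda>_::'n. ?N" ..
  have [measurable]: "?\<phi> \<in> borel_measurable (Pi\<^sub>M UNIV (\<lambda>_::'n. lborel))"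
    by (rule measurable_vec_of_PiM) simp
  have "density (Pi\<^sub>M UNIV (\<lambda>_::'n. lborel)) (\<lambda>z. \<Prod>i\<in>UNIV. ennreal (std_normal_density (z i))) = Pi\<^sub>M UNIV (\<lambda>_::'n. ?N)"
  proof (rule N.PiM_eqI)
    show "sets (density (Pi\<^sub>M UNIV (\<lambda>_::'n. lborel)) (\<lambda>z. \<Prod>i\<in>UNIV. ennreal (std_normal_density (z i)))) = sets (Pi\<^sub>M UNIV (\<lambda>_::'n. ?N))"
      by (simp cong: sets_PiM_cong)
    fix A :: "'n \<Rightarrow> real set" assume A: "\<And>i. i \<in> UNIV \<Longrightarrow> A i \<in> sets ?N"
    then have A'[measurable]: "A i \<in> sets borel" for i by simp
    have "Pi\<^sub>E UNIV A \<in> sets (Pi\<^sub>M UNIV (\<lambda>_::'n. lborel :: real measure))"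
      by (rule sets_PiM_I_finite) auto
    then have "emeasure (density (Pi\<^sub>M UNIV (\<lambda>_::'n. lborel)) (\<lambda>z. \<Prod>i\<in>UNIV. ennreal (std_normal_density (z i)))) (Pi\<^sub>E UNIV A)
       = (\<integral>\<^sup>+ z. (\<Prod>i\<in>UNIV. ennreal (std_normal_density (z i))) * indicator (Pi\<^sub>E UNIV A) z \<partial>Pi\<^sub>M UNIV (\<lambda>_::'n. lborel))"
      by (subst emeasure_density) auto
    also have "\<dots> = (\<integral>\<^sup>+ z. (\<Prod>i\<in>UNIV. ennreal (std_normal_density (z i)) * indicator (A i) (z i)) \<partial>Pi\<^sub>M UNIV (\<lambda>_::'n. lborel))"
    proof (rule nn_integral_cong)
      fix z :: "'n \<Rightarrow> real"
      have "indicator (Pi\<^sub>E UNIV A) z = (\<Prod>i\<in>UNIV. indicator (A i) (z i) :: ennreal)"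
        by (auto simp: indicator_def PiE_def Pi_def)
      then show "(\<Prod>i\<in>UNIV. ennreal (std_normal_density (z i))) * indicator (Pi\<^sub>E UNIV A) z = (\<Prod>i\<in>UNIV. ennreal (std_normal_density (z i)) * indicator (A i) (z i))"
        by (simp add: prod.distrib)
    qed
    also have "\<dots> = (\<Prod>i\<in>UNIV. \<integral>\<^sup>+ x. ennreal (std_normal_density x) * indicator (A i) x \<partial>lborel)"
      by (rule L.product_nn_integral_prod) auto
    also have "\<dots> = (\<Prod>i\<in>UNIV. emeasure ?N (A i))"
      by (simp add: emeasure_density)
    finally show "emeasure (density (Pi\<^sub>M UNIV (\<lambda>_::'n. lborel)) (\<lambda>z. \<Prod>i\<in>UNIV. ennreal (std_normal_density (z i)))) (Pi\<^sub>E UNIV A)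
       = (\<Prod>i\<in>UNIV. emeasure ?N (A i))" .
  qed simp
  then have "std_gaussian = distr (density (Pi\<^sub>M UNIV (\<lambda>_::'n. lborel)) (\<lambda>z. \<Prod>i\<in>UNIV. ennreal (std_normal_density (?\<phi> z $ i)))) borel ?\<phi>"
    by (simp add: std_gaussian_def)
  also have "\<dots> = density (distr (Pi\<^sub>M UNIV (\<lambda>_::'n. lborel)) borel ?\<phi>) (\<lambda>x. \<Prod>i\<in>UNIV. ennreal (std_normal_density (x $ i)))"
    by (rule density_distr[symmetric]) auto
  finally show ?thesis by (simp add: lborel_vec_eq_distr_PiM)
qed

lemma nn_integral_lborel_isometry:
  fixes f :: "'a::euclidean_space \<Rightarrow> ennreal" and c :: real
  assumes [measurable]: "f \<in> borel_measurable borel" and c: "\<bar>c\<bar> = 1"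
  shows "(\<integral>\<^sup>+ x. f (t + c *\<^sub>R x) \<partial>lborel) = (\<integral>\<^sup>+ x. f x \<partial>lborel)"
proof -
  have "c \<noteq> 0" using c by auto
  from lborel_affine[OF this, of t] have "(lborel :: 'a measure) = distr lborel borel (\<lambda>x. t + c *\<^sub>R x)"
    using c by (simp add: density_1)
  then have "(\<integral>\<^sup>+ x. f x \<partial>lborel) = (\<integral>\<^sup>+ x. f x \<partial>distr lborel borel (\<lambda>x. t + c *\<^sub>R x))"
    by simp
  then show ?thesis by (simp add: nn_integral_distr)
qed

text \<open>
  A translation invariant measure is determined by its value on the unit ball, and a rotation maps the
  unit ball to itself. The former is seen by evaluating a double integral in two orders.
\<close>
lemma lborel_orthogonal_invariant:
  fixes Q :: "real ^ 'n ^ 'n"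
  assumes Q: "orthogonal_matrix Q"
  shows "distr lborel borel (\<lambda>x. Q *v x) = lborel"
proof (rule measure_eqI)
  have inv: "Q *v (transpose Q *v x) = x" for x
    using Q unfolding matrix_vector_mul_assoc by (simp add: orthogonal_matrix_def)
  have [measurable]: "(\<lambda>x. Q *v x) \<in> borel_measurable borel"
    by (intro borel_measurable_continuous_onI continuous_intros)
  have nQ: "norm (Q *v x) = norm x" for x
    using Q by (metis orthogonal_transformation_matrix orthogonal_transformation_norm matrix_of_matrix_vector_mul matrix_vector_mul_linear)
  define q where "q A = (\<integral>\<^sup>+ x. indicator A (Q *v x) \<partial>lborel)" for A :: "(real ^ 'n) set"
  \<comment> \<open>Substituting \<open>x - Q\<^sup>T y\<close> for \<open>x\<close> moves the translation from \<open>B\<close> to \<open>A\<close>.\<close>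
  have q_swap: "q A * emeasure lborel B = q B * emeasure lborel A"
    if [measurable]: "A \<in> sets borel" "B \<in> sets borel" for A B :: "(real ^ 'n) set"
  proof -
    have shift: "(\<integral>\<^sup>+ y. indicator B (z + y) \<partial>lborel) = emeasure lborel B" for z :: "real ^ 'n"
      using nn_integral_lborel_isometry[of "indicator B" 1 z] by simp
    have reflect: "(\<integral>\<^sup>+ y. indicator A (z - y) \<partial>lborel) = emeasure lborel A" for z :: "real ^ 'n"
      using nn_integral_lborel_isometry[of "indicator A" "-1" z] by simp
    have "q A * emeasure lborel B = (\<integral>\<^sup>+ x. indicator A (Q *v x) * emeasure lborel B \<partial>lborel)"
      unfolding q_def by (rule nn_integral_multc[symmetric]) measurable
    also have "\<dots> = (\<integral>\<^sup>+ x. (\<integral>\<^sup>+ y. indicator A (Q *v x) * indicator B (Q *v x + y) \<partial>lborel) \<partial>lborel)"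
      by (simp add: nn_integral_cmult shift)
    also have "\<dots> = (\<integral>\<^sup>+ y. (\<integral>\<^sup>+ x. indicator A (Q *v x) * indicator B (Q *v x + y) \<partial>lborel) \<partial>lborel)"
      by (rule lborel_pair.Fubini') measurable
    also have "\<dots> = (\<integral>\<^sup>+ y. (\<integral>\<^sup>+ x. indicator A (Q *v x - y) * indicator B (Q *v x) \<partial>lborel) \<partial>lborel)"
    proof (rule nn_integral_cong)
      fix y :: "real ^ 'n"
      have e: "Q *v (- (transpose Q *v y) + 1 *\<^sub>R x) = Q *v x - y" for x
        using inv[of y] by (simp only: matrix_vector_right_distrib scaleR_one linear_neg[OF matrix_vector_mul_linear]) simp
      show "(\<integral>\<^sup>+ x. indicator A (Q *v x) * indicator B (Q *v x + y) \<partial>lborel)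
        = (\<integral>\<^sup>+ x. indicator A (Q *v x - y) * indicator B (Q *v x) \<partial>lborel)"
        using nn_integral_lborel_isometry[of "\<lambda>x. indicator A (Q *v x) * indicator B (Q *v x + y)" 1 "- (transpose Q *v y)"]
        unfolding e by simp
    qed
    also have "\<dots> = (\<integral>\<^sup>+ x. (\<integral>\<^sup>+ y. indicator A (Q *v x - y) * indicator B (Q *v x) \<partial>lborel) \<partial>lborel)"
      by (rule lborel_pair.Fubini') measurable
    also have "\<dots> = (\<integral>\<^sup>+ x. emeasure lborel A * indicator B (Q *v x) \<partial>lborel)"
      by (simp add: nn_integral_multc reflect)
    also have "\<dots> = q B * emeasure lborel A"
      unfolding q_def by (subst nn_integral_cmult) (auto simp: mult.commute)
    finally show ?thesis .
  qed
  let ?B = "ball 0 1 :: (real ^ 'n) set"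
  have qB: "q ?B = emeasure lborel ?B"
  proof -
    have "indicator ?B (Q *v x) = (indicator ?B x :: ennreal)" for x
      by (simp add: indicator_def nQ)
    then show ?thesis by (simp add: q_def)
  qed
  have ball: "emeasure lborel ?B \<noteq> 0" "emeasure lborel ?B \<noteq> \<infinity>"
    using unit_ball_vol_pos[of "real DIM(real ^ 'n)"] emeasure_bounded_finite[of ?B]
    by (simp_all add: emeasure_ball del: unit_ball_vol_pos)
  fix A assume "A \<in> sets (distr lborel borel (\<lambda>x. Q *v x))"
  then have [measurable]: "A \<in> sets borel" by simp
  have "emeasure lborel ?B * q A = emeasure lborel ?B * emeasure lborel A"
    using q_swap[of A ?B] qB by (simp only: mult.commute) auto
  then have "q A = emeasure lborel A"
    unfolding ennreal_mult_cancel_left using ball by auto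
  moreover have "q A = emeasure (distr lborel borel (\<lambda>x. Q *v x)) A"
    by (subst nn_integral_indicator[symmetric], simp, subst nn_integral_distr) (simp_all add: q_def)
  ultimately show "emeasure (distr lborel borel (\<lambda>x. Q *v x)) A = emeasure lborel A" by simp
qed simp

text \<open>
  The density of the standard Gaussian law depends on the norm only.
\<close>
lemma std_gaussian_orthogonal_invariant:
  fixes Q :: "real ^ 'n ^ 'n"
  assumes Q: "orthogonal_matrix Q"
  shows "distr std_gaussian borel (\<lambda>x. Q *v x) = std_gaussian"
proof -
  have [measurable]: "(\<lambda>x. Q *v x) \<in> borel_measurable borel"
    by (intro borel_measurable_continuous_onI continuous_intros)
  have [measurable]: "(\<lambda>x :: real ^ 'n. \<Prod>i\<in>UNIV. ennreal (std_normal_density (x $ i))) \<in> borel_measurable borel"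
    by measurable
  have radial: "(\<Prod>i\<in>UNIV. ennreal (std_normal_density (x $ i))) = ennreal ((1 / sqrt (2 * pi)) ^ CARD('n) * exp (- (norm x)\<^sup>2 / 2))" for x :: "real ^ 'n"
  proof -
    have "(\<Prod>i\<in>UNIV. std_normal_density (x $ i)) = (1 / sqrt (2 * pi)) ^ CARD('n) * exp (\<Sum>i\<in>UNIV. - (x $ i)\<^sup>2 / 2)"
      by (simp add: normal_density_def prod.distrib exp_sum prod_dividef power_one_over)
    also have "(\<Sum>i\<in>UNIV. - (x $ i)\<^sup>2 / 2) = - (norm x)\<^sup>2 / 2"
    proof -
      have "(norm x)\<^sup>2 = (\<Sum>i\<in>UNIV. (x $ i)\<^sup>2)"
        unfolding power2_norm_eq_inner inner_vec_def by (simp add: power2_eq_square)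
      then show ?thesis by (simp add: sum_negf sum_divide_distrib)
    qed
    finally show ?thesis by (simp add: prod_ennreal)
  qed
  have "norm (Q *v x) = norm x" for x
    using Q by (metis orthogonal_transformation_matrix orthogonal_transformation_norm matrix_of_matrix_vector_mul matrix_vector_mul_linear)
  then have "distr std_gaussian borel (\<lambda>x. Q *v x) = distr (density lborel (\<lambda>x. \<Prod>i\<in>UNIV. ennreal (std_normal_density ((Q *v x) $ i)))) borel (\<lambda>x. Q *v x)"
    unfolding std_gaussian_eq_density radial by simp
  also have "\<dots> = density (distr lborel borel (\<lambda>x. Q *v x)) (\<lambda>x. \<Prod>i\<in>UNIV. ennreal (std_normal_density (x $ i)))"
    by (rule density_distr[symmetric]) auto
  finally show ?thesis
    by (simp add: lborel_orthogonal_invariant[OF Q] std_gaussian_eq_density)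
qed

lemma nn_integral_std_normal_exp_square:
  assumes "a < 1 / 2"
  shows "(\<integral>\<^sup>+ z. ennreal (exp (a * z\<^sup>2)) \<partial>density lborel std_normal_density) = ennreal (1 / sqrt (1 - 2 * a))"
proof -
  define \<sigma> where "\<sigma> = 1 / sqrt (1 - 2 * a)"
  have \<sigma>: "\<sigma> > 0" "\<sigma>\<^sup>2 = 1 / (1 - 2 * a)"
    using assms by (auto simp: \<sigma>_def power_divide)
  interpret prob_space "density lborel (normal_density 0 \<sigma>)"
    by (rule prob_space_normal_density) fact
  have "std_normal_density z * exp (a * z\<^sup>2) = \<sigma> * normal_density 0 \<sigma> z" for z
  proof -
    have e: "- z\<^sup>2 / 2 + a * z\<^sup>2 = - z\<^sup>2 / (2 * \<sigma>\<^sup>2)"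
      using assms by (simp add: \<sigma>(2) field_simps)
    have "std_normal_density z * exp (a * z\<^sup>2) = 1 / sqrt (2 * pi) * exp (- z\<^sup>2 / 2 + a * z\<^sup>2)"
      by (simp add: normal_density_def flip: exp_add)
    also have "\<dots> = \<sigma> * normal_density 0 \<sigma> z"
      unfolding e using \<sigma>(1) by (simp add: normal_density_def real_sqrt_mult)
    finally show ?thesis .
  qed
  then have "(\<integral>\<^sup>+ z. ennreal (exp (a * z\<^sup>2)) \<partial>density lborel std_normal_density)
     = (\<integral>\<^sup>+ z. ennreal \<sigma> * ennreal (normal_density 0 \<sigma> z) \<partial>lborel)"
    using \<sigma>(1) by (simp add: nn_integral_density flip: ennreal_mult)
  also have "\<dots> = ennreal \<sigma> * (\<integral>\<^sup>+ z. ennreal (normal_density 0 \<sigma> z) \<partial>lborel)"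
    by (rule nn_integral_cmult) simp
  also have "(\<integral>\<^sup>+ z. ennreal (normal_density 0 \<sigma> z) \<partial>lborel) = 1"
    using emeasure_space_1 by (simp add: emeasure_density)
  finally show ?thesis by (simp add: \<sigma>_def)
qed

lemma nn_integral_std_gaussian_exp_squares:
  assumes "\<And>i. a i < 1 / 2"
  shows "(\<integral>\<^sup>+ z. ennreal (exp (\<Sum>i\<in>UNIV. a i * (z $ i)\<^sup>2)) \<partial>(std_gaussian :: (real ^ 'n::finite) measure))
    = ennreal (\<Prod>i\<in>UNIV. 1 / sqrt (1 - 2 * a i))"
proof -
  let ?N = "density lborel std_normal_density"
  interpret N: prob_space "?N" by (rule prob_space_normal_density) simp
  interpret N: product_sigma_finite "\<lambda>_::'n. ?N" ..
  have [measurable]: "(\<lambda>z. (\<chi> i. z i) :: real ^ 'n) \<in> borel_measurable (Pi\<^sub>M UNIV (\<lambda>_::'n. ?N))"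
    by (rule measurable_vec_of_PiM) simp
  have "(\<integral>\<^sup>+ z. ennreal (exp (\<Sum>i\<in>UNIV. a i * (z $ i)\<^sup>2)) \<partial>(std_gaussian :: (real ^ 'n) measure))
     = (\<integral>\<^sup>+ z. (\<Prod>i\<in>UNIV. ennreal (exp (a i * (z i)\<^sup>2))) \<partial>Pi\<^sub>M UNIV (\<lambda>_. ?N))"
    by (simp add: std_gaussian_def nn_integral_distr exp_sum prod_ennreal)
  also have "\<dots> = (\<Prod>i\<in>UNIV. \<integral>\<^sup>+ z. ennreal (exp (a i * z\<^sup>2)) \<partial>?N)"
    by (rule N.product_nn_integral_prod) auto
  also have "\<dots> = (\<Prod>i\<in>UNIV. ennreal (1 / sqrt (1 - 2 * a i)))"
    using assms by (intro prod.cong refl nn_integral_std_normal_exp_square)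
  also have "\<dots> = ennreal (\<Prod>i\<in>UNIV. 1 / sqrt (1 - 2 * a i))"
  proof (rule prod_ennreal)
    show "0 \<le> 1 / sqrt (1 - 2 * a i)" for i
      using assms[of i] by simp
  qed
  finally show ?thesis .
qed

text \<open>
  The logarithm of the left-hand side is \<open>x + x\<^sup>2 + O(x\<^sup>3)\<close>. The interval and the constant \<open>27 / 10\<close> are
  tuned to the constants \<open>64\<close> and \<open>128\<close> of the final theorem: for \<open>x = 2 / 5\<close> the smallest possible
  constant is about \<open>2.53\<close>, and anything up to \<open>2.75\<close> would suffice in the end.
\<close>
lemma inverse_sqrt_le_exp_quadratic:
  fixes x :: real
  assumes "\<bar>x\<bar> \<le> 2 / 5"
  shows "1 / sqrt (1 - 2 * x) \<le> exp (x + 27 / 10 * x\<^sup>2)"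
proof -
  define g where "g x = x + 27 / 10 * x\<^sup>2 + ln (1 - 2 * x) / 2" for x :: real
  define g' where "g' x = 2 * x * (27 / 10 - 1 / (1 - 2 * x))" for x :: real
  have der: "(g has_real_derivative g' x) (at x)" if "x \<le> 2 / 5" for x
    unfolding g_def g'_def using that
    by (auto intro!: derivative_eq_intros simp: field_simps power2_eq_square)
  have "g x \<ge> 0"
  proof -
    \<comment> \<open>\<open>17 / 54\<close> is the positive zero of the derivative; beyond it \<open>g\<close> decreases to its value at \<open>2 / 5\<close>\<close>
    consider "x \<le> 0" | "0 \<le> x" "x \<le> 17 / 54" | "17 / 54 \<le> x" by linarith
    then show ?thesis
    proof cases
      case 1
      have "g x \<ge> g 0"
      proof (rule DERIV_nonpos_imp_nonincreasing[OF 1])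
        fix y assume y: "x \<le> y" "y \<le> 0"
        have "1 / (1 - 2 * y) \<le> 1"
          using y by simp
        then have "g' y \<le> 0"
          unfolding g'_def using y by (rule_tac mult_nonpos_nonneg) (linarith, linarith)
        then show "\<exists>d. (g has_real_derivative d) (at y) \<and> d \<le> 0"
          using der[of y] y by auto
      qed
      then show ?thesis by (simp add: g_def)
    next
      case 2
      have "g 0 \<le> g x"
      proof (rule DERIV_nonneg_imp_nondecreasing[OF 2(1)])
        fix y assume y: "0 \<le> y" "y \<le> x"
        have "g' y \<ge> 0"
          unfolding g'_def using y 2 by (intro mult_nonneg_nonneg) (auto simp: field_simps)
        then show "\<exists>d. (g has_real_derivative d) (at y) \<and> 0 \<le> d"
          using der[of y] y 2 by auto
      qed
      then show ?thesis by (simp add: g_def)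
    next
      case 3
      have x: "x \<le> 2 / 5" using assms by simp
      have "g x \<ge> g (2 / 5)"
      proof (rule DERIV_nonpos_imp_nonincreasing[OF x])
        fix y assume y: "x \<le> y" "y \<le> 2 / 5"
        have "g' y \<le> 0"
          unfolding g'_def using y 3 by (intro mult_nonneg_nonpos) (auto simp: field_simps)
        then show "\<exists>d. (g has_real_derivative d) (at y) \<and> d \<le> 0"
          using der[of y] y by auto
      qed
      moreover have "ln 5 \<le> (166 / 100 :: real)"
      proof -
        have "(5::real) \<le> (1 + 415 / 1000 + (415 / 1000)\<^sup>2 / 2) ^ 4"
          by (simp add: power_numeral_reduce divide_simps)
        also have "\<dots> \<le> exp (415 / 1000) ^ 4"
          by (intro power_mono exp_lower_Taylor_quadratic) auto
        also have "\<dots> = exp (166 / 100)"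
          by (simp flip: exp_of_nat_mult)
        finally have "ln 5 \<le> ln (exp (166 / 100 :: real))"
          by (subst ln_le_cancel_iff) auto
        then show ?thesis by simp
      qed
      then have "g (2 / 5) \<ge> 0"
        by (simp add: g_def ln_div power2_eq_square)
      ultimately show ?thesis by simp
    qed
  qed
  moreover have pos: "1 - 2 * x > 0" using assms by simp
  then have "1 / sqrt (1 - 2 * x) = exp (- ln (1 - 2 * x) / 2)"
    by (simp add: exp_minus ln_sqrt[symmetric] inverse_eq_divide)
  ultimately show ?thesis by (simp add: g_def)
qed

lemma nn_integral_std_gaussian_exp_quadratic_form:
  fixes K :: "real ^ 'n ^ 'n"
  assumes K: "transpose K = K" and small: "\<And>x. \<bar>x \<bullet> (K *v x)\<bar> \<le> 2 / 5 * (norm x)\<^sup>2"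
  shows "(\<integral>\<^sup>+ z. ennreal (exp (z \<bullet> (K *v z))) \<partial>std_gaussian) \<le> ennreal (exp (trace K + 27 / 10 * (norm K)\<^sup>2))"
proof -
  obtain Q \<mu> where Q: "orthogonal_matrix Q" "\<And>i. norm (row i Q) = 1" "\<And>i. K *v row i Q = \<mu> i *\<^sub>R row i Q"
    "\<And>x. x \<bullet> (K *v x) = (\<Sum>i\<in>UNIV. \<mu> i * ((Q *v x) $ i)\<^sup>2)"
    "trace K = (\<Sum>i\<in>UNIV. \<mu> i)" "(norm K)\<^sup>2 = (\<Sum>i\<in>UNIV. (\<mu> i)\<^sup>2)"
    by (rule symmetric_matrix_diagonalization[OF K]) (rule that; simp)
  have \<mu>: "\<bar>\<mu> i\<bar> \<le> 2 / 5" for i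
    using small[of "row i Q"] Q(2,3)[of i] by (simp add: dot_square_norm)
  have [measurable]: "(\<lambda>x. Q *v x) \<in> borel_measurable borel"
    by (intro borel_measurable_continuous_onI continuous_intros)
  have [simp]: "sets std_gaussian = sets borel" by (simp add: std_gaussian_def)
  have meas: "(\<lambda>x. Q *v x) \<in> measurable std_gaussian borel"
    by (simp cong: measurable_cong_sets)
  have "(\<integral>\<^sup>+ z. ennreal (exp (z \<bullet> (K *v z))) \<partial>std_gaussian)
     = (\<integral>\<^sup>+ z. ennreal (exp (\<Sum>i\<in>UNIV. \<mu> i * (z $ i)\<^sup>2)) \<partial>distr std_gaussian borel (\<lambda>x. Q *v x))"
    using meas by (simp add: nn_integral_distr Q(4))
  also have "\<dots> = ennreal (\<Prod>i\<in>UNIV. 1 / sqrt (1 - 2 * \<mu> i))"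
  proof -
    have "\<mu> i < 1 / 2" for i using \<mu>[of i] by simp
    then show ?thesis
      unfolding std_gaussian_orthogonal_invariant[OF Q(1)] by (rule nn_integral_std_gaussian_exp_squares)
  qed
  also have "\<dots> \<le> ennreal (\<Prod>i\<in>UNIV. exp (\<mu> i + 27 / 10 * (\<mu> i)\<^sup>2))"
  proof (intro ennreal_leI prod_mono conjI)
    show "0 \<le> 1 / sqrt (1 - 2 * \<mu> i)" for i
      using \<mu>[of i] by simp
  qed (rule inverse_sqrt_le_exp_quadratic[OF \<mu>])
  also have "(\<Prod>i\<in>UNIV. exp (\<mu> i + 27 / 10 * (\<mu> i)\<^sup>2)) = exp (trace K + 27 / 10 * (norm K)\<^sup>2)"
    unfolding Q(5,6) by (simp add: exp_sum[symmetric] sum.distrib sum_distrib_left)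
  finally show ?thesis .
qed

lemma norm_matrix_columns:
  fixes C :: "'a::real_inner ^ 'n ^ 'm"
  shows "(norm C)\<^sup>2 = (\<Sum>j\<in>UNIV. (norm (column j C))\<^sup>2)"
  unfolding power2_norm_eq_inner inner_vec_def column_def
  by simp (rule sum.swap)

lemma norm_transpose: "norm (transpose C) = norm (C :: 'a::real_inner ^ 'n ^ 'm)"
proof -
  have "(norm (transpose C))\<^sup>2 = (norm C)\<^sup>2"
    unfolding power2_norm_eq_inner inner_vec_def transpose_def
    by simp (rule sum.swap)
  then show ?thesis by simp
qed

text \<open>
  Multiplication by \<open>B\<close> acts on each column separately, and the squared norms of the columns add up.
\<close>
lemma norm_matrix_mult_le:
  fixes B :: "'a::{real_inner,semiring_1} ^ 'k ^ 'm" and C :: "'a ^ 'n ^ 'k"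
  assumes "\<And>x. (norm (B *v x))\<^sup>2 \<le> c * (norm x)\<^sup>2"
  shows "(norm (B ** C))\<^sup>2 \<le> c * (norm C)\<^sup>2"
proof -
  have "column j (B ** C) = B *v column j C" for j
    by (simp add: column_def matrix_matrix_mult_def matrix_vector_mult_def)
  then show ?thesis
    unfolding norm_matrix_columns by (simp add: sum_distrib_left sum_mono assms)
qed

text \<open>
  With \<open>X = A Z\<close> the quadratic form becomes \<open>Z \<bullet> (K *v Z)\<close> for the symmetric matrix
  \<open>K = A\<^sup>T S A\<close>, where \<open>S\<close> is the symmetric part of \<open>Q\<close>. Its trace is \<open>Q \<bullet> \<Sigma>\<close>, the mean of the form.
  Multiplication by \<open>A\<close> or \<open>A\<^sup>T\<close> enlarges norms at most by the factor \<open>sqrt \<psi>\<close>, which bounds both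
  the eigenvalues and the Frobenius norm of \<open>K\<close>.
\<close>
lemma gaussian_quadratic_form_mgf:
  fixes \<Sigma> Q :: "real ^ 'n ^ 'n"
  assumes X: "has_gaussian_law M X \<Sigma>"
    and \<psi>: "\<And>x. x \<bullet> (\<Sigma> *v x) \<le> \<psi> * (norm x)\<^sup>2" "0 \<le> \<psi>"
    and \<beta>: "\<And>x. \<bar>x \<bullet> (Q *v x)\<bar> \<le> \<beta> * (norm x)\<^sup>2" "0 \<le> \<beta>"
    and small: "\<psi> * \<beta> \<le> 2 / 5"
  shows "(\<integral>\<^sup>+ \<omega>. ennreal (exp (X \<omega> \<bullet> (Q *v X \<omega>))) \<partial>M) \<le> ennreal (exp (Q \<bullet> \<Sigma> + 27 / 10 * \<psi>\<^sup>2 * (norm Q)\<^sup>2))"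
proof -
  from X obtain A :: "real ^ 'n ^ 'n" where A: "A ** transpose A = \<Sigma>" and [measurable]: "X \<in> borel_measurable M"
    and law: "distr M borel X = distr std_gaussian borel (\<lambda>z. A *v z)"
    unfolding has_gaussian_law_def by blast
  define S where "S = (1 / 2) *\<^sub>R (Q + transpose Q)"
  define K where "K = transpose A ** S ** A"
  have tS: "transpose S = S"
    by (simp add: S_def transpose_def vec_eq_iff add.commute)
  have tK: "transpose K = K"
    by (simp add: K_def matrix_transpose_mul tS matrix_mul_assoc)
  have dual: "x \<bullet> (transpose B *v y) = (B *v x) \<bullet> y" for B :: "real ^ 'n ^ 'n" and x y
    using dot_lmul_matrix[of x "transpose B" y] by simp
  have QS: "x \<bullet> (S *v x) = x \<bullet> (Q *v x)" for x
  proof -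
    have "x \<bullet> (transpose Q *v x) = x \<bullet> (Q *v x)"
      unfolding dual by (rule inner_commute)
    then show ?thesis
      by (simp add: S_def scaleR_matrix_vector_assoc[symmetric] matrix_vector_mult_add_rdistrib inner_add_right del: transpose_matrix_vector)
  qed
  have KA: "z \<bullet> (K *v z) = (A *v z) \<bullet> (Q *v (A *v z))" for z
    unfolding K_def QS[symmetric] by (simp only: matrix_vector_mul_assoc[symmetric] dual)
  have At: "(norm (transpose A *v x))\<^sup>2 \<le> \<psi> * (norm x)\<^sup>2" for x
  proof -
    have "(norm (transpose A *v x))\<^sup>2 = x \<bullet> (\<Sigma> *v x)"
      unfolding A[symmetric] matrix_vector_mul_assoc[symmetric] power2_norm_eq_inner
      using dual[of x "transpose A" "transpose A *v x"] by (simp only: transpose_transpose)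
    then show ?thesis using \<psi>(1)[of x] by simp
  qed
  have Aw: "(norm (A *v x))\<^sup>2 \<le> \<psi> * (norm x)\<^sup>2" for x
  proof (cases "A *v x = 0")
    case False
    have "(norm (A *v x))\<^sup>2 = x \<bullet> (transpose A *v (A *v x))"
      unfolding dual power2_norm_eq_inner ..
    also have "\<dots> \<le> norm x * norm (transpose A *v (A *v x))"
      by (rule norm_cauchy_schwarz)
    finally have "((norm (A *v x))\<^sup>2)\<^sup>2 \<le> (norm x * norm (transpose A *v (A *v x)))\<^sup>2"
      by (rule power_mono) simp
    also have "\<dots> = (norm x)\<^sup>2 * (norm (transpose A *v (A *v x)))\<^sup>2"
      by (rule power_mult_distrib)
    also have "\<dots> \<le> (norm x)\<^sup>2 * (\<psi> * (norm (A *v x))\<^sup>2)"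
      by (intro mult_left_mono At) simp
    finally show ?thesis using False by (simp add: power2_eq_square mult_ac)
  qed (use \<psi>(2) in simp)
  have small': "\<bar>x \<bullet> (K *v x)\<bar> \<le> 2 / 5 * (norm x)\<^sup>2" for x
  proof -
    have "\<bar>x \<bullet> (K *v x)\<bar> \<le> \<beta> * (norm (A *v x))\<^sup>2"
      unfolding KA by (rule \<beta>(1))
    also have "\<dots> \<le> \<beta> * (\<psi> * (norm x)\<^sup>2)"
      by (intro mult_left_mono Aw \<beta>(2))
    also have "\<dots> \<le> 2 / 5 * (norm x)\<^sup>2"
      using mult_right_mono[OF small, of "(norm x)\<^sup>2"] by (simp add: mult_ac)
    finally show ?thesis .
  qed
  have trK: "trace K = Q \<bullet> \<Sigma>"
  proof -
    have sym: "\<Sigma> $ i $ j = \<Sigma> $ j $ i" for i j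
      by (simp add: A[symmetric] matrix_matrix_mult_def transpose_def mult.commute)
    have "trace K = trace (A ** (transpose A ** S))"
      unfolding K_def by (rule trace_mul_sym)
    also have "\<dots> = trace (\<Sigma> ** S)" by (simp add: A matrix_mul_assoc)
    also have "\<dots> = (\<Sum>i\<in>UNIV. \<Sum>j\<in>UNIV. \<Sigma> $ i $ j * (Q $ j $ i + Q $ i $ j) / 2)"
      by (simp add: trace_def matrix_matrix_mult_def S_def transpose_def)
    also have "\<dots> = ((\<Sum>i\<in>UNIV. \<Sum>j\<in>UNIV. \<Sigma> $ i $ j * Q $ j $ i) + (\<Sum>i\<in>UNIV. \<Sum>j\<in>UNIV. \<Sigma> $ i $ j * Q $ i $ j)) / 2"
      by (simp add: distrib_left add_divide_distrib sum.distrib sum_divide_distrib)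
    also have "(\<Sum>i\<in>UNIV. \<Sum>j\<in>UNIV. \<Sigma> $ i $ j * Q $ j $ i) = (\<Sum>i\<in>UNIV. \<Sum>j\<in>UNIV. \<Sigma> $ i $ j * Q $ i $ j)"
      by (subst sum.swap) (simp only: sym)
    finally show ?thesis by (simp add: inner_vec_def mult.commute)
  qed
  have normK: "(norm K)\<^sup>2 \<le> \<psi>\<^sup>2 * (norm Q)\<^sup>2"
  proof -
    have "norm S \<le> norm Q"
      using norm_triangle_ineq[of Q "transpose Q"] by (simp add: S_def norm_transpose)
    have "(norm K)\<^sup>2 = (norm (transpose A ** (S ** A)))\<^sup>2" by (simp add: K_def matrix_mul_assoc)
    also have "\<dots> \<le> \<psi> * (norm (S ** A))\<^sup>2"
      by (rule norm_matrix_mult_le[OF At])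
    also have "norm (S ** A) = norm (transpose A ** transpose S)"
      using norm_transpose[of "S ** A"] by (simp add: matrix_transpose_mul)
    also have "\<psi> * (norm (transpose A ** transpose S))\<^sup>2 \<le> \<psi> * (\<psi> * (norm (transpose S))\<^sup>2)"
      by (intro mult_left_mono norm_matrix_mult_le[OF At] \<psi>(2))
    also have "\<dots> \<le> \<psi> * (\<psi> * (norm Q)\<^sup>2)"
      using \<open>norm S \<le> norm Q\<close> by (intro mult_left_mono power_mono \<psi>(2)) (simp_all add: tS)
    finally show ?thesis by (simp add: power2_eq_square mult_ac)
  qed
  have cont: "continuous_on UNIV (\<lambda>x. x \<bullet> (Q *v x))" "continuous_on UNIV (\<lambda>z. A *v z)"
    by (intro continuous_intros)+
  have [measurable]: "(\<lambda>x. x \<bullet> (Q *v x)) \<in> borel_measurable borel" "(\<lambda>z. A *v z) \<in> borel_measurable borel"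
    using cont by (auto intro: borel_measurable_continuous_onI)
  have [simp]: "sets std_gaussian = sets borel" by (simp add: std_gaussian_def)
  have meas: "(\<lambda>z. A *v z) \<in> measurable std_gaussian borel"
    by (simp cong: measurable_cong_sets)
  have "(\<integral>\<^sup>+ \<omega>. ennreal (exp (X \<omega> \<bullet> (Q *v X \<omega>))) \<partial>M) = (\<integral>\<^sup>+ x. ennreal (exp (x \<bullet> (Q *v x))) \<partial>distr M borel X)"
    by (simp add: nn_integral_distr)
  also have "\<dots> = (\<integral>\<^sup>+ z. ennreal (exp (z \<bullet> (K *v z))) \<partial>std_gaussian)"
    unfolding law KA using meas by (simp add: nn_integral_distr)
  also have "\<dots> \<le> ennreal (exp (trace K + 27 / 10 * (norm K)\<^sup>2))"
    by (rule nn_integral_std_gaussian_exp_quadratic_form[OF tK small'])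
  also have "\<dots> \<le> ennreal (exp (Q \<bullet> \<Sigma> + 27 / 10 * \<psi>\<^sup>2 * (norm Q)\<^sup>2))"
    using normK by (intro ennreal_leI) (simp add: trK)
  finally show ?thesis .
qed

section \<open>Gaussian averages and moments of sums of squares\<close>

lemma std_normal_even_moment_pochhammer:
  "fact (2 * k) / (2 ^ k * fact k) = (2 ^ k * pochhammer (1 / 2) k :: real)"
proof -
  have "(4::real) ^ k = 2 ^ k * 2 ^ k" by (simp flip: power_mult_distrib)
  then show ?thesis by (simp add: fact_double power_mult)
qed

text \<open>
  After expansion the odd moments vanish; only even powers of \<open>c\<close> remain.
\<close>
lemma nn_integral_std_normal_shifted_even_power:
  fixes s c :: real
  shows "(\<integral>\<^sup>+ v. ennreal ((v * c + s) ^ (2 * k)) \<partial>density lborel std_normal_density) =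
    ennreal (\<Sum>j\<le>k. real (2 * k choose (2 * j)) * c ^ (2 * j) * s ^ (2 * (k - j)) * (fact (2 * j) / (2 ^ j * fact j)))"
proof -
  define \<mu> where "\<mu> i = (if even i then fact i / (2 ^ (i div 2) * fact (i div 2)) else 0 :: real)" for i :: nat
  have mom: "has_bochner_integral lborel (\<lambda>v. std_normal_density v * v ^ i) (\<mu> i)" for i
  proof (cases "even i")
    case True
    then obtain j where "i = 2 * j" by (elim evenE)
    then show ?thesis using std_normal_moment_even[of j] by (simp add: \<mu>_def)
  next
    case False
    then obtain j where "i = 2 * j + 1" by (elim oddE)
    then show ?thesis using std_normal_moment_odd[of j] by (simp add: \<mu>_def)
  qed
  have "has_bochner_integral lborel (\<lambda>v. \<Sum>i\<le>2 * k. real (2 * k choose i) * c ^ i * s ^ (2 * k - i) * (std_normal_density v * v ^ i))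
     (\<Sum>i\<le>2 * k. real (2 * k choose i) * c ^ i * s ^ (2 * k - i) * \<mu> i)"
    by (intro has_bochner_integral_sum has_bochner_integral_mult_right mom)
  moreover have "(\<Sum>i\<le>2 * k. real (2 * k choose i) * c ^ i * s ^ (2 * k - i) * (std_normal_density v * v ^ i)) =
      std_normal_density v * (v * c + s) ^ (2 * k)" for v
    by (simp add: binomial_ring sum_distrib_left power_mult_distrib mult_ac)
  moreover have "(\<Sum>i\<le>2 * k. real (2 * k choose i) * c ^ i * s ^ (2 * k - i) * \<mu> i) =
      (\<Sum>j\<le>k. real (2 * k choose (2 * j)) * c ^ (2 * j) * s ^ (2 * (k - j)) * (fact (2 * j) / (2 ^ j * fact j)))"
  proof -
    have "(\<Sum>i\<le>2 * k. real (2 * k choose i) * c ^ i * s ^ (2 * k - i) * \<mu> i) =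
        (\<Sum>i\<in>(\<lambda>j. 2 * j) ` {..k}. real (2 * k choose i) * c ^ i * s ^ (2 * k - i) * \<mu> i)"
    proof (rule sum.mono_neutral_right)
      show "\<forall>i\<in>{..2 * k} - (\<lambda>j. 2 * j) ` {..k}. real (2 * k choose i) * c ^ i * s ^ (2 * k - i) * \<mu> i = 0"
      proof
        fix i assume i: "i \<in> {..2 * k} - (\<lambda>j. 2 * j) ` {..k}"
        have "odd i"
        proof
          assume "even i"
          then obtain j where "i = 2 * j" by (elim evenE)
          then show False using i by auto
        qed
        then show "real (2 * k choose i) * c ^ i * s ^ (2 * k - i) * \<mu> i = 0"
          by (simp add: \<mu>_def)
      qed
    qed auto
    also have "\<dots> = (\<Sum>j\<le>k. real (2 * k choose (2 * j)) * c ^ (2 * j) * s ^ (2 * k - 2 * j) * \<mu> (2 * j))"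
      by (subst sum.reindex) (auto simp: inj_on_def)
    finally show ?thesis by (simp add: \<mu>_def diff_mult_distrib2)
  qed
  ultimately have "has_bochner_integral lborel (\<lambda>v. std_normal_density v * (v * c + s) ^ (2 * k))
      (\<Sum>j\<le>k. real (2 * k choose (2 * j)) * c ^ (2 * j) * s ^ (2 * (k - j)) * (fact (2 * j) / (2 ^ j * fact j)))"
    by simp
  then have "(\<integral>\<^sup>+ v. ennreal (std_normal_density v * (v * c + s) ^ (2 * k)) \<partial>lborel) =
      ennreal (\<Sum>j\<le>k. real (2 * k choose (2 * j)) * c ^ (2 * j) * s ^ (2 * (k - j)) * (fact (2 * j) / (2 ^ j * fact j)))"
    by (subst nn_integral_eq_integral) (auto simp: has_bochner_integral_iff)
  then show ?thesis
    by (simp add: nn_integral_density ennreal_mult)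
qed

text \<open>
  A linear form in independent standard normal variables is normal with variance \<open>\<Sum>b. (c b)\<^sup>2\<close>. For the
  moments alone, induction over the index set with the binomial theorem suffices.
\<close>
lemma nn_integral_gaussian_linear_form_power:
  fixes c :: "'b \<Rightarrow> real"
  assumes "finite B"
  shows "(\<integral>\<^sup>+ v. ennreal ((\<Sum>b\<in>B. v b * c b) ^ (2 * k)) \<partial>Pi\<^sub>M B (\<lambda>_. density lborel std_normal_density)) =
    ennreal (fact (2 * k) / (2 ^ k * fact k) * (\<Sum>b\<in>B. (c b)\<^sup>2) ^ k)"
  using assms
proof (induction B arbitrary: k rule: finite_induct)
  case empty
  then show ?case
    by (cases k) (simp_all add: PiM_empty nn_integral_count_space_finite emeasure_count_space)
next
  case (insert b B)
  let ?N = "density lborel std_normal_density"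
  let ?m = "\<lambda>k. fact (2 * k) / (2 ^ k * fact k) :: real"
  let ?q = "\<Sum>b\<in>B. (c b)\<^sup>2"
  interpret N: prob_space "?N" by (rule prob_space_normal_density) simp
  interpret N: product_sigma_finite "\<lambda>_::'b. ?N" ..
  have nonneg: "?q \<ge> 0" by (simp add: sum_nonneg)
  have upd: "(\<Sum>a\<in>insert b B. (x(b := y)) a * c a) = y * c b + (\<Sum>a\<in>B. x a * c a)" for x and y :: real
    using insert.hyps by (auto simp: intro!: sum.cong)
  have "(\<integral>\<^sup>+ v. ennreal ((\<Sum>b\<in>insert b B. v b * c b) ^ (2 * k)) \<partial>Pi\<^sub>M (insert b B) (\<lambda>_. ?N)) =
     (\<integral>\<^sup>+ x. (\<integral>\<^sup>+ y. ennreal ((y * c b + (\<Sum>a\<in>B. x a * c a)) ^ (2 * k)) \<partial>?N) \<partial>Pi\<^sub>M B (\<lambda>_. ?N))"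
    using insert.hyps unfolding upd[symmetric] by (intro N.product_nn_integral_insert) (auto intro!: measurable_compose[OF _ measurable_ennreal])
  also have "\<dots> = (\<integral>\<^sup>+ x. (\<Sum>j\<le>k. ennreal (real (2 * k choose (2 * j)) * c b ^ (2 * j) * ?m j) * ennreal ((\<Sum>a\<in>B. x a * c a) ^ (2 * (k - j)))) \<partial>Pi\<^sub>M B (\<lambda>_. ?N))"
    unfolding nn_integral_std_normal_shifted_even_power
  proof (rule nn_integral_cong)
    fix x :: "'b \<Rightarrow> real"
    have nonneg: "0 \<le> real (2 * k choose (2 * j)) * c b ^ (2 * j) * ?m j" "0 \<le> (\<Sum>a\<in>B. x a * c a) ^ (2 * (k - j))" for j
      by (simp_all add: power_mult)
    have "ennreal (\<Sum>j\<le>k. real (2 * k choose (2 * j)) * c b ^ (2 * j) * (\<Sum>a\<in>B. x a * c a) ^ (2 * (k - j)) * ?m j) =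
        ennreal (\<Sum>j\<le>k. (real (2 * k choose (2 * j)) * c b ^ (2 * j) * ?m j) * (\<Sum>a\<in>B. x a * c a) ^ (2 * (k - j)))"
      by (simp add: mult_ac)
    also have "\<dots> = (\<Sum>j\<le>k. ennreal ((real (2 * k choose (2 * j)) * c b ^ (2 * j) * ?m j) * (\<Sum>a\<in>B. x a * c a) ^ (2 * (k - j))))"
      by (rule sum_ennreal[symmetric]) (rule mult_nonneg_nonneg[OF nonneg])
    also have "\<dots> = (\<Sum>j\<le>k. ennreal (real (2 * k choose (2 * j)) * c b ^ (2 * j) * ?m j) * ennreal ((\<Sum>a\<in>B. x a * c a) ^ (2 * (k - j))))"
      by (intro sum.cong refl ennreal_mult[OF nonneg])
    finally show "ennreal (\<Sum>j\<le>k. real (2 * k choose (2 * j)) * c b ^ (2 * j) * (\<Sum>a\<in>B. x a * c a) ^ (2 * (k - j)) * ?m j) =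
        (\<Sum>j\<le>k. ennreal (real (2 * k choose (2 * j)) * c b ^ (2 * j) * ?m j) * ennreal ((\<Sum>a\<in>B. x a * c a) ^ (2 * (k - j))))" .
  qed
  also have "\<dots> = (\<Sum>j\<le>k. ennreal (real (2 * k choose (2 * j)) * c b ^ (2 * j) * ?m j) * ennreal (?m (k - j) * ?q ^ (k - j)))"
    by (simp add: nn_integral_sum nn_integral_cmult insert.IH)
  also have "\<dots> = ennreal (\<Sum>j\<le>k. real (2 * k choose (2 * j)) * c b ^ (2 * j) * ?m j * (?m (k - j) * ?q ^ (k - j)))"
    using nonneg by (simp add: ennreal_mult[symmetric])
  also have "(\<Sum>j\<le>k. real (2 * k choose (2 * j)) * c b ^ (2 * j) * ?m j * (?m (k - j) * ?q ^ (k - j))) =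
      (\<Sum>j\<le>k. ?m k * (real (k choose j) * ((c b)\<^sup>2) ^ j * ?q ^ (k - j)))"
  proof (rule sum.cong[OF refl])
    fix j assume "j \<in> {..k}"
    then have j: "j \<le> k" by simp
    have e1: "real (2 * k choose (2 * j)) = fact (2 * k) / (fact (2 * j) * fact (2 * (k - j)))"
      using j by (simp add: binomial_fact diff_mult_distrib2)
    have e2: "real (k choose j) = fact k / (fact j * fact (k - j))"
      using j by (simp add: binomial_fact)
    have e3: "(2::real) ^ k = 2 ^ j * 2 ^ (k - j)"
      using j by (simp flip: power_add)
    show "real (2 * k choose (2 * j)) * c b ^ (2 * j) * ?m j * (?m (k - j) * ?q ^ (k - j)) =
        ?m k * (real (k choose j) * ((c b)\<^sup>2) ^ j * ?q ^ (k - j))"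
      unfolding e1 e2 e3 power_mult by simp
  qed
  also have "\<dots> = ?m k * ((c b)\<^sup>2 + ?q) ^ k"
    by (simp add: binomial_ring sum_distrib_left)
  finally show ?case
    using insert.hyps by simp
qed

text \<open>
  The moments of the chi-square law with \<open>card B\<close> degrees of freedom; the induction step is the
  Vandermonde identity for rising factorials.
\<close>
lemma nn_integral_chi_square_power:
  assumes "finite B"
  shows "(\<integral>\<^sup>+ v. ennreal ((\<Sum>b\<in>B. (v b)\<^sup>2) ^ k) \<partial>Pi\<^sub>M B (\<lambda>_. density lborel std_normal_density)) =
    ennreal (2 ^ k * pochhammer (real (card B) / 2) k)"
  using assms
proof (induction B arbitrary: k rule: finite_induct)
  case empty
  then show ?case
    by (cases k) (simp_all add: PiM_empty nn_integral_count_space_finite emeasure_count_space pochhammer_rec)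
next
  case (insert b B)
  let ?N = "density lborel std_normal_density"
  interpret N: prob_space "?N" by (rule prob_space_normal_density) simp
  interpret N: product_sigma_finite "\<lambda>_::'a. ?N" ..
  have poch: "0 \<le> pochhammer (x :: real) i" if "0 \<le> x" for x i
    using that by (induction i) (auto simp: pochhammer_Suc)
  have upd: "(\<Sum>a\<in>insert b B. ((x(b := y)) a)\<^sup>2) = y\<^sup>2 + (\<Sum>a\<in>B. (x a)\<^sup>2)" for x and y :: real
    using insert.hyps by (auto simp: intro!: sum.cong)
  have one: "(\<integral>\<^sup>+ y. ennreal ((y\<^sup>2 + s) ^ k) \<partial>?N) =
      (\<Sum>j\<le>k. ennreal (real (k choose j) * (2 ^ j * pochhammer (1 / 2) j)) * ennreal (s ^ (k - j)))" if s: "s \<ge> 0" for s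
  proof -
    have sq: "(\<integral>\<^sup>+ y. ennreal (y ^ (2 * j)) \<partial>?N) = ennreal (2 ^ j * pochhammer (1 / 2) j)" for j
    proof -
      have "(\<integral>\<^sup>+ y. ennreal (std_normal_density y * y ^ (2 * j)) \<partial>lborel) = ennreal (fact (2 * j) / (2 ^ j * fact j))"
        using std_normal_moment_even[of j] by (subst nn_integral_eq_integral) (auto simp: has_bochner_integral_iff)
      then show ?thesis
        unfolding std_normal_even_moment_pochhammer by (simp add: nn_integral_density ennreal_mult)
    qed
    have "(\<integral>\<^sup>+ y. ennreal ((y\<^sup>2 + s) ^ k) \<partial>?N) = (\<integral>\<^sup>+ y. (\<Sum>j\<le>k. ennreal (real (k choose j) * s ^ (k - j)) * ennreal (y ^ (2 * j))) \<partial>?N)"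
    proof (rule nn_integral_cong)
      fix y :: real
      have nonneg: "0 \<le> real (k choose j) * s ^ (k - j)" "0 \<le> y ^ (2 * j)" for j
        using s by (simp_all add: power_mult)
      have "ennreal ((y\<^sup>2 + s) ^ k) = ennreal (\<Sum>j\<le>k. (real (k choose j) * s ^ (k - j)) * y ^ (2 * j))"
        by (simp add: binomial_ring mult_ac flip: power_mult)
      also have "\<dots> = (\<Sum>j\<le>k. ennreal ((real (k choose j) * s ^ (k - j)) * y ^ (2 * j)))"
        by (rule sum_ennreal[symmetric]) (rule mult_nonneg_nonneg[OF nonneg])
      also have "\<dots> = (\<Sum>j\<le>k. ennreal (real (k choose j) * s ^ (k - j)) * ennreal (y ^ (2 * j)))"
        by (intro sum.cong refl ennreal_mult[OF nonneg])
      finally show "ennreal ((y\<^sup>2 + s) ^ k) = (\<Sum>j\<le>k. ennreal (real (k choose j) * s ^ (k - j)) * ennreal (y ^ (2 * j)))" .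
    qed
    also have "\<dots> = (\<Sum>j\<le>k. ennreal (real (k choose j) * s ^ (k - j)) * ennreal (2 ^ j * pochhammer (1 / 2) j))"
      by (simp add: nn_integral_sum nn_integral_cmult sq)
    also have "\<dots> = (\<Sum>j\<le>k. ennreal (real (k choose j) * (2 ^ j * pochhammer (1 / 2) j)) * ennreal (s ^ (k - j)))"
      using s by (intro sum.cong refl) (simp add: ennreal_mult[symmetric] poch mult_ac)
    finally show ?thesis .
  qed
  have "(\<integral>\<^sup>+ v. ennreal ((\<Sum>b\<in>insert b B. (v b)\<^sup>2) ^ k) \<partial>Pi\<^sub>M (insert b B) (\<lambda>_. ?N)) =
     (\<integral>\<^sup>+ x. (\<integral>\<^sup>+ y. ennreal ((y\<^sup>2 + (\<Sum>a\<in>B. (x a)\<^sup>2)) ^ k) \<partial>?N) \<partial>Pi\<^sub>M B (\<lambda>_. ?N))"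
    using insert.hyps unfolding upd[symmetric] by (intro N.product_nn_integral_insert) (auto intro!: measurable_compose[OF _ measurable_ennreal])
  also have "\<dots> = (\<Sum>j\<le>k. ennreal (real (k choose j) * (2 ^ j * pochhammer (1 / 2) j)) * ennreal (2 ^ (k - j) * pochhammer (real (card B) / 2) (k - j)))"
    by (simp add: one sum_nonneg nn_integral_sum nn_integral_cmult insert.IH)
  also have "\<dots> = ennreal (\<Sum>j\<le>k. 2 ^ k * (real (k choose j) * pochhammer (1 / 2) j * pochhammer (real (card B) / 2) (k - j)))"
  proof -
    have "ennreal (real (k choose j) * (2 ^ j * pochhammer (1 / 2) j)) * ennreal (2 ^ (k - j) * pochhammer (real (card B) / 2) (k - j)) =
      ennreal (2 ^ k * (real (k choose j) * pochhammer (1 / 2) j * pochhammer (real (card B) / 2) (k - j)))" if "j \<le> k" for j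
    proof -
      have "(2::real) ^ k = 2 ^ j * 2 ^ (k - j)"
        using that by (simp flip: power_add)
      then show ?thesis by (simp add: ennreal_mult[symmetric] poch mult_ac)
    qed
    then show ?thesis by (simp add: poch)
  qed
  also have "(\<Sum>j\<le>k. 2 ^ k * (real (k choose j) * pochhammer (1 / 2) j * pochhammer (real (card B) / 2) (k - j))) =
      2 ^ k * pochhammer (1 / 2 + real (card B) / 2) k"
    by (simp add: pochhammer_binomial_sum sum_distrib_left)
  finally show ?case
    using insert.hyps by (simp add: add_divide_distrib)
qed

text \<open>
  A bound for the even moments of all linear combinations gives one for the moments of the sum of
  squares: average the hypothesis over Gaussian coefficients \<open>v\<close>, and exchange the order of integration.
\<close>
lemma power_sum_squares_moment_le:
  fixes Y :: "'b \<Rightarrow> 'w \<Rightarrow> real" and C :: real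
  assumes "sigma_finite_measure M" "finite B" and Y: "\<And>b. b \<in> B \<Longrightarrow> Y b \<in> borel_measurable M"
    and C: "0 \<le> C"
    and bound: "\<And>v. (\<integral>\<^sup>+ \<omega>. ennreal ((\<Sum>b\<in>B. v b * Y b \<omega>) ^ (2 * k)) \<partial>M) \<le> ennreal (C * (\<Sum>b\<in>B. (v b)\<^sup>2) ^ k)"
  shows "(\<integral>\<^sup>+ \<omega>. ennreal ((\<Sum>b\<in>B. (Y b \<omega>)\<^sup>2) ^ k) \<partial>M) \<le>
    ennreal (C * 4 ^ k * fact k / fact (2 * k) * pochhammer (real (card B) / 2) k)"
proof -
  let ?N = "density lborel std_normal_density"
  let ?P = "Pi\<^sub>M B (\<lambda>_. ?N)"
  define m where "m = (fact (2 * k) / (2 ^ k * fact k) :: real)"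
  have m: "m > 0" by (simp add: m_def)
  interpret M: sigma_finite_measure M by fact
  interpret N: prob_space "?N" by (rule prob_space_normal_density) simp
  interpret N: product_prob_space "\<lambda>_::'b. ?N" ..
  interpret P: prob_space ?P by (rule prob_space_PiM) (rule prob_space_normal_density, simp)
  interpret pair_sigma_finite M ?P ..
  have [measurable]: "(\<lambda>x. \<Sum>b\<in>B. snd x b * Y b (fst x)) \<in> borel_measurable (M \<Otimes>\<^sub>M ?P)"
    using Y by (intro borel_measurable_sum borel_measurable_times)
      (auto intro!: measurable_compose[OF measurable_fst] measurable_compose[OF measurable_snd])
  have [measurable]: "(\<lambda>\<omega>. \<Sum>b\<in>B. (Y b \<omega>)\<^sup>2) \<in> borel_measurable M"
    using Y by measurable
  have "ennreal m * (\<integral>\<^sup>+ \<omega>. ennreal ((\<Sum>b\<in>B. (Y b \<omega>)\<^sup>2) ^ k) \<partial>M) =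
      (\<integral>\<^sup>+ \<omega>. ennreal (m * (\<Sum>b\<in>B. (Y b \<omega>)\<^sup>2) ^ k) \<partial>M)"
    using m by (subst nn_integral_cmult[symmetric]) (auto simp: ennreal_mult sum_nonneg)
  also have "\<dots> = (\<integral>\<^sup>+ \<omega>. (\<integral>\<^sup>+ v. ennreal ((\<Sum>b\<in>B. v b * Y b \<omega>) ^ (2 * k)) \<partial>?P) \<partial>M)"
    using assms(2) by (simp add: nn_integral_gaussian_linear_form_power m_def)
  also have "\<dots> = (\<integral>\<^sup>+ v. (\<integral>\<^sup>+ \<omega>. ennreal ((\<Sum>b\<in>B. v b * Y b \<omega>) ^ (2 * k)) \<partial>M) \<partial>?P)"
    by (rule Fubini'[symmetric]) (simp add: case_prod_beta)
  also have "\<dots> \<le> (\<integral>\<^sup>+ v. ennreal C * ennreal ((\<Sum>b\<in>B. (v b)\<^sup>2) ^ k) \<partial>?P)"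
    using C bound by (intro nn_integral_mono) (simp add: ennreal_mult[symmetric] sum_nonneg)
  also have "\<dots> = ennreal C * ennreal (2 ^ k * pochhammer (real (card B) / 2) k)"
    using assms(2) by (subst nn_integral_cmult) (auto simp: nn_integral_chi_square_power)
  finally have "ennreal (1 / m) * (ennreal m * (\<integral>\<^sup>+ \<omega>. ennreal ((\<Sum>b\<in>B. (Y b \<omega>)\<^sup>2) ^ k) \<partial>M)) \<le>
      ennreal (1 / m) * (ennreal C * ennreal (2 ^ k * pochhammer (real (card B) / 2) k))"
    by (rule mult_left_mono) simp
  also have "ennreal (1 / m) * (ennreal m * (\<integral>\<^sup>+ \<omega>. ennreal ((\<Sum>b\<in>B. (Y b \<omega>)\<^sup>2) ^ k) \<partial>M)) =
      (\<integral>\<^sup>+ \<omega>. ennreal ((\<Sum>b\<in>B. (Y b \<omega>)\<^sup>2) ^ k) \<partial>M)"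
    using m by (simp add: mult.assoc[symmetric] ennreal_mult[symmetric])
  also have "ennreal (1 / m) * (ennreal C * ennreal (2 ^ k * pochhammer (real (card B) / 2) k)) =
      ennreal (C * 4 ^ k * fact k / fact (2 * k) * pochhammer (real (card B) / 2) k)"
  proof -
    have "0 \<le> pochhammer (real (card B) / 2) k"
      by (induction k) (auto simp: pochhammer_Suc)
    moreover have "(4::real) ^ k = 2 ^ k * 2 ^ k" by (simp flip: power_mult_distrib)
    ultimately show ?thesis
      using m C by (simp add: ennreal_mult[symmetric] m_def)
  qed
  finally show ?thesis .
qed

text \<open>
  Pair the factor \<open>k - i\<close> of the factorial with the factor \<open>s + i\<close>; their product is at most
  \<open>k\<^sup>2 - i\<^sup>2\<close>.
\<close>
lemma fact_pochhammer_le_power: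
  fixes s :: real
  assumes "0 \<le> s" "s \<le> real k"
  shows "fact k * pochhammer s k \<le> real k ^ (2 * k)"
proof -
  have "fact k = (\<Prod>i<k. real k - real i)"
    unfolding fact_prod_rev atLeast0LessThan of_nat_prod by (intro prod.cong refl) (simp add: of_nat_diff)
  moreover have "pochhammer s k = (\<Prod>i<k. s + real i)"
    by (simp add: pochhammer_prod atLeast0LessThan)
  ultimately have "fact k * pochhammer s k = (\<Prod>i<k. (real k - real i) * (s + real i))"
    by (simp add: prod.distrib)
  also have "\<dots> \<le> (\<Prod>i<k. (real k)\<^sup>2)"
  proof (rule prod_mono, intro conjI)
    fix i assume "i \<in> {..<k}"
    then have i: "real i < real k" by simp
    show "0 \<le> (real k - real i) * (s + real i)" using assms i by simp
    have "(real k - real i) * (s + real i) \<le> (real k - real i) * (real k + real i)"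
      using assms i by (intro mult_left_mono) auto
    also have "\<dots> = (real k)\<^sup>2 - (real i)\<^sup>2"
      by (simp add: algebra_simps power2_eq_square)
    finally show "(real k - real i) * (s + real i) \<le> (real k)\<^sup>2"
      using zero_le_power2[of "real i"] by linarith
  qed
  also have "\<dots> = real k ^ (2 * k)" by (simp add: power_mult)
  finally show ?thesis .
qed

text \<open>
  The number \<open>932 / 1000\<close> is \<open>432 / 1000 + 1 / 2\<close>, where the first summand comes from the Laplace
  transform and the second one from the exponent of the final bound. The estimate is nearly sharp at
  \<open>r = 1\<close>.
\<close>
lemma exp_le_square_bound:
  fixes r :: real
  assumes "1 \<le> r" "r \<le> 2"
  shows "exp (932 / 1000 * r) \<le> (16 / 10 * r)\<^sup>2"
proof -
  have e1: "exp (466 / 1000) \<le> (16 / 10 :: real)"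
  proof -
    \<comment> \<open>\<open>1 + y \<le> exp y\<close> is only sharp enough after passing to the 64th root\<close>
    have "(10 / 16 :: real) \<le> (1 + (- 466 / 64000)) ^ 64"
      by (simp add: power_divide)
    also have "\<dots> \<le> exp (- 466 / 64000) ^ 64"
      by (intro power_mono) (use exp_ge_add_one_self[of "- 466 / 64000"] in auto)
    also have "\<dots> = exp (- (466 / 1000))"
      using exp_of_nat_mult[of 64 "- 466 / 64000 :: real"] by simp
    also have "\<dots> = 1 / exp (466 / 1000)"
      by (simp add: exp_minus inverse_eq_divide)
    finally show ?thesis by (simp add: field_simps)
  qed
  have "exp (466 / 1000 * (r - 1)) \<le> 1 + 466 / 1000 * (r - 1) + (466 / 1000 * (r - 1))\<^sup>2"
    using assms by (intro exp_bound) auto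
  also have "\<dots> \<le> r"
  proof -
    have "(r - 1) * (r - 1) \<le> (r - 1) * 1"
      using assms by (intro mult_left_mono) auto
    moreover have "(466 / 1000 * (r - 1))\<^sup>2 = 217156 / 1000000 * ((r - 1) * (r - 1))"
      by (simp add: power2_eq_square algebra_simps)
    ultimately have "(466 / 1000 * (r - 1))\<^sup>2 \<le> 217156 / 1000000 * (r - 1)"
      by simp
    moreover have "(466 / 1000 + 217156 / 1000000) * (r - 1) \<le> 1 * (r - 1)"
      using assms by (intro mult_right_mono) auto
    ultimately show ?thesis unfolding distrib_right mult_1 by linarith
  qed
  finally have e2: "exp (466 / 1000 * (r - 1)) \<le> r" .
  have "exp (466 / 1000 * r) = exp (466 / 1000) * exp (466 / 1000 * (r - 1))"
    by (simp add: field_simps flip: exp_add)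
  also have "\<dots> \<le> 16 / 10 * r"
    using e1 e2 by (intro mult_mono) auto
  finally have "exp (466 / 1000 * r) ^ 2 \<le> (16 / 10 * r)\<^sup>2"
    by (rule power_mono) simp
  moreover have "exp (466 / 1000 * r) ^ 2 = exp (932 / 1000 * r)"
    by (simp flip: exp_of_nat_mult)
  ultimately show ?thesis by simp
qed

text \<open>
  Here \<open>t = \<delta> / \<psi>\<close>, \<open>N = n m\<close>, and \<open>t / 20\<close> is the argument at which the Laplace transform is used; it
  does not exceed \<open>2 / 5\<close> for \<open>t \<le> 8\<close>. Once the first two factors are estimated by
  \<open>k ^ (2 * k)\<close>, the left-hand side becomes the \<open>k\<close>-th power of a function of \<open>r = K / k\<close>.
\<close>
lemma moment_bound_le_exp:
  fixes d t N :: real and k :: nat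
  defines "K \<equiv> N * t\<^sup>2 / 64"
  assumes t: "0 < t" and N: "0 < N" and d: "0 \<le> d" "d \<le> real k"
    and k: "0 < k" "real k \<le> K" "K \<le> 2 * real k"
  shows "fact k * pochhammer d k * (2 / (N * (t / 20) * t)) ^ (2 * k) * exp (27 / 10 * N * (t / 20)\<^sup>2) \<le> exp (- K / 2)"
proof -
  define r where "r = K / real k"
  have r: "1 \<le> r" "r \<le> 2" and K: "K = r * real k"
    using k by (auto simp: r_def field_simps)
  have Nt: "N * t\<^sup>2 = 64 * r * real k" using K by (simp add: K_def field_simps)
  have e: "2 / (N * (t / 20) * t) = 1 / (16 / 10 * r * real k)"
  proof -
    have "N * (t / 20) * t = N * t\<^sup>2 / 20" by (simp add: power2_eq_square)
    then have "N * (t / 20) * t = 64 * r * real k / 20" unfolding Nt .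
    then show ?thesis by (simp only:) simp
  qed
  have e': "27 / 10 * N * (t / 20)\<^sup>2 = 432 / 1000 * (r * real k)"
  proof -
    have "27 / 10 * N * (t / 20)\<^sup>2 = 27 / 4000 * (N * t\<^sup>2)" by (simp add: power_divide)
    then show ?thesis by (simp add: Nt)
  qed
  have "fact k * pochhammer d k * (2 / (N * (t / 20) * t)) ^ (2 * k) \<le> real k ^ (2 * k) * (1 / (16 / 10 * r * real k)) ^ (2 * k)"
    unfolding e using d r by (intro mult_right_mono fact_pochhammer_le_power) auto
  also have "\<dots> = (1 / (16 / 10 * r)) ^ (2 * k)"
    using k by (simp add: power_divide power_mult_distrib)
  also have "\<dots> = 1 / ((16 / 10 * r)\<^sup>2) ^ k"
    by (simp add: power_divide power_mult)
  also have "\<dots> \<le> 1 / exp (932 / 1000 * r) ^ k"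
    using r by (intro divide_left_mono power_mono exp_le_square_bound) auto
  also have "\<dots> = exp (- (932 / 1000 * (r * real k)))"
    by (simp add: exp_minus inverse_eq_divide mult_ac flip: exp_of_nat_mult)
  finally have "fact k * pochhammer d k * (2 / (N * (t / 20) * t)) ^ (2 * k) * exp (27 / 10 * N * (t / 20)\<^sup>2) \<le>
      exp (- (932 / 1000 * (r * real k))) * exp (432 / 1000 * (r * real k))"
    unfolding e' by (rule mult_right_mono) simp
  also have "\<dots> = exp (- K / 2)"
    by (simp add: K flip: exp_add)
  finally show ?thesis .
qed

section \<open>Moments of the empirical covariance matrix\<close>

lemma inner_empirical_covariance:
  "Q \<bullet> empirical_covariance n X \<omega> = (\<Sum>k\<in>{1..n}. X k \<omega> \<bullet> (Q *v X k \<omega>)) / real n"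
proof -
  have "Q \<bullet> ((columnvector x :: real ^ 1 ^ 'a) ** transpose (columnvector x)) = x \<bullet> (Q *v x)" for x :: "real ^ 'a"
    by (simp add: inner_vec_def matrix_matrix_mult_def matrix_vector_mult_def columnvector_def transpose_def
        sum_distrib_left mult_ac)
  then show ?thesis
    by (simp add: empirical_covariance_def inner_sum_right)
qed

text \<open>
  The left-hand side is one of the terms of the power series of \<open>cosh\<close>, all of which are nonnegative.
\<close>
lemma even_power_le_cosh:
  fixes y :: real
  shows "y ^ (2 * k) / fact (2 * k) \<le> (exp y + exp (- y)) / 2"
proof -
  let ?f = "\<lambda>n. if even n then y ^ n /\<^sub>R fact n else 0"
  have s: "?f sums cosh y" by (rule cosh_converges)
  have "y ^ (2 * k) / fact (2 * k) = sum ?f {2 * k}"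
    by (simp add: divide_inverse mult.commute)
  also have "\<dots> \<le> suminf ?f"
    using s by (intro sum_le_suminf) (auto simp: sums_iff zero_le_even_power)
  also have "\<dots> = cosh y"
    using sums_unique[OF s] ..
  finally show ?thesis by (simp only: cosh_field_def)
qed

locale gaussian_sample =
  fixes M :: "'w measure" and X :: "nat \<Rightarrow> 'w \<Rightarrow> real ^ 'p::finite" and \<Sigma> :: "real ^ 'p ^ 'p" and \<psi> :: real and n :: nat
  assumes prob: "prob_space M"
    and indep: "prob_space.indep_vars M (\<lambda>_. borel) X {1..n}"
    and law: "\<And>k. k \<in> {1..n} \<Longrightarrow> has_gaussian_law M (X k) \<Sigma>"
    and \<psi>: "\<And>x. x \<bullet> (\<Sigma> *v x) \<le> \<psi> * (norm x)\<^sup>2" "0 < \<psi>"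
    and n: "0 < n"
begin

definition deviation :: "'w \<Rightarrow> real ^ 'p ^ 'p" where
  "deviation \<omega> = \<Sigma> - empirical_covariance n X \<omega>"

lemma X_measurable: "k \<in> {1..n} \<Longrightarrow> X k \<in> borel_measurable M"
  using law by (auto simp: has_gaussian_law_def)

lemma quadratic_form_measurable: "(\<lambda>x. x \<bullet> (Q *v x)) \<in> borel_measurable borel" for Q :: "real ^ 'p ^ 'p"
  by (intro borel_measurable_continuous_onI continuous_intros)

lemma inner_deviation_measurable [measurable]: "(\<lambda>\<omega>. Q \<bullet> deviation \<omega>) \<in> borel_measurable M"
proof -
  have "(\<lambda>\<omega>. X k \<omega> \<bullet> (Q *v X k \<omega>)) \<in> borel_measurable M" if "k \<in> {1..n}" for k
    using measurable_compose[OF X_measurable[OF that] quadratic_form_measurable] .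
  then show ?thesis
    unfolding deviation_def inner_diff_right inner_empirical_covariance by measurable
qed

text \<open>
  The argument \<open>\<theta>\<close> is distributed over the \<open>n\<close> independent samples, each of which sees only \<open>\<theta> / n\<close>;
  the quadratic terms in the exponent then add up to a multiple of \<open>\<theta>\<^sup>2 / n\<close>.
\<close>
lemma deviation_mgf:
  fixes Q :: "real ^ 'p ^ 'p"
  assumes \<beta>: "\<And>x. \<bar>x \<bullet> (Q *v x)\<bar> \<le> \<beta> * (norm x)\<^sup>2" "0 \<le> \<beta>"
    and small: "\<psi> * (\<bar>\<theta>\<bar> * \<beta> / real n) \<le> 2 / 5"
  shows "(\<integral>\<^sup>+ \<omega>. ennreal (exp (\<theta> * (Q \<bullet> deviation \<omega>))) \<partial>M) \<le>
    ennreal (exp (27 / 10 * \<theta>\<^sup>2 * \<psi>\<^sup>2 * (norm Q)\<^sup>2 / real n))"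
proof -
  interpret prob_space M by (rule prob)
  define c where "c = - \<theta> / real n"
  define R where "R = c *\<^sub>R Q"
  have Rx: "x \<bullet> (R *v x) = c * (x \<bullet> (Q *v x))" for x
    by (simp add: R_def flip: scaleR_matrix_vector_assoc)
  have abs_c: "\<bar>c\<bar> = \<bar>\<theta>\<bar> / real n"
    by (simp add: c_def)
  have R: "\<bar>x \<bullet> (R *v x)\<bar> \<le> (\<bar>\<theta>\<bar> * \<beta> / real n) * (norm x)\<^sup>2" for x
    using mult_left_mono[OF \<beta>(1)[of x], of "\<bar>c\<bar>"] unfolding Rx abs_mult abs_c by simp
  have expand: "exp (\<theta> * (Q \<bullet> deviation \<omega>)) = exp (\<theta> * (Q \<bullet> \<Sigma>)) * (\<Prod>k\<in>{1..n}. exp (X k \<omega> \<bullet> (R *v X k \<omega>)))" for \<omega>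
  proof -
    have "\<theta> * (Q \<bullet> deviation \<omega>) = \<theta> * (Q \<bullet> \<Sigma>) + (\<Sum>k\<in>{1..n}. X k \<omega> \<bullet> (R *v X k \<omega>))"
      unfolding Rx deviation_def inner_diff_right inner_empirical_covariance
      by (simp add: c_def right_diff_distrib sum_negf sum_distrib_left sum_divide_distrib)
    then show ?thesis by (simp add: exp_add exp_sum)
  qed
  have "(\<integral>\<^sup>+ \<omega>. ennreal (exp (\<theta> * (Q \<bullet> deviation \<omega>))) \<partial>M) =
      (\<integral>\<^sup>+ \<omega>. ennreal (exp (\<theta> * (Q \<bullet> \<Sigma>))) * (\<Prod>k\<in>{1..n}. ennreal (exp (X k \<omega> \<bullet> (R *v X k \<omega>)))) \<partial>M)"
    unfolding expand by (subst ennreal_mult) (simp_all add: prod_nonneg prod_ennreal)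
  also have "\<dots> = ennreal (exp (\<theta> * (Q \<bullet> \<Sigma>))) * (\<integral>\<^sup>+ \<omega>. (\<Prod>k\<in>{1..n}. ennreal (exp (X k \<omega> \<bullet> (R *v X k \<omega>)))) \<partial>M)"
  proof (rule nn_integral_cmult)
    have "(\<lambda>\<omega>. X k \<omega> \<bullet> (R *v X k \<omega>)) \<in> borel_measurable M" if "k \<in> {1..n}" for k
      using measurable_compose[OF X_measurable[OF that] quadratic_form_measurable] .
    then show "(\<lambda>\<omega>. \<Prod>k\<in>{1..n}. ennreal (exp (X k \<omega> \<bullet> (R *v X k \<omega>)))) \<in> borel_measurable M"
      by measurable
  qed
  also have "(\<integral>\<^sup>+ \<omega>. (\<Prod>k\<in>{1..n}. ennreal (exp (X k \<omega> \<bullet> (R *v X k \<omega>)))) \<partial>M) =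
      (\<Prod>k\<in>{1..n}. \<integral>\<^sup>+ \<omega>. ennreal (exp (X k \<omega> \<bullet> (R *v X k \<omega>))) \<partial>M)"
  proof (rule indep_vars_nn_integral)
    have "(\<lambda>x. ennreal (exp (x \<bullet> (R *v x)))) \<in> borel_measurable borel"
      using quadratic_form_measurable[of R] by measurable
    then show "indep_vars (\<lambda>_. borel) (\<lambda>k \<omega>. ennreal (exp (X k \<omega> \<bullet> (R *v X k \<omega>)))) {1..n}"
      by (intro indep_vars_compose2[OF indep])
  qed auto
  also have "\<dots> \<le> (\<Prod>k\<in>{1..n}. ennreal (exp (R \<bullet> \<Sigma> + 27 / 10 * \<psi>\<^sup>2 * (norm R)\<^sup>2)))"
    using \<beta>(2) \<psi>(2) small n
    by (intro prod_mono_ennreal gaussian_quadratic_form_mgf[OF law \<psi>(1) _ R]) auto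
  also have "\<dots> = ennreal (exp (real n * (R \<bullet> \<Sigma> + 27 / 10 * \<psi>\<^sup>2 * (norm R)\<^sup>2)))"
    by (simp add: ennreal_power exp_of_nat_mult)
  also have "ennreal (exp (\<theta> * (Q \<bullet> \<Sigma>))) * \<dots> = ennreal (exp (\<theta> * (Q \<bullet> \<Sigma>) + real n * (R \<bullet> \<Sigma> + 27 / 10 * \<psi>\<^sup>2 * (norm R)\<^sup>2)))"
    by (simp add: ennreal_mult exp_add)
  also have "\<theta> * (Q \<bullet> \<Sigma>) + real n * (R \<bullet> \<Sigma> + 27 / 10 * \<psi>\<^sup>2 * (norm R)\<^sup>2) = 27 / 10 * \<theta>\<^sup>2 * \<psi>\<^sup>2 * (norm Q)\<^sup>2 / real n"
    using n by (simp add: R_def c_def power_mult_distrib power_divide distrib_left) (simp add: power2_eq_square field_simps)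
  finally show ?thesis by (simp add: mult_left_mono)
qed

lemma deviation_moment:
  fixes Q :: "real ^ 'p ^ 'p"
  assumes \<beta>: "\<And>x. \<bar>x \<bullet> (Q *v x)\<bar> \<le> \<beta> * (norm x)\<^sup>2" "0 \<le> \<beta>"
    and \<theta>: "0 < \<theta>" and small: "\<psi> * (\<theta> * \<beta> / real n) \<le> 2 / 5"
  shows "(\<integral>\<^sup>+ \<omega>. ennreal ((Q \<bullet> deviation \<omega>) ^ (2 * k)) \<partial>M) \<le>
    ennreal (fact (2 * k) / \<theta> ^ (2 * k) * exp (27 / 10 * \<theta>\<^sup>2 * \<psi>\<^sup>2 * (norm Q)\<^sup>2 / real n))"
proof -
  define C where "C = fact (2 * k) / \<theta> ^ (2 * k) / 2"
  have C: "0 \<le> C" using \<theta> by (simp add: C_def)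
  let ?e = "exp (27 / 10 * \<theta>\<^sup>2 * \<psi>\<^sup>2 * (norm Q)\<^sup>2 / real n)"
  have le: "y ^ (2 * k) \<le> C * exp (\<theta> * y) + C * exp (- \<theta> * y)" for y :: real
  proof -
    have "y ^ (2 * k) = (2 * C) * ((\<theta> * y) ^ (2 * k) / fact (2 * k))"
      using \<theta> by (simp add: C_def power_mult_distrib)
    also have "\<dots> \<le> (2 * C) * ((exp (\<theta> * y) + exp (- (\<theta> * y))) / 2)"
      using C by (intro mult_left_mono even_power_le_cosh) auto
    finally show ?thesis by (simp add: algebra_simps)
  qed
  have "(\<integral>\<^sup>+ \<omega>. ennreal ((Q \<bullet> deviation \<omega>) ^ (2 * k)) \<partial>M) \<le>
      (\<integral>\<^sup>+ \<omega>. ennreal C * ennreal (exp (\<theta> * (Q \<bullet> deviation \<omega>))) + ennreal C * ennreal (exp (- \<theta> * (Q \<bullet> deviation \<omega>))) \<partial>M)"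
  proof (intro nn_integral_mono)
    fix \<omega>
    let ?y = "Q \<bullet> deviation \<omega>"
    have "ennreal (?y ^ (2 * k)) \<le> ennreal (C * exp (\<theta> * ?y) + C * exp (- \<theta> * ?y))"
      by (rule ennreal_leI[OF le])
    also have "\<dots> = ennreal (C * exp (\<theta> * ?y)) + ennreal (C * exp (- \<theta> * ?y))"
      using C by (intro ennreal_plus) auto
    also have "\<dots> = ennreal C * ennreal (exp (\<theta> * ?y)) + ennreal C * ennreal (exp (- \<theta> * ?y))"
      using C by (simp only: ennreal_mult exp_ge_zero)
    finally show "ennreal (?y ^ (2 * k)) \<le> ennreal C * ennreal (exp (\<theta> * ?y)) + ennreal C * ennreal (exp (- \<theta> * ?y))" .
  qed
  also have "\<dots> = ennreal C * (\<integral>\<^sup>+ \<omega>. ennreal (exp (\<theta> * (Q \<bullet> deviation \<omega>))) \<partial>M) + ennreal C * (\<integral>\<^sup>+ \<omega>. ennreal (exp (- \<theta> * (Q \<bullet> deviation \<omega>))) \<partial>M)"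
    by (subst nn_integral_add) (simp_all add: nn_integral_cmult)
  also have "\<dots> \<le> ennreal C * ennreal ?e + ennreal C * ennreal ?e"
  proof (intro add_mono mult_left_mono)
    show "(\<integral>\<^sup>+ \<omega>. ennreal (exp (\<theta> * (Q \<bullet> deviation \<omega>))) \<partial>M) \<le> ennreal ?e"
      using deviation_mgf[OF \<beta>, of \<theta>] \<theta> small by simp
    show "(\<integral>\<^sup>+ \<omega>. ennreal (exp (- \<theta> * (Q \<bullet> deviation \<omega>))) \<partial>M) \<le> ennreal ?e"
      using deviation_mgf[OF \<beta>, of "- \<theta>"] \<theta> small by simp
  qed auto
  also have "\<dots> = ennreal (C * ?e) + ennreal (C * ?e)"
    using C by (simp add: ennreal_mult)
  also have "\<dots> = ennreal (C * ?e + C * ?e)"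
    using C by (intro ennreal_plus[symmetric]) auto
  finally show ?thesis by (simp add: C_def flip: mult_2)
qed

text \<open>
  For the linear combination with coefficients \<open>v\<close> the Laplace transform is evaluated at the largest
  argument for which the relevant eigenvalues do not exceed \<open>x\<close>. This argument is inversely proportional to
  \<open>|v|\<close>, so that the resulting moment bound is homogeneous in \<open>v\<close>, as needed for the averaging.
\<close>
lemma sum_squares_deviation_moment:
  fixes Q :: "'b \<Rightarrow> real ^ 'p ^ 'p" and m x :: real
  assumes B: "finite B" and m: "0 < m" and x: "0 < x" "x \<le> 2 / 5" and k: "0 < k"
    and op: "\<And>v y. norm ((\<Sum>b\<in>B. v b *\<^sub>R Q b) *v y) \<le> sqrt ((\<Sum>b\<in>B. (v b)\<^sup>2) / m) * norm y"
    and frob: "\<And>v. (norm (\<Sum>b\<in>B. v b *\<^sub>R Q b))\<^sup>2 \<le> (\<Sum>b\<in>B. (v b)\<^sup>2)"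
  shows "(\<integral>\<^sup>+ \<omega>. ennreal ((\<Sum>b\<in>B. (Q b \<bullet> deviation \<omega>)\<^sup>2) ^ k) \<partial>M) \<le>
    ennreal (fact k * pochhammer (real (card B) / 2) k * (2 * \<psi> * sqrt m / (x * (real n * m))) ^ (2 * k) *
      exp (27 / 10 * (real n * m) * x\<^sup>2))"
proof -
  interpret prob_space M by (rule prob)
  let ?e = "exp (27 / 10 * (real n * m) * x\<^sup>2)"
  define C where "C = fact (2 * k) * (\<psi> * sqrt m / (x * (real n * m))) ^ (2 * k) * ?e"
  have C: "0 \<le> C" using \<psi>(2) m x by (simp add: C_def)
  have "(\<integral>\<^sup>+ \<omega>. ennreal ((\<Sum>b\<in>B. v b * (Q b \<bullet> deviation \<omega>)) ^ (2 * k)) \<partial>M) \<le> ennreal (C * (\<Sum>b\<in>B. (v b)\<^sup>2) ^ k)" for v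
  proof -
    define S where "S = (\<Sum>b\<in>B. v b *\<^sub>R Q b)"
    define V where "V = (\<Sum>b\<in>B. (v b)\<^sup>2)"
    have "V \<ge> 0" by (simp add: V_def sum_nonneg)
    have S: "(\<Sum>b\<in>B. v b * (Q b \<bullet> deviation \<omega>)) = S \<bullet> deviation \<omega>" for \<omega>
      by (simp add: S_def inner_sum_left)
    have nS: "(norm S)\<^sup>2 \<le> V" using frob[of v] by (simp add: S_def V_def)
    show ?thesis
    proof (cases "V = 0")
      case True
      then have "S = 0" using nS by simp
      then show ?thesis unfolding S using k by (simp add: power_0_left)
    next
      case False
      with \<open>V \<ge> 0\<close> have V: "V > 0" by simp
      define \<beta> where "\<beta> = sqrt (V / m)"
      \<comment> \<open>the choice that makes \<open>\<psi> * (\<theta> * \<beta> / n)\<close> equal to \<open>x\<close>\<close>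
      define \<theta> where "\<theta> = x * sqrt m * real n / (\<psi> * sqrt V)"
      have \<theta>: "0 < \<theta>" using x m n \<psi>(2) V by (simp add: \<theta>_def)
      have \<beta>: "0 \<le> \<beta>" by (simp add: \<beta>_def V less_imp_le m)
      have \<beta>': "\<bar>y \<bullet> (S *v y)\<bar> \<le> \<beta> * (norm y)\<^sup>2" for y
      proof -
        have "\<bar>y \<bullet> (S *v y)\<bar> \<le> norm y * norm (S *v y)" by (rule Cauchy_Schwarz_ineq2)
        also have "\<dots> \<le> norm y * (\<beta> * norm y)"
          using op[of v y] by (intro mult_left_mono) (auto simp: S_def \<beta>_def V_def)
        finally show ?thesis by (simp add: power2_eq_square mult_ac)
      qed
      have "\<psi> * (\<theta> * \<beta> / real n) = x"
        using m n \<psi>(2) V by (simp add: \<theta>_def \<beta>_def real_sqrt_divide)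
      then have small: "\<psi> * (\<theta> * \<beta> / real n) \<le> 2 / 5" using x by simp
      have "(\<integral>\<^sup>+ \<omega>. ennreal ((S \<bullet> deviation \<omega>) ^ (2 * k)) \<partial>M) \<le>
          ennreal (fact (2 * k) / \<theta> ^ (2 * k) * exp (27 / 10 * \<theta>\<^sup>2 * \<psi>\<^sup>2 * (norm S)\<^sup>2 / real n))"
        by (rule deviation_moment[OF \<beta>' \<beta> \<theta> small])
      also have "\<dots> \<le> ennreal (C * V ^ k)"
      proof (rule ennreal_leI)
        have "\<theta>\<^sup>2 * \<psi>\<^sup>2 * V = (real n)\<^sup>2 * m * x\<^sup>2"
          using m n \<psi>(2) V by (simp add: \<theta>_def power_divide power_mult_distrib)
        moreover have "\<theta>\<^sup>2 * \<psi>\<^sup>2 * (norm S)\<^sup>2 \<le> \<theta>\<^sup>2 * \<psi>\<^sup>2 * V"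
          using nS by (intro mult_left_mono) auto
        ultimately have "27 / 10 * (\<theta>\<^sup>2 * \<psi>\<^sup>2 * (norm S)\<^sup>2) / real n \<le> 27 / 10 * ((real n)\<^sup>2 * m * x\<^sup>2) / real n"
          by (intro divide_right_mono mult_left_mono) auto
        also have "\<dots> = 27 / 10 * (real n * m) * x\<^sup>2"
          using n by (simp add: power2_eq_square)
        finally have "27 / 10 * \<theta>\<^sup>2 * \<psi>\<^sup>2 * (norm S)\<^sup>2 / real n \<le> 27 / 10 * (real n * m) * x\<^sup>2"
          by (simp only: mult.assoc)
        then have e: "exp (27 / 10 * \<theta>\<^sup>2 * \<psi>\<^sup>2 * (norm S)\<^sup>2 / real n) \<le> ?e" by simp
        have "1 / \<theta> = \<psi> * sqrt m / (x * (real n * m)) * sqrt V"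
          using m n \<psi>(2) V x by (simp add: \<theta>_def field_simps)
        then have "(1 / \<theta>) ^ (2 * k) = (\<psi> * sqrt m / (x * (real n * m))) ^ (2 * k) * (sqrt V ^ 2) ^ k"
          by (simp only: power_mult_distrib power_mult)
        then have t: "1 / \<theta> ^ (2 * k) = (\<psi> * sqrt m / (x * (real n * m))) ^ (2 * k) * V ^ k"
          using V by (simp add: power_one_over)
        have "fact (2 * k) / \<theta> ^ (2 * k) * exp (27 / 10 * \<theta>\<^sup>2 * \<psi>\<^sup>2 * (norm S)\<^sup>2 / real n) \<le> fact (2 * k) * (1 / \<theta> ^ (2 * k)) * ?e"
          using e \<theta> by (simp add: divide_right_mono mult_left_mono)
        then show "fact (2 * k) / \<theta> ^ (2 * k) * exp (27 / 10 * \<theta>\<^sup>2 * \<psi>\<^sup>2 * (norm S)\<^sup>2 / real n) \<le> C * V ^ k"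
          unfolding t by (simp add: C_def mult_ac)
      qed
      finally show ?thesis unfolding S V_def .
    qed
  qed
  from power_sum_squares_moment_le[OF sigma_finite_measure_axioms B inner_deviation_measurable C this]
  have "(\<integral>\<^sup>+ \<omega>. ennreal ((\<Sum>b\<in>B. (Q b \<bullet> deviation \<omega>)\<^sup>2) ^ k) \<partial>M) \<le>
      ennreal (C * 4 ^ k * fact k / fact (2 * k) * pochhammer (real (card B) / 2) k)" .
  also have "C * 4 ^ k * fact k / fact (2 * k) * pochhammer (real (card B) / 2) k =
      fact k * pochhammer (real (card B) / 2) k * (2 * \<psi> * sqrt m / (x * (real n * m))) ^ (2 * k) * ?e"
  proof -
    have "(2 * \<psi> * sqrt m / (x * (real n * m))) ^ (2 * k) = 4 ^ k * (\<psi> * sqrt m / (x * (real n * m))) ^ (2 * k)"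
      by (simp add: power_mult_distrib power_divide power_mult[of 2 2 k])
    then show ?thesis by (simp add: C_def)
  qed
  finally show ?thesis .
qed

text \<open>
  The exponent \<open>k\<close> depends on \<open>m\<close> but not on the matrices \<open>Q\<close>, so it is the same for all
  constituents in one equivalence class.
\<close>
lemma sum_squares_deviation_tail_moment:
  fixes Q :: "'b \<Rightarrow> real ^ 'p ^ 'p" and m \<delta> :: real and s :: nat
  defines "k \<equiv> nat \<lfloor>real n * m * \<delta>\<^sup>2 / (64 * \<psi>\<^sup>2)\<rfloor>"
  assumes B: "finite B" and m: "0 < m" and \<delta>: "0 < \<delta>" "\<delta> \<le> 8 * \<psi>"
    and s: "0 < s" "card B \<le> 2 * s" and large: "64 * real s * \<psi>\<^sup>2 / (m * \<delta>\<^sup>2) \<le> real n"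
    and op: "\<And>v y. norm ((\<Sum>b\<in>B. v b *\<^sub>R Q b) *v y) \<le> sqrt ((\<Sum>b\<in>B. (v b)\<^sup>2) / m) * norm y"
    and frob: "\<And>v. (norm (\<Sum>b\<in>B. v b *\<^sub>R Q b))\<^sup>2 \<le> (\<Sum>b\<in>B. (v b)\<^sup>2)"
  shows "(\<integral>\<^sup>+ \<omega>. ennreal (((\<Sum>b\<in>B. (Q b \<bullet> deviation \<omega>)\<^sup>2) / (m * \<delta>\<^sup>2)) ^ k) \<partial>M) \<le>
    ennreal (exp (- (real n * m * \<delta>\<^sup>2 / (128 * \<psi>\<^sup>2))))"
proof -
  define t where "t = \<delta> / \<psi>"
  define N where "N = real n * m"
  have t: "0 < t" "t \<le> 8" using \<delta> \<psi>(2) by (simp_all add: t_def field_simps)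
  have N: "0 < N" using n m by (simp add: N_def)
  have K: "real n * m * \<delta>\<^sup>2 / (64 * \<psi>\<^sup>2) = N * t\<^sup>2 / 64"
    by (simp add: N_def t_def power_divide)
  have sK: "real s \<le> N * t\<^sup>2 / 64"
    unfolding K[symmetric] using large m \<delta> \<psi>(2) by (simp add: field_simps)
  have k: "real k \<le> N * t\<^sup>2 / 64" "N * t\<^sup>2 / 64 < real k + 1" "s \<le> k"
    using sK s(1) unfolding k_def K by linarith+
  have k0: "0 < k" using k(3) s(1) by simp
  have ck: "real (card B) / 2 \<le> real k" using s(2) k(3) by linarith
  have mom: "(\<integral>\<^sup>+ \<omega>. ennreal ((\<Sum>b\<in>B. (Q b \<bullet> deviation \<omega>)\<^sup>2) ^ k) \<partial>M) \<le>
    ennreal (fact k * pochhammer (real (card B) / 2) k * (2 * \<psi> * sqrt m / (t / 20 * N)) ^ (2 * k) *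
      exp (27 / 10 * N * (t / 20)\<^sup>2))"
    unfolding N_def using t by (intro sum_squares_deviation_moment[OF B m _ _ k0 op frob]) auto
  define c where "c = (1 / (m * \<delta>\<^sup>2)) ^ k"
  have c: "0 \<le> c" using m by (simp add: c_def)
  have "(\<integral>\<^sup>+ \<omega>. ennreal (((\<Sum>b\<in>B. (Q b \<bullet> deviation \<omega>)\<^sup>2) / (m * \<delta>\<^sup>2)) ^ k) \<partial>M) =
      (\<integral>\<^sup>+ \<omega>. ennreal c * ennreal ((\<Sum>b\<in>B. (Q b \<bullet> deviation \<omega>)\<^sup>2) ^ k) \<partial>M)"
    using c by (simp add: ennreal_mult[symmetric] sum_nonneg c_def power_divide mult.commute)
  also have "\<dots> = ennreal c * (\<integral>\<^sup>+ \<omega>. ennreal ((\<Sum>b\<in>B. (Q b \<bullet> deviation \<omega>)\<^sup>2) ^ k) \<partial>M)"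
    by (rule nn_integral_cmult) measurable
  also have "\<dots> \<le> ennreal c * ennreal (fact k * pochhammer (real (card B) / 2) k * (2 * \<psi> * sqrt m / (t / 20 * N)) ^ (2 * k) *
      exp (27 / 10 * N * (t / 20)\<^sup>2))"
    by (intro mult_left_mono mom) simp
  also have "\<dots> = ennreal (c * (fact k * pochhammer (real (card B) / 2) k * (2 * \<psi> * sqrt m / (t / 20 * N)) ^ (2 * k) *
      exp (27 / 10 * N * (t / 20)\<^sup>2)))"
    using c by (simp add: ennreal_mult')
  also have "c * (fact k * pochhammer (real (card B) / 2) k * (2 * \<psi> * sqrt m / (t / 20 * N)) ^ (2 * k) *
      exp (27 / 10 * N * (t / 20)\<^sup>2)) =
      fact k * pochhammer (real (card B) / 2) k * (2 / (N * (t / 20) * t)) ^ (2 * k) * exp (27 / 10 * N * (t / 20)\<^sup>2)"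
  proof -
    have "c * (2 * \<psi> * sqrt m / (t / 20 * N)) ^ (2 * k) = ((2 * \<psi> * sqrt m / (t / 20 * N))\<^sup>2 / (m * \<delta>\<^sup>2)) ^ k"
      by (simp add: c_def power_mult power_divide power_mult_distrib)
    also have "(2 * \<psi> * sqrt m / (t / 20 * N))\<^sup>2 / (m * \<delta>\<^sup>2) = (2 / (N * (t / 20) * t))\<^sup>2"
      using m N t \<delta> \<psi>(2) by (simp add: power_divide power_mult_distrib t_def field_simps)
    finally have f: "c * (2 * \<psi> * sqrt m / (t / 20 * N)) ^ (2 * k) = (2 / (N * (t / 20) * t)) ^ (2 * k)"
      by (simp only: power_mult)
    show ?thesis unfolding f[symmetric] by (simp only: mult_ac)
  qed
  also have "ennreal \<dots> \<le> ennreal (exp (- (N * t\<^sup>2 / 64) / 2))"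
  proof (rule ennreal_leI, rule moment_bound_le_exp)
    have "1 \<le> real k" using k0 by simp
    then show "N * t\<^sup>2 / 64 \<le> 2 * real k" using k(2) by linarith
  qed (use t N ck k k0 in auto)
  also have "- (N * t\<^sup>2 / 64) / 2 = - (real n * m * \<delta>\<^sup>2 / (128 * \<psi>\<^sup>2))"
    using K by (simp add: field_simps)
  finally show ?thesis .
qed

end

section \<open>Adjoint matrices and orthogonal projections\<close>

definition adjoint_matrix :: "complex ^ 'n ^ 'm \<Rightarrow> complex ^ 'm ^ 'n" where
  "adjoint_matrix A = (\<chi> i j. cnj (A $ j $ i))"

text \<open>
  The library's \<open>*s\<close> multiplies a vector by a scalar of its entry type, and the entries of a matrix in
  this sense are its rows; hence a separate multiplication of matrices by complex numbers.
\<close>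
definition complex_scale :: "complex \<Rightarrow> complex ^ 'n ^ 'm \<Rightarrow> complex ^ 'n ^ 'm" where
  "complex_scale c A = (\<chi> i j. c * A $ i $ j)"

lemma inner_complex_mult: "(a * b) \<bullet> c = b \<bullet> (cnj a * c)" for a b c :: complex
  by (simp add: inner_complex_def algebra_simps)

lemma adjoint_matrix_dual: "(A *v x) \<bullet> y = x \<bullet> (adjoint_matrix A *v y)"
proof -
  have "(A *v x) \<bullet> y = (\<Sum>i\<in>UNIV. \<Sum>j\<in>UNIV. (A $ i $ j * x $ j) \<bullet> y $ i)"
    by (simp add: inner_vec_def matrix_vector_mult_def inner_sum_left)
  also have "\<dots> = (\<Sum>j\<in>UNIV. \<Sum>i\<in>UNIV. (A $ i $ j * x $ j) \<bullet> y $ i)"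
    by (rule sum.swap)
  also have "\<dots> = x \<bullet> (adjoint_matrix A *v y)"
    by (simp add: inner_vec_def matrix_vector_mult_def adjoint_matrix_def inner_sum_right inner_complex_mult)
  finally show ?thesis .
qed

lemma adjoint_adjoint [simp]: "adjoint_matrix (adjoint_matrix A) = A"
  by (simp add: adjoint_matrix_def vec_eq_iff)

lemma adjoint_mult: "adjoint_matrix (A ** B) = adjoint_matrix B ** adjoint_matrix A"
  by (simp add: adjoint_matrix_def matrix_matrix_mult_def vec_eq_iff mult.commute)

lemma adjoint_add: "adjoint_matrix (A + B) = adjoint_matrix A + adjoint_matrix B"
  and adjoint_diff: "adjoint_matrix (A - B) = adjoint_matrix A - adjoint_matrix B"
  and adjoint_scale: "adjoint_matrix (complex_scale c A) = complex_scale (cnj c) (adjoint_matrix A)"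
  and adjoint_zero: "adjoint_matrix 0 = 0"
  by (simp_all add: adjoint_matrix_def complex_scale_def vec_eq_iff)

lemma adjoint_eqI:
  assumes "\<And>x y. (A *v x) \<bullet> y = x \<bullet> (B *v y)"
  shows "adjoint_matrix A = B"
proof -
  have "adjoint_matrix A *v y = B *v y" for y
  proof (rule vector_eq_ldot[THEN iffD1], rule allI)
    show "x \<bullet> (adjoint_matrix A *v y) = x \<bullet> (B *v y)" for x
      using assms[of x y] by (simp only: adjoint_matrix_dual)
  qed
  then show ?thesis by (simp add: matrix_eq)
qed

lemma inner_matrix_mult_right:
  fixes A :: "complex ^ 'k ^ 'm" and B :: "complex ^ 'n ^ 'm"
  shows "(A ** C) \<bullet> B = A \<bullet> (B ** adjoint_matrix C)"
proof -
  have e: "(a * c) \<bullet> b = a \<bullet> (b * cnj c)" for a b c :: complex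
    by (simp add: inner_complex_def algebra_simps)
  have "(A ** C) \<bullet> B = (\<Sum>i\<in>UNIV. \<Sum>k\<in>UNIV. \<Sum>j\<in>UNIV. (A $ i $ j * C $ j $ k) \<bullet> B $ i $ k)"
    by (simp add: inner_vec_def matrix_matrix_mult_def inner_sum_left)
  also have "\<dots> = (\<Sum>i\<in>UNIV. \<Sum>j\<in>UNIV. \<Sum>k\<in>UNIV. (A $ i $ j * C $ j $ k) \<bullet> B $ i $ k)"
    by (intro sum.cong refl sum.swap)
  also have "\<dots> = A \<bullet> (B ** adjoint_matrix C)"
    by (simp add: inner_vec_def matrix_matrix_mult_def adjoint_matrix_def inner_sum_right e)
  finally show ?thesis .
qed

lemma complex_scale_mult:
  "complex_scale c A *v x = c *s (A *v x)" "complex_scale c A ** B = complex_scale c (A ** B)"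
  "B ** complex_scale c A = complex_scale c (B ** A)"
  by (simp_all add: complex_scale_def matrix_vector_mult_def matrix_matrix_mult_def vec_eq_iff
      sum_distrib_left mult_ac)

lemma complex_scale_eq_scaleR: "complex_scale (complex_of_real c) A = c *\<^sub>R A"
  by (simp add: complex_scale_def vec_eq_iff complex_eq_iff)

lemma complex_scale_scale: "complex_scale c (complex_scale d A) = complex_scale (c * d) A"
  by (simp add: complex_scale_def vec_eq_iff algebra_simps)

lemma scaleR_eq_scale: "c *\<^sub>R v = complex_of_real c *s (v :: complex ^ 'p)"
  by (simp add: vec_eq_iff complex_eq_iff)

lemma complex_subspace_imp_real:
  assumes V: "vec.subspace (V :: (complex ^ 'p) set)"
  shows "subspace V"
proof (rule subspaceI)
  show "c *\<^sub>R x \<in> V" if "x \<in> V" for c x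
    unfolding scaleR_eq_scale by (rule vec.subspace_scale[OF V that])
qed (use vec.subspace_0[OF V] vec.subspace_add[OF V] in blast)+

text \<open>
  Orthogonality refers to the real inner product on \<open>complex ^ 'p\<close>, the real part of the Hermitian one.
  For a complex subspace, which contains \<open>\<i> *s u\<close> along with \<open>u\<close>, this is the same as Hermitian
  orthogonality.
\<close>
definition orth_proj :: "(complex ^ 'p::finite) set \<Rightarrow> complex ^ 'p ^ 'p" where
  "orth_proj V = (SOME P. \<forall>x. P *v x \<in> V \<and> (\<forall>u\<in>V. (x - P *v x) \<bullet> u = 0))"

context
  fixes V :: "(complex ^ 'p::finite) set"
  assumes V: "vec.subspace V"
begin

lemma orth_proj_point_unique:
  assumes "y \<in> V" "\<And>u. u \<in> V \<Longrightarrow> (x - y) \<bullet> u = 0" "y' \<in> V" "\<And>u. u \<in> V \<Longrightarrow> (x - y') \<bullet> u = 0"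
  shows "y = y'"
proof -
  have "y - y' \<in> V" using assms V by (simp add: vec.subspace_diff)
  then have "(x - y') \<bullet> (y - y') - (x - y) \<bullet> (y - y') = 0" using assms by simp
  then have "(y - y') \<bullet> (y - y') = 0" by (simp add: inner_diff_left)
  then show ?thesis by simp
qed

text \<open>
  A real orthogonal projection onto a complex subspace is complex linear because it is unique and the
  orthogonality relation is preserved under complex scalars.
\<close>
lemma orth_proj_exists: "\<exists>P. \<forall>x. P *v x \<in> V \<and> (\<forall>u\<in>V. (x - P *v x) \<bullet> u = 0)"
proof -
  have spanV: "span V = V"
    using complex_subspace_imp_real[OF V] by (rule span_eq_iff[THEN iffD2])
  have ex: "\<exists>y. y \<in> V \<and> (\<forall>u\<in>V. (x - y) \<bullet> u = 0)" for x
  proof -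
    obtain y z where "y \<in> span V" "\<And>w. w \<in> span V \<Longrightarrow> orthogonal z w" "x = y + z"
      using orthogonal_subspace_decomp_exists[of V x] by blast
    then show ?thesis by (intro exI[of _ y]) (auto simp: spanV orthogonal_def)
  qed
  define f where "f x = (SOME y. y \<in> V \<and> (\<forall>u\<in>V. (x - y) \<bullet> u = 0))" for x
  have f: "f x \<in> V" "u \<in> V \<Longrightarrow> (x - f x) \<bullet> u = 0" for x u
    using someI_ex[OF ex[of x]] by (auto simp: f_def)
  have lin: "Vector_Spaces.linear (*s) (*s) f"
  proof (rule Vector_Spaces.linear_iff[THEN iffD2], intro conjI allI)
    show "f (x + y) = f x + f y" for x y
    proof (rule orth_proj_point_unique[OF f])
      show "f x + f y \<in> V" using f V by (simp add: vec.subspace_add)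
      show "(x + y - (f x + f y)) \<bullet> u = 0" if "u \<in> V" for u
        using f(2)[OF that, of x] f(2)[OF that, of y] by (simp add: inner_diff_left inner_add_left)
    qed
    show "f (c *s x) = c *s f x" for c x
    proof (rule orth_proj_point_unique[OF f])
      show "c *s f x \<in> V" using f V by (simp add: vec.subspace_scale)
      show "(c *s x - c *s f x) \<bullet> u = 0" if "u \<in> V" for u
      proof -
        have "c *s x - c *s f x = c *s (x - f x)"
          by (rule vec.scale_right_diff_distrib[symmetric])
        then show ?thesis
          using f(2)[OF vec.subspace_scale[OF V that]] by (simp only: complex_inner_scale)
      qed
    qed
  qed (unfold_locales)
  show ?thesis
    by (intro exI[of _ "matrix f"], unfold matrix_works[OF lin]) (use f in blast)
qed

lemma orth_proj_in: "orth_proj V *v x \<in> V"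
  and orth_proj_orthogonal: "u \<in> V \<Longrightarrow> (x - orth_proj V *v x) \<bullet> u = 0"
  using someI_ex[OF orth_proj_exists] unfolding orth_proj_def by blast+

lemma orth_proj_eqI: "y \<in> V \<Longrightarrow> (\<And>u. u \<in> V \<Longrightarrow> (x - y) \<bullet> u = 0) \<Longrightarrow> orth_proj V *v x = y"
  by (rule orth_proj_point_unique[OF orth_proj_in orth_proj_orthogonal])

lemma orth_proj_id: "x \<in> V \<Longrightarrow> orth_proj V *v x = x"
  by (rule orth_proj_eqI) auto

lemma orth_proj_idem: "orth_proj V ** orth_proj V = orth_proj V"
  unfolding matrix_eq matrix_vector_mul_assoc[symmetric] by (simp add: orth_proj_id orth_proj_in)

lemma orth_proj_self_adjoint: "adjoint_matrix (orth_proj V) = orth_proj V"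
proof (rule adjoint_eqI)
  fix x y
  have "(orth_proj V *v x) \<bullet> y = (orth_proj V *v x) \<bullet> (orth_proj V *v y)"
    using orth_proj_orthogonal[OF orth_proj_in, of y x]
    by (simp add: inner_diff_left inner_commute[of "orth_proj V *v x"])
  also have "\<dots> = x \<bullet> (orth_proj V *v y)"
    using orth_proj_orthogonal[OF orth_proj_in, of x y] by (simp add: inner_diff_left)
  finally show "(orth_proj V *v x) \<bullet> y = x \<bullet> (orth_proj V *v y)" .
qed

lemma inner_orth_proj: "x \<bullet> (orth_proj V *v x) = (norm (orth_proj V *v x))\<^sup>2"
  using orth_proj_orthogonal[OF orth_proj_in, of x x] unfolding power2_norm_eq_inner by (simp add: inner_diff_left)

lemma norm_orth_proj_le: "norm (orth_proj V *v x) \<le> norm x"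
proof -
  have "(norm (orth_proj V *v x))\<^sup>2 \<le> norm x * norm (orth_proj V *v x)"
    using norm_cauchy_schwarz[of x "orth_proj V *v x"] by (simp only: inner_orth_proj)
  then show ?thesis by (cases "norm (orth_proj V *v x) = 0") (auto simp: power2_eq_square)
qed

lemma orth_proj_mult: "(\<And>x. A *v x \<in> V) \<Longrightarrow> orth_proj V ** A = A"
  unfolding matrix_eq matrix_vector_mul_assoc[symmetric] by (simp add: orth_proj_id)

end

lemma orth_proj_sum:
  fixes V W :: "(complex ^ 'p::finite) set"
  assumes V: "vec.subspace V" and W: "vec.subspace W" and U: "vec.subspace U"
    and orth: "\<And>v w. v \<in> V \<Longrightarrow> w \<in> W \<Longrightarrow> v \<bullet> w = 0"
    and sub: "V \<subseteq> U" "W \<subseteq> U" and sum: "\<And>u. u \<in> U \<Longrightarrow> \<exists>v\<in>V. \<exists>w\<in>W. u = v + w"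
  shows "orth_proj U = orth_proj V + orth_proj W"
proof -
  have "orth_proj U *v x = orth_proj V *v x + orth_proj W *v x" for x
  proof (rule orth_proj_eqI[OF U])
    show "orth_proj V *v x + orth_proj W *v x \<in> U"
      using orth_proj_in[OF V, of x] orth_proj_in[OF W, of x] sub by (intro vec.subspace_add[OF U]) auto
    fix u assume "u \<in> U"
    then obtain v w where vw: "v \<in> V" "w \<in> W" "u = v + w" using sum by blast
    have "(orth_proj W *v x) \<bullet> v = 0" "(orth_proj V *v x) \<bullet> w = 0"
      using orth[OF vw(1) orth_proj_in[OF W, of x]] orth[OF orth_proj_in[OF V, of x] vw(2)]
      by (simp_all add: inner_commute)
    then show "(x - (orth_proj V *v x + orth_proj W *v x)) \<bullet> u = 0"
      using orth_proj_orthogonal[OF V vw(1), of x] orth_proj_orthogonal[OF W vw(2), of x]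
      by (simp add: vw(3) inner_add_right inner_diff_left inner_add_left)
  qed
  then show ?thesis by (simp add: matrix_eq matrix_vector_mult_add_rdistrib)
qed

lemma orthogonal_complement_decomposition:
  fixes V U :: "(complex ^ 'p::finite) set"
  assumes V: "vec.subspace V" and U: "vec.subspace U" and sub: "V \<subseteq> U"
  defines "W \<equiv> {u\<in>U. \<forall>v\<in>V. u \<bullet> v = 0}"
  shows "vec.subspace W" "orth_proj U = orth_proj V + orth_proj W"
    "\<And>u. u \<in> U \<Longrightarrow> \<exists>v\<in>V. \<exists>w\<in>W. u = v + w"
proof -
  show W: "vec.subspace W"
    unfolding W_def vec.subspace_def
    using vec.subspace_0[OF U] vec.subspace_add[OF U] vec.subspace_scale[OF U]
      vec.subspace_scale[OF V]
    by (auto simp: inner_add_left complex_inner_scale)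
  show dec: "\<exists>v\<in>V. \<exists>w\<in>W. u = v + w" if "u \<in> U" for u
  proof (intro bexI)
    show "u = orth_proj V *v u + (u - orth_proj V *v u)" by simp
    have "orth_proj V *v u \<in> U" using orth_proj_in[OF V] sub by blast
    then show "u - orth_proj V *v u \<in> W"
      unfolding W_def using orth_proj_orthogonal[OF V] vec.subspace_diff[OF U that] by auto
    show "orth_proj V *v u \<in> V" by (rule orth_proj_in[OF V])
  qed
  show "orth_proj U = orth_proj V + orth_proj W"
    by (rule orth_proj_sum[OF V W U _ sub _ dec]) (auto simp: W_def inner_commute)
qed

lemma matrix_mult_axis:
  fixes A :: "'a::semiring_1 ^ 'n ^ 'm"
  shows "A *v axis j 1 = column j A"
proof -
  have "A $ i $ k * axis j 1 $ k = (if k = j then A $ i $ j else 0)" for i k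
    by (simp add: axis_def)
  then show ?thesis by (simp add: matrix_vector_mult_def column_def)
qed

lemma norm_orth_proj_line:
  fixes b :: "complex ^ 'p::finite"
  assumes b: "b \<noteq> 0"
  shows "(norm (orth_proj (vec.span {b})))\<^sup>2 = 1"
proof -
  define r where "r = (norm b)\<^sup>2"
  have r: "r > 0" using b by (simp add: r_def)
  have nb: "r = (\<Sum>j\<in>UNIV. (cmod (b $ j))\<^sup>2)"
    unfolding r_def power2_norm_eq_inner inner_vec_def by simp
  have scale: "(c *s b) \<bullet> (a *s b) = Re (cnj c * a) * r" for a c
  proof -
    have "(c * z) \<bullet> (a * z) = Re (cnj c * a) * (cmod z)\<^sup>2" for z
      unfolding cmod_power2 by (simp add: inner_complex_def power2_eq_square algebra_simps)
    then show ?thesis by (simp add: inner_vec_def nb sum_distrib_left)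
  qed
  have col: "column j (orth_proj (vec.span {b})) = (cnj (b $ j) / complex_of_real r) *s b" for j
  proof -
    have "orth_proj (vec.span {b}) *v axis j 1 = (cnj (b $ j) / complex_of_real r) *s b"
    proof (rule orth_proj_eqI)
      show "(cnj (b $ j) / complex_of_real r) *s b \<in> vec.span {b}"
        by (intro vec.span_scale vec.span_base) simp
      fix u assume "u \<in> vec.span {b}"
      then obtain a where u: "u = a *s b" by (auto simp: vec.span_singleton)
      have "axis j 1 \<bullet> u = Re (a * b $ j)"
        by (simp add: u inner_axis' inner_complex_def)
      moreover have "((cnj (b $ j) / complex_of_real r) *s b) \<bullet> u = Re (b $ j / complex_of_real r * a) * r"
        unfolding u scale by simp
      moreover have "Re (b $ j / complex_of_real r * a) = Re (a * b $ j) / r"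
        by (simp add: Re_divide_of_real[symmetric] mult.commute del: Re_divide_of_real)
      ultimately show "(axis j 1 - (cnj (b $ j) / complex_of_real r) *s b) \<bullet> u = 0"
        using r by (simp add: inner_diff_left)
    qed (rule vec.subspace_span)
    then show ?thesis by (simp add: matrix_mult_axis)
  qed
  have "(norm (column j (orth_proj (vec.span {b}))))\<^sup>2 = (cmod (b $ j))\<^sup>2 / r" for j
  proof -
    let ?c = "cnj (b $ j) / complex_of_real r"
    have "(norm (?c *s b))\<^sup>2 = Re (cnj ?c * ?c) * r"
      by (simp only: power2_norm_eq_inner scale)
    also have "Re (cnj ?c * ?c) = (cmod ?c)\<^sup>2"
      unfolding cmod_power2 by (simp add: power2_eq_square add_divide_distrib)
    also have "cmod ?c = cmod (b $ j) / r"
      using r by (simp add: norm_divide)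
    finally show ?thesis
      using r by (simp add: col power_divide power2_eq_square)
  qed
  then show ?thesis
    using r by (simp add: norm_matrix_columns nb[symmetric] sum_divide_distrib[symmetric])
qed

text \<open>
  The squared Frobenius norm of a projection is its trace. Splitting off one line after the other avoids
  the choice of an orthonormal basis over the complex numbers.
\<close>
lemma norm_orth_proj_eq_dim:
  fixes V :: "(complex ^ 'p::finite) set"
  shows "vec.subspace V \<Longrightarrow> (norm (orth_proj V))\<^sup>2 = real (vec.dim V)"
proof (induction "vec.dim V" arbitrary: V rule: less_induct)
  case less
  note V = less.prems
  show ?case
  proof (cases "V = {0}")
    case True
    have "orth_proj V *v x = 0" for x
      using orth_proj_in[OF V, of x] True by simp
    then have "orth_proj V = 0" by (simp add: matrix_eq)
    then show ?thesis using True by simp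
  next
    case False
    then obtain b where b: "b \<in> V" "b \<noteq> 0" using vec.subspace_0[OF V] by blast
    define L where "L = vec.span {b}"
    define W where "W = {u\<in>V. \<forall>v\<in>L. u \<bullet> v = 0}"
    have L: "vec.subspace L" by (simp add: L_def)
    have LV: "L \<subseteq> V" unfolding L_def using b V by (intro vec.span_minimal) auto
    note dec = orthogonal_complement_decomposition[OF L V LV, folded W_def]
    have LW: "L \<inter> W = {0}"
      using vec.subspace_0[OF L] vec.subspace_0[OF dec(1)] by (auto simp: W_def)
    have "V = {x + y |x y. x \<in> L \<and> y \<in> W}"
      using dec(3) LV vec.subspace_add[OF V] by (auto simp: W_def) blast
    then have dimV: "vec.dim V = vec.dim L + vec.dim W"
      using vec.dim_sums_Int[OF L dec(1)] LW by simp
    have "vec.dim L = 1"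
      unfolding L_def using b vec.dim_eq_card_independent[of "{b}"] by simp
    then have "(norm (orth_proj W))\<^sup>2 = real (vec.dim W)"
      using less.hyps[OF _ dec(1)] dimV by simp
    moreover have "orth_proj L \<bullet> orth_proj W = 0"
    proof -
      have "orth_proj W ** orth_proj L = 0"
      proof -
        have "orth_proj W *v (orth_proj L *v x) = 0" for x
          using orth_proj_in[OF L, of x] vec.subspace_0[OF dec(1)]
          by (intro orth_proj_eqI[OF dec(1)]) (auto simp: W_def inner_commute)
        then show ?thesis by (simp add: matrix_eq matrix_vector_mul_assoc)
      qed
      then show ?thesis
        using inner_matrix_mult_right[of "orth_proj W" "orth_proj L" "mat 1"]
          inner_matrix_mult_right[of "mat 1" "orth_proj L" "orth_proj W"] orth_proj_self_adjoint[OF L]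
        by simp
    qed
    then have "(norm (orth_proj L + orth_proj W))\<^sup>2 = (norm (orth_proj L))\<^sup>2 + (norm (orth_proj W))\<^sup>2"
      by (intro norm_add_Pythagorean) (simp add: orthogonal_def)
    ultimately show ?thesis
      using norm_orth_proj_line[OF b(2), folded L_def] \<open>vec.dim L = 1\<close>
      by (simp add: dec(2) dimV)
  qed
qed

section \<open>Schur's lemma for permutation representations\<close>

lemma perm_matrix_mult_nth:
  fixes Y :: "'a::semiring_1 ^ 'p::finite ^ 'p"
  assumes "bij g"
  shows "(perm_matrix g ** Y) $ i $ j = Y $ (Hilbert_Choice.inv g i) $ j"
    and "(Y ** perm_matrix g) $ i $ j = Y $ i $ g j"
proof -
  have "(if i = g k then 1 else 0) * Y $ k $ j = (if k = Hilbert_Choice.inv g i then Y $ k $ j else 0)" for k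
    using assms by (auto simp: bij_inv_eq_iff)
  then show "(perm_matrix g ** Y) $ i $ j = Y $ (Hilbert_Choice.inv g i) $ j"
    by (simp add: perm_matrix_def matrix_matrix_mult_def)
  have "Y $ i $ k * (if k = g j then 1 else 0) = (if k = g j then Y $ i $ k else 0)" for k
    by simp
  then show "(Y ** perm_matrix g) $ i $ j = Y $ i $ g j"
    by (simp add: perm_matrix_def matrix_matrix_mult_def)
qed

lemma perm_matrix_orthogonal:
  assumes "bij (g :: 'p::finite \<Rightarrow> 'p)"
  shows "perm_matrix g ** transpose (perm_matrix g) = (mat 1 :: 'a::comm_semiring_1 ^ 'p ^ 'p)"
    and "transpose (perm_matrix g) ** perm_matrix g = (mat 1 :: 'a ^ 'p ^ 'p)"
proof -
  have "(perm_matrix g ** transpose (perm_matrix g)) $ i $ j = (mat 1 :: 'a ^ 'p ^ 'p) $ i $ j" for i j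
    using assms unfolding perm_matrix_mult_nth(1)[OF assms]
    by (auto simp: transpose_def perm_matrix_def mat_def bij_inv_eq_iff bij_is_inj inj_eq dest: bij_is_surj surj_f_inv_f) (metis bij_inv_eq_iff)+
  then show "perm_matrix g ** transpose (perm_matrix g) = (mat 1 :: 'a ^ 'p ^ 'p)"
    by (simp add: vec_eq_iff)
  have "(transpose (perm_matrix g) ** perm_matrix g) $ i $ j = (mat 1 :: 'a ^ 'p ^ 'p) $ i $ j" for i j
    unfolding perm_matrix_mult_nth(2)[OF assms]
    using assms by (auto simp: transpose_def perm_matrix_def mat_def bij_is_inj inj_eq)
  then show "transpose (perm_matrix g) ** perm_matrix g = (mat 1 :: 'a ^ 'p ^ 'p)"
    by (simp add: vec_eq_iff)
qed

definition commuting_matrices :: "('p \<Rightarrow> 'p) set \<Rightarrow> ('a::semiring_1 ^ 'p::finite ^ 'p) set" where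
  "commuting_matrices G = {Y. \<forall>g\<in>G. perm_matrix g ** Y = Y ** perm_matrix g}"

lemma commuting_matrices_vector:
  "Y \<in> commuting_matrices G \<Longrightarrow> g \<in> G \<Longrightarrow> perm_matrix g *v (Y *v x) = Y *v (perm_matrix g *v x)"
  by (simp add: commuting_matrices_def matrix_vector_mul_assoc)

lemma commuting_matrices_mult:
  "Y \<in> commuting_matrices G \<Longrightarrow> Z \<in> commuting_matrices G \<Longrightarrow> Y ** Z \<in> commuting_matrices G"
  unfolding commuting_matrices_def
proof (intro CollectI ballI)
  fix g assume "Y \<in> {Y. \<forall>g\<in>G. perm_matrix g ** Y = Y ** perm_matrix g}"
    "Z \<in> {Y. \<forall>g\<in>G. perm_matrix g ** Y = Y ** perm_matrix g}" "g \<in> G"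
  then have Y: "perm_matrix g ** Y = Y ** perm_matrix g" and Z: "perm_matrix g ** Z = Z ** perm_matrix g"
    by auto
  have "perm_matrix g ** (Y ** Z) = Y ** (perm_matrix g ** Z)"
    by (simp only: matrix_mul_assoc Y)
  then show "perm_matrix g ** (Y ** Z) = Y ** Z ** perm_matrix g"
    by (simp only: Z matrix_mul_assoc)
qed

lemma matrix_mult_add_right_distrib: "(A + B) ** C = A ** C + B ** (C :: 'a::semiring_1 ^ 'n ^ 'k)"
  by (simp add: matrix_matrix_mult_def vec_eq_iff distrib_right sum.distrib)

lemma matrix_mult_diff_right_distrib: "(A - B) ** C = A ** C - B ** (C :: 'a::ring_1 ^ 'n ^ 'k)"
  by (simp add: matrix_matrix_mult_def vec_eq_iff left_diff_distrib sum_subtractf)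

lemma commuting_matrices_add:
  "Y \<in> commuting_matrices G \<Longrightarrow> Z \<in> commuting_matrices G \<Longrightarrow> Y + Z \<in> commuting_matrices G"
  by (simp add: commuting_matrices_def matrix_add_ldistrib matrix_mult_add_right_distrib)

lemma commuting_matrices_scale:
  "Y \<in> commuting_matrices G \<Longrightarrow> complex_scale c Y \<in> commuting_matrices G"
  by (simp add: commuting_matrices_def complex_scale_mult)

lemma commuting_matrices_diff:
  "Y \<in> commuting_matrices G \<Longrightarrow> Z \<in> commuting_matrices G \<Longrightarrow> Y - Z \<in> commuting_matrices G" for Y Z :: "complex ^ 'p::finite ^ 'p"
  using commuting_matrices_add[OF _ commuting_matrices_scale[of Z G "-1"], of Y]
  by (simp add: complex_scale_def vec_eq_iff minus_vec_def plus_vec_def)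

locale permutation_group =
  fixes G :: "('p::finite \<Rightarrow> 'p) set"
  assumes G: "subgroup G (BijGroup UNIV)"
begin

lemma bij: "g \<in> G \<Longrightarrow> bij g"
  and inv_in: "g \<in> G \<Longrightarrow> Hilbert_Choice.inv g \<in> G"
  using subgroup_BijGroup_UNIV_D[OF G] by auto

text \<open>
  In terms of the entries, commutation with permutation matrices is invariance under simultaneous
  permutation of rows and columns; this makes the closure under adjoints, real parts and linear
  combinations evident.
\<close>
lemma commuting_matrices_iff:
  "Y \<in> commuting_matrices G \<longleftrightarrow> (\<forall>g\<in>G. \<forall>i j. Y $ g i $ g j = Y $ i $ j)"
proof -
  have "perm_matrix g ** Y = Y ** perm_matrix g \<longleftrightarrow> (\<forall>i j. Y $ g i $ g j = Y $ i $ j)" if "g \<in> G" for g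
  proof -
    have "perm_matrix g ** Y = Y ** perm_matrix g \<longleftrightarrow> (\<forall>i j. Y $ (Hilbert_Choice.inv g i) $ j = Y $ i $ g j)"
      by (simp add: vec_eq_iff perm_matrix_mult_nth[OF bij[OF that]])
    also have "\<dots> \<longleftrightarrow> (\<forall>i j. Y $ g i $ g j = Y $ i $ j)"
      using bij[OF that] by (metis bij_inv_eq_iff)
    finally show ?thesis .
  qed
  then show ?thesis by (simp add: commuting_matrices_def)
qed

lemma invariant_matrices_eq_commuting: "invariant_matrices G = commuting_matrices G"
proof -
  have "perm_matrix g ** M ** transpose (perm_matrix g) = M \<longleftrightarrow> perm_matrix g ** M = M ** perm_matrix g"
    if "g \<in> G" for g and M :: "real ^ 'p ^ 'p"
    using perm_matrix_orthogonal[OF bij[OF that], where 'a = real]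
    by (metis matrix_mul_assoc matrix_mul_rid)
  then show ?thesis by (auto simp: invariant_matrices_def commuting_matrices_def)
qed

lemma commuting_matrices_adjoint:
  "Y \<in> commuting_matrices G \<Longrightarrow> adjoint_matrix Y \<in> commuting_matrices G"
  by (simp add: commuting_matrices_iff adjoint_matrix_def)

lemma orth_proj_commuting:
  assumes V: "invariant_subspace G V"
  shows "orth_proj V \<in> commuting_matrices G"
proof -
  have sV: "vec.subspace V" using V by (simp add: invariant_subspace_def)
  have "orth_proj V *v (perm_matrix g *v x) = perm_matrix g *v (orth_proj V *v x)" if g: "g \<in> G" for g x
  proof (rule orth_proj_eqI[OF sV])
    show "perm_matrix g *v (orth_proj V *v x) \<in> V"
      using V g orth_proj_in[OF sV] by (auto simp: invariant_subspace_def)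
    fix u assume u: "u \<in> V"
    have w: "perm_matrix (Hilbert_Choice.inv g) *v u \<in> V"
      using V u inv_in[OF g] by (auto simp: invariant_subspace_def)
    have e: "perm_matrix g *v (perm_matrix (Hilbert_Choice.inv g) *v u) = u"
      by (simp add: vec_eq_iff perm_matrix_nth[OF bij[OF g]] perm_matrix_nth[OF bij[OF inv_in[OF g]]]
          inv_inv_eq[OF bij[OF g]] bij_is_surj[OF bij[OF g]] surj_f_inv_f)
    have "(perm_matrix g *v (x - orth_proj V *v x)) \<bullet> (perm_matrix g *v (perm_matrix (Hilbert_Choice.inv g) *v u)) = 0"
      unfolding perm_matrix_inner[OF bij[OF g]] by (rule orth_proj_orthogonal[OF sV w])
    then show "(perm_matrix g *v x - perm_matrix g *v (orth_proj V *v x)) \<bullet> u = 0"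
      unfolding e by (simp add: matrix_vector_mult_diff_distrib)
  qed
  then show ?thesis
    by (simp add: commuting_matrices_def matrix_eq matrix_vector_mul_assoc[symmetric])
qed

text \<open>
  Maschke's theorem in the unitary form, expressed through projections. The decompositions in the
  definition of the multiplicities are merely direct; orthogonality is needed for the Frobenius norm to
  split.
\<close>
lemma orthogonal_irreducible_decomposition:
  "invariant_subspace G U \<Longrightarrow>
    \<exists>D. finite D \<and> (\<forall>V\<in>D. irreducible_subspace G V \<and> V \<subseteq> U) \<and> (\<Sum>V\<in>D. orth_proj V) = orth_proj U"
proof (induction "vec.dim U" arbitrary: U rule: less_induct)
  case less
  have U: "vec.subspace U" using less.prems by (simp add: invariant_subspace_def)
  show ?case
  proof (cases "U = {0}")
    case True
    have "orth_proj U = 0"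
      using orth_proj_in[OF U] True by (simp add: matrix_eq)
    then show ?thesis by (intro exI[of _ "{}"]) simp
  next
    case False
    obtain V where V: "irreducible_subspace G V" "V \<subseteq> U"
      using irreducible_subspace_exists[OF less.prems False] by blast
    then have iV: "invariant_subspace G V" and sV: "vec.subspace V" and V0: "V \<noteq> {0}"
      by (auto simp: irreducible_subspace_def invariant_subspace_def)
    define W where "W = {u\<in>U. \<forall>v\<in>V. u \<bullet> v = 0}"
    note dec = orthogonal_complement_decomposition[OF sV U V(2), folded W_def]
    have iW: "invariant_subspace G W"
      unfolding W_def by (rule invariant_subspace_orthogonal[OF G less.prems iV])
    have VW: "V \<inter> W \<subseteq> {0}" by (auto simp: W_def)
    have "W \<subseteq> U" by (auto simp: W_def)
    moreover have "W \<noteq> U" using VW V0 V vec.subspace_0[OF sV] by auto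
    ultimately have "vec.dim W < vec.dim U"
      using vec.subspace_dim_equal[OF dec(1) U] by linarith
    then obtain D where D: "finite D" "\<forall>V\<in>D. irreducible_subspace G V \<and> V \<subseteq> W"
      "(\<Sum>V\<in>D. orth_proj V) = orth_proj W"
      using less.hyps[OF _ iW] by blast
    have "V \<notin> D"
    proof
      assume "V \<in> D"
      then have "V \<subseteq> {0}" using D(2) VW by blast
      then show False using V0 vec.subspace_0[OF sV] by blast
    qed
    then show ?thesis
      using D V dec(2) \<open>W \<subseteq> U\<close> by (intro exI[of _ "insert V D"]) auto
  qed
qed

text \<open>
  The equivariant linear maps from \<open>V\<close> to the whole space, extended by \<open>0\<close> to the orthogonal complement
  of \<open>V\<close>.
\<close>
definition intertwiners :: "(complex ^ 'p) set \<Rightarrow> (complex ^ 'p ^ 'p) set" where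
  "intertwiners V = {Y \<in> commuting_matrices G. Y ** orth_proj V = Y}"

lemma irreducibleD:
  assumes "irreducible_subspace G V"
  shows "invariant_subspace G V" "vec.subspace V" "V \<noteq> {0}" "orth_proj V \<in> commuting_matrices G"
    "0 < vec.dim V" "orth_proj V \<in> intertwiners V" "orth_proj V \<noteq> 0"
proof -
  show i: "invariant_subspace G V" and s: "vec.subspace V" and n: "V \<noteq> {0}"
    using assms by (auto simp: irreducible_subspace_def invariant_subspace_def)
  show c: "orth_proj V \<in> commuting_matrices G" by (rule orth_proj_commuting[OF i])
  then show "orth_proj V \<in> intertwiners V" by (simp add: intertwiners_def orth_proj_idem[OF s])
  obtain x where "x \<in> V" "x \<noteq> 0" using n vec.subspace_0[OF s] by blast
  then show "orth_proj V \<noteq> 0" using orth_proj_id[OF s, of x] by auto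
  then show "0 < vec.dim V" using norm_orth_proj_eq_dim[OF s] by (cases "vec.dim V") auto
qed

lemma irreducible_subspace_eqI:
  assumes "irreducible_subspace G V" "vec.subspace U" "\<And>g u. g \<in> G \<Longrightarrow> u \<in> U \<Longrightarrow> perm_matrix g *v u \<in> U"
    "U \<subseteq> V" "x \<in> U" "x \<noteq> 0"
  shows "U = V"
  using assms by (auto simp: irreducible_subspace_def invariant_subspace_def)

text \<open>
  An eigenspace of \<open>H\<close> in \<open>V\<close> is an invariant subspace, hence all of \<open>V\<close>. For a self-adjoint matrix
  an eigenvector exists by the variational argument above.
\<close>
lemma schur_self_adjoint:
  assumes V: "irreducible_subspace G V" and H: "H \<in> commuting_matrices G" "adjoint_matrix H = H" "H ** orth_proj V = H"
  obtains c :: real where "H = c *\<^sub>R orth_proj V"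
proof -
  note s = irreducibleD[OF V]
  have lin: "linear (\<lambda>x. H *v x)"
    by (intro linearI) (simp_all add: matrix_vector_right_distrib scaleR_eq_scale vec.scale)
  have PH: "orth_proj V ** H = H"
    using arg_cong[OF H(3), of adjoint_matrix] by (simp add: adjoint_mult H(2) orth_proj_self_adjoint[OF s(2)])
  have HV: "H *v x \<in> V" for x
    using orth_proj_in[OF s(2), of "H *v x"] by (simp add: matrix_vector_mul_assoc PH)
  obtain x c where x: "x \<in> V" "norm x = 1" "H *v x = c *\<^sub>R x"
  proof (rule self_adjoint_eigenvector[OF lin _ complex_subspace_imp_real[OF s(2)] s(3)])
    show "(H *v x) \<bullet> y = x \<bullet> (H *v y)" for x y
      using adjoint_matrix_dual[of H x y] by (simp add: H(2))
  qed (use HV in auto)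
  define E where "E = {v \<in> V. H *v v = complex_of_real c *s v}"
  have "E = V"
  proof (rule irreducible_subspace_eqI[OF V])
    show "vec.subspace E"
      unfolding E_def vec.subspace_def
      using vec.subspace_0[OF s(2)] vec.subspace_add[OF s(2)] vec.subspace_scale[OF s(2)]
      by (auto simp: matrix_vector_right_distrib vec.scale vec.scale_right_distrib mult.commute)
    show "perm_matrix g *v u \<in> E" if "g \<in> G" "u \<in> E" for g u
    proof -
      have "perm_matrix g *v u \<in> V" using s(1) that by (auto simp: E_def invariant_subspace_def)
      moreover have "H *v (perm_matrix g *v u) = complex_of_real c *s (perm_matrix g *v u)"
        using commuting_matrices_vector[OF H(1) that(1), of u] that(2) by (simp add: E_def vec.scale)
      ultimately show ?thesis by (simp add: E_def)
    qed
    show "x \<in> E" "x \<noteq> 0" using x by (auto simp: E_def scaleR_eq_scale)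
  qed (auto simp: E_def)
  have "H *v y = (c *\<^sub>R orth_proj V) *v y" for y
  proof -
    have "H *v y = H *v (orth_proj V *v y)" by (simp add: matrix_vector_mul_assoc H(3))
    also have "\<dots> = complex_of_real c *s (orth_proj V *v y)"
      using orth_proj_in[OF s(2), of y] \<open>E = V\<close> by (auto simp: E_def)
    finally show ?thesis by (simp add: complex_scale_mult flip: complex_scale_eq_scaleR)
  qed
  then show ?thesis using that[of c] by (simp add: matrix_eq)
qed

text \<open>
  Write \<open>T\<close> as a complex combination of two self-adjoint matrices.
\<close>
lemma schur_scalar:
  assumes V: "irreducible_subspace G V" and T: "T \<in> commuting_matrices G" "T ** orth_proj V = T" "orth_proj V ** T = T"
  obtains a where "T = complex_scale a (orth_proj V)"
proof -
  note s = irreducibleD[OF V]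
  let ?T' = "adjoint_matrix T"
  have T': "?T' \<in> commuting_matrices G" "?T' ** orth_proj V = ?T'"
    using commuting_matrices_adjoint[OF T(1)] arg_cong[OF T(3), of adjoint_matrix]
    by (simp_all add: adjoint_mult orth_proj_self_adjoint[OF s(2)])
  obtain c1 where c1: "T + ?T' = c1 *\<^sub>R orth_proj V"
    using T T' by (rule_tac schur_self_adjoint[OF V, of "T + ?T'"])
      (auto simp: commuting_matrices_add adjoint_add add.commute matrix_mult_add_right_distrib)
  obtain c2 where c2: "complex_scale \<i> (T - ?T') = c2 *\<^sub>R orth_proj V"
  proof (rule schur_self_adjoint[OF V, of "complex_scale \<i> (T - ?T')"])
    show "complex_scale \<i> (T - ?T') \<in> commuting_matrices G"
      using T(1) T'(1) by (intro commuting_matrices_scale commuting_matrices_diff)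
    show "adjoint_matrix (complex_scale \<i> (T - ?T')) = complex_scale \<i> (T - ?T')"
      by (simp add: adjoint_scale adjoint_diff) (simp add: complex_scale_def vec_eq_iff algebra_simps)
    show "complex_scale \<i> (T - ?T') ** orth_proj V = complex_scale \<i> (T - ?T')"
      using T(2) T'(2) by (simp add: complex_scale_mult matrix_mult_diff_right_distrib)
  qed
  have "T $ i $ j = (complex_of_real c1 - \<i> * complex_of_real c2) / 2 * orth_proj V $ i $ j" for i j
  proof -
    have e1: "T $ i $ j + ?T' $ i $ j = complex_of_real c1 * orth_proj V $ i $ j"
      using arg_cong[OF c1[folded complex_scale_eq_scaleR], of "\<lambda>M. M $ i $ j"] by (simp add: complex_scale_def)
    have "\<i> * (T $ i $ j - ?T' $ i $ j) = complex_of_real c2 * orth_proj V $ i $ j"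
      using arg_cong[OF c2[folded complex_scale_eq_scaleR], of "\<lambda>M. M $ i $ j"] by (simp add: complex_scale_def)
    then have e2: "T $ i $ j - ?T' $ i $ j = - \<i> * (complex_of_real c2 * orth_proj V $ i $ j)"
      by (metis complex_i_mult_minus mult_minus_left minus_minus)
    have "2 * T $ i $ j = (T $ i $ j + ?T' $ i $ j) + (T $ i $ j - ?T' $ i $ j)" by simp
    also have "\<dots> = complex_of_real c1 * orth_proj V $ i $ j - \<i> * (complex_of_real c2 * orth_proj V $ i $ j)"
      unfolding e1 e2 by simp
    finally have "2 * T $ i $ j = complex_of_real c1 * orth_proj V $ i $ j - \<i> * (complex_of_real c2 * orth_proj V $ i $ j)" .
    then show ?thesis by (simp add: field_simps)
  qed
  then show ?thesis
    using that[of "(complex_of_real c1 - \<i> * complex_of_real c2) / 2"] by (simp add: complex_scale_def vec_eq_iff)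
qed

text \<open>
  The matrix \<open>Y\<^sup>* Y\<close> is a scalar on \<open>V\<close> by Schur's lemma, and comparing Frobenius norms determines the scalar.
\<close>
lemma intertwiner_norm:
  assumes V: "irreducible_subspace G V" and Y: "Y \<in> intertwiners V"
  shows "(norm (Y *v x))\<^sup>2 = (norm Y)\<^sup>2 / real (vec.dim V) * (norm (orth_proj V *v x))\<^sup>2"
    and "adjoint_matrix Y ** Y = ((norm Y)\<^sup>2 / real (vec.dim V)) *\<^sub>R orth_proj V"
proof -
  note s = irreducibleD[OF V]
  have Y': "Y \<in> commuting_matrices G" "Y ** orth_proj V = Y"
    using Y by (auto simp: intertwiners_def)
  obtain c where c: "adjoint_matrix Y ** Y = c *\<^sub>R orth_proj V"
  proof (rule schur_self_adjoint[OF V, of "adjoint_matrix Y ** Y"])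
    show "adjoint_matrix Y ** Y ** orth_proj V = adjoint_matrix Y ** Y"
      by (simp add: Y'(2) flip: matrix_mul_assoc)
  qed (auto simp: Y' commuting_matrices_adjoint commuting_matrices_mult adjoint_mult)
  have n: "(norm (Y *v x))\<^sup>2 = c * (norm (orth_proj V *v x))\<^sup>2" for x
  proof -
    have "(norm (Y *v x))\<^sup>2 = x \<bullet> ((adjoint_matrix Y ** Y) *v x)"
      by (simp only: power2_norm_eq_inner adjoint_matrix_dual matrix_vector_mul_assoc)
    also have "\<dots> = c * (x \<bullet> (orth_proj V *v x))"
      unfolding c by (simp only: complex_scale_eq_scaleR[symmetric] complex_scale_mult) (simp flip: scaleR_eq_scale)
    finally show ?thesis by (simp only: inner_orth_proj[OF s(2)])
  qed
  have "(norm Y)\<^sup>2 = c * (norm (orth_proj V))\<^sup>2"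
    unfolding norm_matrix_columns matrix_mult_axis[symmetric] n sum_distrib_left ..
  then have "c = (norm Y)\<^sup>2 / real (vec.dim V)"
    using s(5) by (simp add: norm_orth_proj_eq_dim[OF s(2)] del: vec.dim_eq_0)
  then show "(norm (Y *v x))\<^sup>2 = (norm Y)\<^sup>2 / real (vec.dim V) * (norm (orth_proj V *v x))\<^sup>2"
    and "adjoint_matrix Y ** Y = ((norm Y)\<^sup>2 / real (vec.dim V)) *\<^sub>R orth_proj V"
    using n c by simp_all
qed

lemma intertwiner_image:
  assumes V: "irreducible_subspace G V" and W: "irreducible_subspace G W"
    and Y: "Y \<in> intertwiners V" "Y \<noteq> 0" "\<And>x. Y *v x \<in> W"
  shows "(\<lambda>x. Y *v x) ` V = W"
proof -
  note s = irreducibleD[OF V]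
  obtain x where x: "Y *v x \<noteq> 0" using Y(2) by (auto simp: matrix_eq)
  show ?thesis
  proof (rule irreducible_subspace_eqI[OF W])
    show "vec.subspace ((\<lambda>x. Y *v x) ` V)"
      unfolding vec.subspace_def
      using vec.subspace_0[OF s(2)] vec.subspace_add[OF s(2)] vec.subspace_scale[OF s(2)]
      by (auto simp: image_iff simp flip: matrix_vector_right_distrib vec.scale) force+
    show "perm_matrix g *v u \<in> (\<lambda>x. Y *v x) ` V" if "g \<in> G" "u \<in> (\<lambda>x. Y *v x) ` V" for g u
    proof -
      from that(2) obtain v where v: "u = Y *v v" "v \<in> V" by (rule imageE)
      have "perm_matrix g *v u = Y *v (perm_matrix g *v v)"
        using Y(1) commuting_matrices_vector[of Y G g v] that(1) by (simp add: v(1) intertwiners_def)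
      moreover have "perm_matrix g *v v \<in> V" using s(1) that(1) v(2) by (auto simp: invariant_subspace_def)
      ultimately show ?thesis by blast
    qed
    show "(\<lambda>x. Y *v x) ` V \<subseteq> W" using Y(3) by blast
    have "Y *v x = Y *v (orth_proj V *v x)"
      using Y(1) by (simp add: intertwiners_def matrix_vector_mul_assoc)
    then show "Y *v x \<in> (\<lambda>x. Y *v x) ` V" using orth_proj_in[OF s(2), of x] by blast
    show "Y *v x \<noteq> 0" by fact
  qed
qed

text \<open>
  An intertwiner that is prescribed on \<open>V\<close> only becomes a matrix commuting with the whole group after
  composition with the projection onto \<open>V\<close>.
\<close>
lemma equivalent_iff_intertwiner:
  assumes V: "irreducible_subspace G V" and W: "irreducible_subspace G W"
  shows "equivalent_subspaces G V W \<longleftrightarrow> (\<exists>Y\<in>intertwiners V. Y \<noteq> 0 \<and> (\<forall>x. Y *v x \<in> W))"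
proof
  note s = irreducibleD[OF V]
  assume "equivalent_subspaces G V W"
  then obtain \<phi> where \<phi>: "Vector_Spaces.linear (*s) (*s) \<phi>" "bij_betw \<phi> V W"
    "\<And>g v. g \<in> G \<Longrightarrow> v \<in> V \<Longrightarrow> \<phi> (perm_matrix g *v v) = perm_matrix g *v \<phi> v"
    unfolding equivalent_subspaces_def by blast
  define Y where "Y = matrix \<phi> ** orth_proj V"
  have Yx: "Y *v x = \<phi> (orth_proj V *v x)" for x
    by (simp only: Y_def matrix_vector_mul_assoc[symmetric] matrix_works[OF \<phi>(1)])
  have "Y \<in> commuting_matrices G"
    unfolding commuting_matrices_def
  proof (intro CollectI ballI)
    fix g assume g: "g \<in> G"
    have "perm_matrix g *v (Y *v x) = Y *v (perm_matrix g *v x)" for x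
      unfolding Yx commuting_matrices_vector[OF s(4) g, of x, symmetric]
      by (rule \<phi>(3)[OF g orth_proj_in[OF s(2)], symmetric])
    then show "perm_matrix g ** Y = Y ** perm_matrix g"
      by (simp add: matrix_eq matrix_vector_mul_assoc)
  qed
  moreover have "Y ** orth_proj V = Y"
    by (simp add: Y_def orth_proj_idem[OF s(2)] flip: matrix_mul_assoc)
  moreover have "Y *v x \<in> W" for x
    using \<phi>(2) orth_proj_in[OF s(2), of x] by (auto simp: Yx bij_betw_def)
  moreover have "Y \<noteq> 0"
  proof
    assume "Y = 0"
    obtain w where w: "w \<in> W" "w \<noteq> 0"
      using irreducibleD(2,3)[OF W] vec.subspace_0 by blast
    then obtain x where "x \<in> V" "w = \<phi> x" using \<phi>(2) by (auto simp: bij_betw_def)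
    then have "w = Y *v x" by (simp add: Yx orth_proj_id[OF s(2)])
    then show False using w(2) \<open>Y = 0\<close> by simp
  qed
  ultimately show "\<exists>Y\<in>intertwiners V. Y \<noteq> 0 \<and> (\<forall>x. Y *v x \<in> W)"
    by (auto simp: intertwiners_def)
next
  note s = irreducibleD[OF V]
  assume "\<exists>Y\<in>intertwiners V. Y \<noteq> 0 \<and> (\<forall>x. Y *v x \<in> W)"
  then obtain Y where Y: "Y \<in> intertwiners V" "Y \<noteq> 0" "\<And>x. Y *v x \<in> W" by blast
  have "inj_on (\<lambda>x. Y *v x) V"
  proof (rule inj_onI)
    fix x y assume xy: "x \<in> V" "y \<in> V" "Y *v x = Y *v y"
    have "x - y \<in> V" using xy s(2) by (simp add: vec.subspace_diff)
    moreover have "Y *v (x - y) = 0" using xy(3) by (simp add: matrix_vector_mult_diff_distrib)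
    ultimately show "x = y"
      using intertwiner_norm(1)[OF V Y(1), of "x - y"] Y(2) s(5) by (simp add: orth_proj_id[OF s(2)] del: vec.dim_eq_0)
  qed
  then have "bij_betw (\<lambda>x. Y *v x) V W"
    using intertwiner_image[OF V W Y] by (simp add: bij_betw_def)
  moreover have "Vector_Spaces.linear (*s) (*s) (\<lambda>x. Y *v x)"
    by (rule matrix_vector_mul_linear_gen)
  ultimately show "equivalent_subspaces G V W"
    unfolding equivalent_subspaces_def using Y(1)
    by (intro exI[of _ "\<lambda>x. Y *v x"]) (auto simp: intertwiners_def commuting_matrices_vector)
qed

end

section \<open>Spaces of intertwiners\<close>

definition re_matrix :: "complex ^ 'n ^ 'm \<Rightarrow> real ^ 'n ^ 'm" where
  "re_matrix Y = (\<chi> i j. Re (Y $ i $ j))"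

definition of_real_matrix :: "real ^ 'n ^ 'm \<Rightarrow> complex ^ 'n ^ 'm" where
  "of_real_matrix M = (\<chi> i j. complex_of_real (M $ i $ j))"

lemma inner_of_real_matrix: "Y \<bullet> of_real_matrix M = re_matrix Y \<bullet> M"
  by (simp add: inner_vec_def re_matrix_def of_real_matrix_def inner_complex_def)

lemma norm_of_real_matrix: "norm (of_real_matrix M) = norm M"
proof -
  have "(norm (of_real_matrix M))\<^sup>2 = (norm M)\<^sup>2"
    unfolding power2_norm_eq_inner by (simp add: inner_vec_def of_real_matrix_def inner_complex_def)
  then show ?thesis by simp
qed

lemma re_matrix_sum: "re_matrix (\<Sum>b\<in>B. v b *\<^sub>R Y b) = (\<Sum>b\<in>B. v b *\<^sub>R re_matrix (Y b))"
  by (simp add: re_matrix_def vec_eq_iff)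

lemma norm_re_matrix_le: "norm (re_matrix Y) \<le> norm Y"
  by (rule norm_le_componentwise_cart) (simp add: re_matrix_def norm_le_componentwise_cart abs_Re_le_cmod)

lemma norm_re_matrix_mult_le: "norm (re_matrix Y *v y) \<le> norm (Y *v (\<chi> j. complex_of_real (y $ j)))"
proof (rule norm_le_componentwise_cart)
  fix i
  have "(re_matrix Y *v y) $ i = Re ((Y *v (\<chi> j. complex_of_real (y $ j))) $ i)"
    by (simp add: matrix_vector_mult_def re_matrix_def)
  then show "norm ((re_matrix Y *v y) $ i) \<le> norm ((Y *v (\<chi> j. complex_of_real (y $ j))) $ i)"
    by (simp add: abs_Re_le_cmod)
qed

lemma norm_of_real_vec: "norm (\<chi> j. complex_of_real (y $ j)) = norm (y :: real ^ 'n)"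
  by (simp add: norm_vec_def)

lemma orthonormal_parseval:
  fixes B :: "'a::euclidean_space set"
  assumes B: "finite B" "pairwise orthogonal B" "\<And>b. b \<in> B \<Longrightarrow> norm b = 1"
  shows "x \<in> span B \<Longrightarrow> (norm x)\<^sup>2 = (\<Sum>b\<in>B. (b \<bullet> x)\<^sup>2)"
    and "(norm (\<Sum>b\<in>B. v b *\<^sub>R b))\<^sup>2 = (\<Sum>b\<in>B. (v b)\<^sup>2)"
proof -
  show p: "(norm x)\<^sup>2 = (\<Sum>b\<in>B. (b \<bullet> x)\<^sup>2)" if x: "x \<in> span B" for x
  proof -
    have e: "(\<Sum>b\<in>B. (x \<bullet> b) *\<^sub>R b) = x"
      by (rule orthonormal_basis_expand[OF B(2,3) x B(1)])
    have "x \<bullet> x = (\<Sum>b\<in>B. (x \<bullet> b) *\<^sub>R b) \<bullet> x" by (simp only: e)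
    also have "\<dots> = (\<Sum>b\<in>B. (b \<bullet> x)\<^sup>2)"
      by (simp add: inner_sum_left power2_eq_square inner_commute[of x])
    finally show ?thesis by (simp only: power2_norm_eq_inner)
  qed
  have "b \<bullet> (\<Sum>c\<in>B. v c *\<^sub>R c) = v b" if b: "b \<in> B" for b
  proof -
    have "v c * (b \<bullet> c) = (if c = b then v b else 0)" if "c \<in> B" for c
      using B(2,3) b that by (auto simp: pairwise_def orthogonal_def norm_eq_1)
    then have "b \<bullet> (\<Sum>c\<in>B. v c *\<^sub>R c) = (\<Sum>c\<in>B. if c = b then v b else 0)"
      by (simp add: inner_sum_right)
    then show ?thesis using b B(1) by simp
  qed
  moreover have "(\<Sum>c\<in>B. v c *\<^sub>R c) \<in> span B"
    by (intro span_sum span_scale span_base)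
  ultimately show "(norm (\<Sum>b\<in>B. v b *\<^sub>R b))\<^sup>2 = (\<Sum>b\<in>B. (v b)\<^sup>2)"
    by (simp add: p)
qed

context permutation_group
begin

lemma of_real_matrix_commuting: "M \<in> invariant_matrices G \<Longrightarrow> of_real_matrix M \<in> commuting_matrices G"
  and re_matrix_invariant: "Y \<in> commuting_matrices G \<Longrightarrow> re_matrix Y \<in> invariant_matrices G"
  by (simp_all add: invariant_matrices_eq_commuting commuting_matrices_iff of_real_matrix_def re_matrix_def)

lemma subspace_intertwiners: "subspace (intertwiners V)"
  unfolding subspace_def intertwiners_def
  using commuting_matrices_scale[where G = G] commuting_matrices_add[where G = G and 'a = complex]
  by (auto simp: commuting_matrices_def matrix_mult_add_right_distrib complex_scale_mult simp flip: complex_scale_eq_scaleR)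

lemma intertwiners_mult_left:
  "A \<in> commuting_matrices G \<Longrightarrow> Y \<in> intertwiners V \<Longrightarrow> A ** Y \<in> intertwiners V"
  by (simp add: intertwiners_def commuting_matrices_mult matrix_mul_assoc[symmetric])

lemma intertwiner_adjoint:
  assumes V: "irreducible_subspace G V" and W: "irreducible_subspace G W"
    and Y: "Y \<in> intertwiners V" "\<And>x. Y *v x \<in> W"
  shows "adjoint_matrix Y \<in> intertwiners W" "adjoint_matrix Y *v x \<in> V" "orth_proj V ** adjoint_matrix Y = adjoint_matrix Y"
proof -
  have sV: "vec.subspace V" and sW: "vec.subspace W" using irreducibleD(2) V W by auto
  have "orth_proj W ** Y = Y" by (rule orth_proj_mult[OF sW Y(2)])
  from arg_cong[OF this, of adjoint_matrix] have "adjoint_matrix Y ** orth_proj W = adjoint_matrix Y"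
    by (simp add: adjoint_mult orth_proj_self_adjoint[OF sW])
  then show "adjoint_matrix Y \<in> intertwiners W"
    using Y(1) by (simp add: intertwiners_def commuting_matrices_adjoint)
  have "Y ** orth_proj V = Y" using Y(1) by (simp add: intertwiners_def)
  from arg_cong[OF this, of adjoint_matrix] show e: "orth_proj V ** adjoint_matrix Y = adjoint_matrix Y"
    by (simp add: adjoint_mult orth_proj_self_adjoint[OF sV])
  show "adjoint_matrix Y *v x \<in> V"
    using orth_proj_in[OF sV, of "adjoint_matrix Y *v x"] by (simp add: matrix_vector_mul_assoc e)
qed

definition irrep_equivalence :: "((complex ^ 'p) set \<times> (complex ^ 'p) set) set" where
  "irrep_equivalence =
    {(V, W). irreducible_subspace G V \<and> irreducible_subspace G W \<and> equivalent_subspaces G V W}"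

lemma irrep_equivalence_iff:
  "(V, W) \<in> irrep_equivalence \<longleftrightarrow> irreducible_subspace G V \<and> irreducible_subspace G W \<and>
    (\<exists>Y\<in>intertwiners V. Y \<noteq> 0 \<and> (\<forall>x. Y *v x \<in> W))"
  using equivalent_iff_intertwiner by (auto simp: irrep_equivalence_def)

text \<open>
  Symmetry is the main point: the inverse of an intertwiner is its adjoint up to a scalar.
\<close>
lemma equiv_irrep_equivalence: "equiv {V. irreducible_subspace G V} irrep_equivalence"
proof (rule equivI)
  show "irrep_equivalence \<subseteq> {V. irreducible_subspace G V} \<times> {V. irreducible_subspace G V}"
    by (auto simp: irrep_equivalence_def)
  show "refl_on {V. irreducible_subspace G V} irrep_equivalence"
  proof (rule refl_onI)
    fix V assume "V \<in> {V. irreducible_subspace G V}"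
    then have V: "irreducible_subspace G V" by simp
    show "(V, V) \<in> irrep_equivalence"
      unfolding irrep_equivalence_iff using V irreducibleD[OF V] orth_proj_in by blast
  qed
  show "sym irrep_equivalence"
  proof (rule symI)
    fix V W assume "(V, W) \<in> irrep_equivalence"
    then obtain Y where VW: "irreducible_subspace G V" "irreducible_subspace G W"
      and Y: "Y \<in> intertwiners V" "Y \<noteq> 0" "\<And>x. Y *v x \<in> W"
      unfolding irrep_equivalence_iff by blast
    have "adjoint_matrix Y \<noteq> 0" using Y(2) adjoint_adjoint[of Y] adjoint_zero by metis
    then show "(W, V) \<in> irrep_equivalence"
      unfolding irrep_equivalence_iff using VW intertwiner_adjoint[OF VW Y(1,3)] by blast
  qed
  show "trans irrep_equivalence"
  proof (rule transI)
    fix U V W assume "(U, V) \<in> irrep_equivalence" "(V, W) \<in> irrep_equivalence"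
    then obtain Y Z where irr: "irreducible_subspace G U" "irreducible_subspace G V" "irreducible_subspace G W"
      and Y: "Y \<in> intertwiners U" "Y \<noteq> 0" "\<And>x. Y *v x \<in> V"
      and Z: "Z \<in> intertwiners V" "Z \<noteq> 0" "\<And>x. Z *v x \<in> W"
      unfolding irrep_equivalence_iff by blast
    have "Z ** Y \<in> intertwiners U"
      using Z(1) Y(1) by (intro intertwiners_mult_left) (auto simp: intertwiners_def)
    moreover have "(Z ** Y) *v x \<in> W" for x
      by (simp add: Z(3) flip: matrix_vector_mul_assoc)
    moreover have "Z ** Y \<noteq> 0"
    proof
      assume 0: "Z ** Y = 0"
      have "Z *v v = 0" if "v \<in> V" for v
      proof -
        have "v \<in> (\<lambda>x. Y *v x) ` U" using intertwiner_image[OF irr(1,2) Y] that by simp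
        then obtain u where "v = Y *v u" by (rule imageE)
        then show ?thesis by (simp add: matrix_vector_mul_assoc 0)
      qed
      then have "W \<subseteq> {0}" using intertwiner_image[OF irr(2,3) Z] by auto
      then show False using irreducibleD(3)[OF irr(3)] vec.subspace_0[OF irreducibleD(2)[OF irr(3)]] by blast
    qed
    ultimately show "(U, W) \<in> irrep_equivalence"
      unfolding irrep_equivalence_iff using irr by blast
  qed
qed

lemma active_irreps_eq: "active_irreps G = {V. irreducible_subspace G V} // irrep_equivalence"
  by (simp add: active_irreps_def irrep_equivalence_def)

lemma irrep_dim_eq:
  assumes V: "irreducible_subspace G V"
  shows "irrep_dim (irrep_equivalence `` {V}) = vec.dim V"
proof -
  have "V \<in> irrep_equivalence `` {V}"
    using equiv_class_self[OF equiv_irrep_equivalence] V by simp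
  then have "(SOME W. W \<in> irrep_equivalence `` {V}) \<in> irrep_equivalence `` {V}"
    by (rule someI)
  then obtain W where W: "(SOME W. W \<in> irrep_equivalence `` {V}) = W" "(V, W) \<in> irrep_equivalence" by blast
  then obtain \<phi> where \<phi>: "Vector_Spaces.linear (*s) (*s) \<phi>" "bij_betw \<phi> V W"
    by (auto simp: irrep_equivalence_def equivalent_subspaces_def)
  have span: "vec.span V = V" using irreducibleD(2)[OF V] by simp
  have "inj_on \<phi> (vec.span V)" unfolding span using \<phi>(2) by (simp add: bij_betw_def)
  then have "vec.dim (\<phi> ` V) = vec.dim V" by (rule vec.dim_image_eq[OF \<phi>(1)])
  then show ?thesis unfolding irrep_dim_def W(1) using \<phi>(2) by (simp add: bij_betw_def)
qed

text \<open>
  If \<open>Y\<close> is one nonzero intertwiner from \<open>V\<close> to \<open>W\<close> and \<open>Z\<close> another one, then \<open>Y\<^sup>* Z\<close> is a scalar on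
  \<open>V\<close>; for a suitable \<open>b\<close> the range of \<open>Z - b Y\<close> is orthogonal to the range of \<open>Y\<close>, which is \<open>W\<close>.
\<close>
lemma intertwiners_into_irreducible:
  assumes V: "irreducible_subspace G V" and W: "irreducible_subspace G W"
    and Y: "Y \<in> intertwiners V" "Y \<noteq> 0" "\<And>x. Y *v x \<in> W"
    and Z: "Z \<in> intertwiners V" "\<And>x. Z *v x \<in> W"
  obtains a where "Z = complex_scale a Y"
proof -
  note s = irreducibleD[OF V] and t = irreducibleD[OF W]
  let ?Y' = "adjoint_matrix Y"
  note Y' = intertwiner_adjoint[OF V W Y(1,3)]
  define c where "c = (norm Y)\<^sup>2 / real (vec.dim V)"
  have c: "c \<noteq> 0" using Y(2) s(5) by (simp add: c_def del: vec.dim_eq_0)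
  have YY: "?Y' ** Y = complex_scale (complex_of_real c) (orth_proj V)"
    unfolding complex_scale_eq_scaleR c_def by (rule intertwiner_norm(2)[OF V Y(1)])
  obtain a where a: "?Y' ** Z = complex_scale a (orth_proj V)"
  proof (rule schur_scalar[OF V, of "?Y' ** Z"])
    show "?Y' ** Z \<in> commuting_matrices G"
      using Y'(1) Z(1) by (auto simp: intertwiners_def intro: commuting_matrices_mult)
    show "?Y' ** Z ** orth_proj V = ?Y' ** Z"
      using Z(1) by (simp add: intertwiners_def matrix_mul_assoc[symmetric])
    show "orth_proj V ** (?Y' ** Z) = ?Y' ** Z"
      by (simp add: matrix_mul_assoc Y'(3))
  qed
  define b where "b = a / complex_of_real c"
  define Z' where "Z' = Z - complex_scale b Y"
  have Y'Z': "?Y' ** Z' = 0"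
  proof -
    have "?Y' ** Z' = ?Y' ** Z - complex_scale b (?Y' ** Y)"
      unfolding Z'_def by (simp add: matrix_matrix_mult_def complex_scale_def vec_eq_iff right_diff_distrib sum_subtractf sum_distrib_left mult_ac)
    also have "\<dots> = complex_scale a (orth_proj V) - complex_scale (b * complex_of_real c) (orth_proj V)"
      by (simp add: a YY complex_scale_scale)
    finally show ?thesis using c by (simp add: b_def)
  qed
  have "Z' *v x = 0" for x
  proof -
    have "Z' *v x \<in> W"
      unfolding Z'_def matrix_vector_mult_diff_rdistrib complex_scale_mult
      using Z(2) Y(3) t(2) by (intro vec.subspace_diff vec.subspace_scale)
    then have "Z' *v x \<in> (\<lambda>x. Y *v x) ` V" using intertwiner_image[OF V W Y] by simp
    then obtain v where v: "Z' *v x = Y *v v" by (rule imageE)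
    have "(Z' *v x) \<bullet> (Z' *v x) = v \<bullet> ((?Y' ** Z') *v x)"
      by (subst v) (simp only: adjoint_matrix_dual matrix_vector_mul_assoc)
    then show ?thesis by (simp add: Y'Z')
  qed
  then have "Z' = 0" by (simp add: matrix_eq)
  then show ?thesis using that[of b] by (simp add: Z'_def)
qed

text \<open>
  The components of a vector in a direct decomposition depend linearly and equivariantly on the vector,
  because they are unique.
\<close>
lemma decomposition_projections:
  assumes D: "irreducible_decomposition G D UNIV"
  obtains \<pi> :: "(complex ^ 'p) set \<Rightarrow> complex ^ 'p ^ 'p" where
    "\<And>W. W \<in> D \<Longrightarrow> \<pi> W \<in> commuting_matrices G" "\<And>W x. W \<in> D \<Longrightarrow> \<pi> W *v x \<in> W" "(\<Sum>W\<in>D. \<pi> W) = mat 1"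
proof -
  have fin: "finite D" and irr: "\<And>W. W \<in> D \<Longrightarrow> irreducible_subspace G W"
    and ex1: "\<And>u. \<exists>!f. f \<in> (\<Pi>\<^sub>E V\<in>D. V) \<and> (\<Sum>V\<in>D. f V) = u"
    using D by (auto simp: irreducible_decomposition_def)
  define F where "F u = (THE f. f \<in> (\<Pi>\<^sub>E V\<in>D. V) \<and> (\<Sum>V\<in>D. f V) = u)" for u
  have F: "F u \<in> (\<Pi>\<^sub>E V\<in>D. V)" "(\<Sum>V\<in>D. F u V) = u" for u
    using theI'[OF ex1[of u]] by (auto simp: F_def)
  have FW: "F u W \<in> W" if "W \<in> D" for u W using PiE_mem[OF F(1) that] .
  have F_eq: "F u W = f W" if f: "\<And>W. W \<in> D \<Longrightarrow> f W \<in> W" "(\<Sum>V\<in>D. f V) = u" and W: "W \<in> D" for f u W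
  proof -
    have "F u = restrict f D"
      unfolding F_def using f by (intro the1_equality[OF ex1]) (auto simp: restrict_PiE_iff)
    then show ?thesis using W by simp
  qed
  have sub: "vec.subspace W" if "W \<in> D" for W using irreducibleD(2)[OF irr[OF that]] .
  have lin: "Vector_Spaces.linear (*s) (*s) (\<lambda>u. F u W)" if W: "W \<in> D" for W
  proof (rule Vector_Spaces.linear_iff[THEN iffD2], intro conjI allI)
    show "F (x + y) W = F x W + F y W" for x y
      using W by (intro F_eq) (auto simp: vec.subspace_add[OF sub] FW sum.distrib F(2))
    show "F (c *s x) W = c *s F x W" for c x
      using W by (intro F_eq) (auto simp: vec.subspace_scale[OF sub] FW F(2) simp flip: vec.scale_sum_right)
  qed (unfold_locales)
  define \<pi> where "\<pi> W = matrix (\<lambda>u. F u W)" for W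
  have \<pi>: "\<pi> W *v x = F x W" if "W \<in> D" for W x
    unfolding \<pi>_def by (rule matrix_works[OF lin[OF that]])
  show ?thesis
  proof (rule that)
    show "\<pi> W *v x \<in> W" if "W \<in> D" for W x using that by (simp add: \<pi> FW)
    have "(\<Sum>W\<in>D. \<pi> W) *v x = x" for x
    proof -
      have "(\<Sum>W\<in>D. \<pi> W) *v x = (\<Sum>W\<in>D. \<pi> W *v x)"
        using fin by (induction D rule: finite_induct) (auto simp: matrix_vector_mult_add_rdistrib)
      then show ?thesis by (simp add: \<pi> F(2))
    qed
    then show "(\<Sum>W\<in>D. \<pi> W) = mat 1" by (simp add: matrix_eq)
    show "\<pi> W \<in> commuting_matrices G" if W: "W \<in> D" for W
    proof -
      have "F (perm_matrix g *v x) W = perm_matrix g *v F x W" if g: "g \<in> G" for g x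
      proof (rule F_eq[OF _ _ W])
        show "perm_matrix g *v F x W \<in> W" if "W \<in> D" for W
          using irreducibleD(1)[OF irr[OF that]] FW[OF that] g by (auto simp: invariant_subspace_def)
        show "(\<Sum>V\<in>D. perm_matrix g *v F x V) = perm_matrix g *v x"
          by (simp add: F(2) flip: vec.sum)
      qed
      then show ?thesis
        by (simp add: commuting_matrices_def matrix_eq matrix_vector_mul_assoc[symmetric] \<pi>[OF W])
    qed
  qed
qed

text \<open>
  Compose an intertwiner with the projections onto the summands \<open>W\<close> of the decomposition. The component
  in \<open>W\<close> vanishes unless \<open>W\<close> is equivalent to \<open>V\<close>, in which case it is a complex multiple of one fixed
  intertwiner, that is, a real combination of two matrices.
\<close>
lemma dim_intertwiners_le:
  assumes V: "irreducible_subspace G V" and D: "irreducible_decomposition G D UNIV"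
  shows "dim (intertwiners V) \<le> 2 * card (irrep_equivalence `` {V} \<inter> D)"
    and "irrep_equivalence `` {V} \<inter> D \<noteq> {}"
proof -
  have fin: "finite D" and irr: "\<And>W. W \<in> D \<Longrightarrow> irreducible_subspace G W"
    using D by (auto simp: irreducible_decomposition_def)
  obtain \<pi> where \<pi>: "\<And>W. W \<in> D \<Longrightarrow> \<pi> W \<in> commuting_matrices G" "\<And>W x. W \<in> D \<Longrightarrow> \<pi> W *v x \<in> W" "(\<Sum>W\<in>D. \<pi> W) = mat 1"
    using decomposition_projections[OF D] by metis
  let ?C = "irrep_equivalence `` {V} \<inter> D"
  have comp: "\<pi> W ** Y \<in> intertwiners V" "(\<pi> W ** Y) *v x \<in> W" if "W \<in> D" "Y \<in> intertwiners V" for W Y x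
    using intertwiners_mult_left[OF \<pi>(1) that(2)] \<pi>(2) that(1) by (auto simp flip: matrix_vector_mul_assoc)
  \<comment> \<open>a nonzero component would be an equivalence\<close>
  have zero: "\<pi> W ** Y = 0" if "W \<in> D" "W \<notin> ?C" "Y \<in> intertwiners V" for W Y
    using that comp[OF that(1,3)] V irr unfolding Int_iff Image_singleton_iff irrep_equivalence_iff by blast
  have expand: "Y = (\<Sum>W\<in>?C. \<pi> W ** Y)" if "Y \<in> intertwiners V" for Y
  proof -
    have "(\<Sum>W\<in>D. \<pi> W) ** Y = (\<Sum>W\<in>D. \<pi> W ** Y)"
      using fin by (induction D rule: finite_induct) (auto simp: matrix_mult_add_right_distrib)
    also have "\<dots> = (\<Sum>W\<in>?C. \<pi> W ** Y)"
      using fin zero that by (intro sum.mono_neutral_right) auto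
    finally show ?thesis by (simp add: \<pi>(3))
  qed
  show "?C \<noteq> {}"
    using expand[OF irreducibleD(6)[OF V]] irreducibleD(7)[OF V] by auto
  have "\<exists>T. \<forall>Z\<in>intertwiners V. (\<forall>x. Z *v x \<in> W) \<longrightarrow> (\<exists>a. Z = complex_scale a T)" if W: "W \<in> ?C" for W
  proof -
    obtain Y where "Y \<in> intertwiners V" "Y \<noteq> 0" "\<And>x. Y *v x \<in> W"
      using W by (auto simp: irrep_equivalence_iff)
    then show ?thesis
      using intertwiners_into_irreducible[OF V irr[of W]] W by (intro exI[of _ Y]) blast
  qed
  then obtain T where T: "\<And>W Z. W \<in> ?C \<Longrightarrow> Z \<in> intertwiners V \<Longrightarrow> (\<And>x. Z *v x \<in> W) \<Longrightarrow> \<exists>a. Z = complex_scale a (T W)"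
    by metis
  let ?S = "T ` ?C \<union> (\<lambda>W. complex_scale \<i> (T W)) ` ?C"
  have "intertwiners V \<subseteq> span ?S"
  proof
    fix Y assume Y: "Y \<in> intertwiners V"
    have "\<pi> W ** Y \<in> span ?S" if W: "W \<in> ?C" for W
    proof -
      obtain a where "\<pi> W ** Y = complex_scale a (T W)"
        using T[OF W] comp[of W Y] W Y by blast
      also have "\<dots> = Re a *\<^sub>R T W + Im a *\<^sub>R complex_scale \<i> (T W)"
        by (simp add: complex_scale_def vec_eq_iff complex_eq_iff)
      also have "\<dots> \<in> span ?S"
        using W by (intro span_add span_scale span_base) auto
      finally show ?thesis .
    qed
    then have "(\<Sum>W\<in>?C. \<pi> W ** Y) \<in> span ?S" by (rule span_sum)
    then show "Y \<in> span ?S" using expand[OF Y] by simp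
  qed
  then have "dim (intertwiners V) \<le> card ?S"
    using fin by (intro dim_le_card) auto
  also have "\<dots> \<le> card (T ` ?C) + card ((\<lambda>W. complex_scale \<i> (T W)) ` ?C)"
    by (rule card_Un_le)
  also have "\<dots> \<le> 2 * card ?C"
    using fin card_image_le[of ?C T] card_image_le[of ?C "\<lambda>W. complex_scale \<i> (T W)"] by simp
  finally show "dim (intertwiners V) \<le> 2 * card ?C" .
qed

text \<open>
  Every irreducible subspace is equivalent to a member of one fixed decomposition. Without finiteness
  the maximum, the minimum and the cardinality in the theorem would be meaningless.
\<close>
lemma finite_active_irreps: "finite (active_irreps G)"
proof -
  obtain D :: "(complex ^ 'p) set set" where D: "irreducible_decomposition G D UNIV"
    using irreducible_decomposition_exists[OF G] by blast
  have "active_irreps G \<subseteq> (\<lambda>W. irrep_equivalence `` {W}) ` D"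
  proof
    fix c assume "c \<in> active_irreps G"
    then obtain V where V: "irreducible_subspace G V" "c = irrep_equivalence `` {V}"
      by (auto simp: active_irreps_eq elim: quotientE)
    then obtain W where "W \<in> D" "(V, W) \<in> irrep_equivalence"
      using dim_intertwiners_le(2)[OF V(1) D] by blast
    then show "c \<in> (\<lambda>W. irrep_equivalence `` {W}) ` D"
      using equiv_class_eq[OF equiv_irrep_equivalence] V(2) by blast
  qed
  moreover have "finite D" using D by (simp add: irreducible_decomposition_def)
  ultimately show ?thesis by (meson finite_imageI finite_subset)
qed

text \<open>
  All that the probabilistic argument has to know about the representation \<open>V\<close>. Taking real parts keeps
  the inner products with real matrices and does not enlarge norms.
\<close>
lemma intertwiner_basis:
  assumes V: "irreducible_subspace G V"
  obtains B where "finite B" "card B \<le> 2 * irrep_multiplicity G (irrep_equivalence `` {V})"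
    "\<And>M. M \<in> invariant_matrices G \<Longrightarrow>
      (norm (of_real_matrix M ** orth_proj V))\<^sup>2 = (\<Sum>b\<in>B. (re_matrix b \<bullet> M)\<^sup>2)"
    "\<And>b. b \<in> B \<Longrightarrow> re_matrix b \<in> invariant_matrices G"
    "\<And>v y. norm ((\<Sum>b\<in>B. v b *\<^sub>R re_matrix b) *v y) \<le> sqrt ((\<Sum>b\<in>B. (v b)\<^sup>2) / real (vec.dim V)) * norm y"
    "\<And>v. (norm (\<Sum>b\<in>B. v b *\<^sub>R re_matrix b))\<^sup>2 \<le> (\<Sum>b\<in>B. (v b)\<^sup>2)"
proof -
  note s = irreducibleD[OF V]
  obtain B where B: "B \<subseteq> intertwiners V" "pairwise orthogonal B" "\<And>b. b \<in> B \<Longrightarrow> norm b = 1"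
    "independent B" "card B = dim (intertwiners V)" "span B = intertwiners V"
    using orthonormal_basis_subspace[OF subspace_intertwiners[of V]] by metis
  have fin: "finite B" using B(4) by (rule independent_imp_finite)
  have parseval1: "x \<in> span B \<Longrightarrow> (norm x)\<^sup>2 = (\<Sum>b\<in>B. (b \<bullet> x)\<^sup>2)" for x
    using orthonormal_parseval(1)[OF fin B(2)] B(3) by blast
  have parseval2: "(norm (\<Sum>b\<in>B. v b *\<^sub>R b))\<^sup>2 = (\<Sum>b\<in>B. (v b)\<^sup>2)" for v
    using orthonormal_parseval(2)[OF fin B(2)] B(3) by blast
  have D: "irreducible_decomposition G (SOME D. irreducible_decomposition G D UNIV) (UNIV :: (complex ^ 'p) set)"
    using irreducible_decomposition_exists[OF G] by (rule someI_ex)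
  show ?thesis
  proof (rule that[OF fin])
    show "card B \<le> 2 * irrep_multiplicity G (irrep_equivalence `` {V})"
      unfolding B(5) irrep_multiplicity_def by (rule dim_intertwiners_le(1)[OF V D])
    show "re_matrix b \<in> invariant_matrices G" if "b \<in> B" for b
      using B(1) that by (intro re_matrix_invariant) (auto simp: intertwiners_def)
    show "(norm (of_real_matrix M ** orth_proj V))\<^sup>2 = (\<Sum>b\<in>B. (re_matrix b \<bullet> M)\<^sup>2)" if M: "M \<in> invariant_matrices G" for M
    proof -
      have "of_real_matrix M ** orth_proj V \<in> span B"
        unfolding B(6) by (rule intertwiners_mult_left[OF of_real_matrix_commuting[OF M] s(6)])
      then have "(norm (of_real_matrix M ** orth_proj V))\<^sup>2 = (\<Sum>b\<in>B. (b \<bullet> (of_real_matrix M ** orth_proj V))\<^sup>2)"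
        by (rule parseval1)
      also have "\<dots> = (\<Sum>b\<in>B. (re_matrix b \<bullet> M)\<^sup>2)"
      proof (rule sum.cong[OF refl])
        fix b assume "b \<in> B"
        then have "b ** orth_proj V = b" using B(1) by (auto simp: intertwiners_def)
        then have "b \<bullet> (of_real_matrix M ** orth_proj V) = re_matrix b \<bullet> M"
          using inner_matrix_mult_right[of b "orth_proj V" "of_real_matrix M"]
          by (simp add: orth_proj_self_adjoint[OF s(2)] inner_of_real_matrix)
        then show "(b \<bullet> (of_real_matrix M ** orth_proj V))\<^sup>2 = (re_matrix b \<bullet> M)\<^sup>2" by simp
      qed
      finally show ?thesis .
    qed
    fix v :: "complex ^ 'p ^ 'p \<Rightarrow> real"
    let ?Y = "\<Sum>b\<in>B. v b *\<^sub>R b"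
    have Y: "?Y \<in> intertwiners V"
      unfolding B(6)[symmetric] by (intro span_sum span_scale span_base)
    show "(norm (\<Sum>b\<in>B. v b *\<^sub>R re_matrix b))\<^sup>2 \<le> (\<Sum>b\<in>B. (v b)\<^sup>2)"
      unfolding parseval2[symmetric] re_matrix_sum[symmetric]
      by (intro power_mono norm_re_matrix_le) simp
    fix y :: "real ^ 'p"
    let ?y = "\<chi> j. complex_of_real (y $ j)"
    have "norm ((\<Sum>b\<in>B. v b *\<^sub>R re_matrix b) *v y) \<le> norm (?Y *v ?y)"
      unfolding re_matrix_sum[symmetric] by (rule norm_re_matrix_mult_le)
    also have "\<dots> = sqrt ((norm (?Y *v ?y))\<^sup>2)" by simp
    also have "\<dots> \<le> sqrt ((norm ?Y)\<^sup>2 / real (vec.dim V) * (norm ?y)\<^sup>2)"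
      unfolding intertwiner_norm(1)[OF V Y]
      by (intro real_sqrt_le_mono mult_left_mono power_mono norm_orth_proj_le[OF s(2)]) auto
    also have "\<dots> = sqrt ((\<Sum>b\<in>B. (v b)\<^sup>2) / real (vec.dim V)) * norm y"
      unfolding parseval2 norm_of_real_vec real_sqrt_mult by simp
    finally show "norm ((\<Sum>b\<in>B. v b *\<^sub>R re_matrix b) *v y) \<le> sqrt ((\<Sum>b\<in>B. (v b)\<^sup>2) / real (vec.dim V)) * norm y" .
  qed
qed

end

section \<open>The concentration inequality\<close>

text \<open>
  Markov's inequality for the average of the \<open>k\<close>-th powers, which is at least \<open>1\<close> on the event by
  convexity (in the form of Bernoulli's inequality).
\<close>
lemma measure_sum_ge_card_le:
  fixes a :: "'i \<Rightarrow> 'w \<Rightarrow> real"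
  assumes M: "prob_space M" and I: "finite I" "I \<noteq> {}"
    and meas: "\<And>i. i \<in> I \<Longrightarrow> a i \<in> borel_measurable M" and nonneg: "\<And>i \<omega>. i \<in> I \<Longrightarrow> 0 \<le> a i \<omega>"
    and mom: "\<And>i. i \<in> I \<Longrightarrow> (\<integral>\<^sup>+ \<omega>. ennreal (a i \<omega> ^ k) \<partial>M) \<le> ennreal q" and q: "0 \<le> q"
  shows "measure M {\<omega> \<in> space M. real (card I) \<le> (\<Sum>i\<in>I. a i \<omega>)} \<le> q"
proof -
  interpret prob_space M by fact
  let ?N = "real (card I)"
  have N: "0 < ?N" using I by (simp add: card_gt_0_iff)
  let ?E = "{\<omega> \<in> space M. ?N \<le> (\<Sum>i\<in>I. a i \<omega>)}"
  have E[measurable]: "?E \<in> sets M" using meas by measurable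
  have power_sum: "?N \<le> (\<Sum>i\<in>I. a i \<omega> ^ k)" if "?N \<le> (\<Sum>i\<in>I. a i \<omega>)" for \<omega>
  proof -
    have "?N \<le> ?N + real k * ((\<Sum>i\<in>I. a i \<omega>) - ?N)" using that by simp
    also have "\<dots> = (\<Sum>i\<in>I. 1 + real k * (a i \<omega> - 1))"
      by (simp add: sum.distrib sum_subtractf right_diff_distrib flip: sum_distrib_left)
    also have "\<dots> \<le> (\<Sum>i\<in>I. a i \<omega> ^ k)"
      using Bernoulli_inequality[of "a _ \<omega> - 1" k] nonneg by (intro sum_mono) simp
    finally show ?thesis .
  qed
  have "emeasure M ?E = (\<integral>\<^sup>+ \<omega>. indicator ?E \<omega> \<partial>M)" by simp
  also have "\<dots> \<le> (\<integral>\<^sup>+ \<omega>. ennreal (1 / ?N) * (\<Sum>i\<in>I. ennreal (a i \<omega> ^ k)) \<partial>M)"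
  proof (rule nn_integral_mono)
    fix \<omega>
    show "indicator ?E \<omega> \<le> ennreal (1 / ?N) * (\<Sum>i\<in>I. ennreal (a i \<omega> ^ k))"
    proof (cases "\<omega> \<in> ?E")
      case True
      then have "1 \<le> 1 / ?N * (\<Sum>i\<in>I. a i \<omega> ^ k)" using power_sum[of \<omega>] N by (simp add: field_simps)
      then have "ennreal 1 \<le> ennreal (1 / ?N * (\<Sum>i\<in>I. a i \<omega> ^ k))" by (rule ennreal_leI)
      also have "\<dots> = ennreal (1 / ?N) * (\<Sum>i\<in>I. ennreal (a i \<omega> ^ k))"
        using nonneg by (subst ennreal_mult) (auto simp: sum_nonneg)
      finally show ?thesis using True by simp
    qed simp
  qed
  also have "\<dots> = ennreal (1 / ?N) * (\<Sum>i\<in>I. \<integral>\<^sup>+ \<omega>. ennreal (a i \<omega> ^ k) \<partial>M)"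
    using meas by (subst nn_integral_cmult) (auto intro!: borel_measurable_sum simp: nn_integral_sum)
  also have "\<dots> \<le> ennreal (1 / ?N) * (\<Sum>i\<in>I. ennreal q)"
    by (intro mult_left_mono sum_mono mom) auto
  also have "\<dots> = ennreal (1 / ?N) * ennreal (?N * q)"
    using q by (subst sum_ennreal) auto
  also have "\<dots> = ennreal q"
    using N q by (simp flip: ennreal_mult)
  finally show ?thesis using q by (simp add: emeasure_eq_measure)
qed

context permutation_group
begin

lemma subspace_invariant_matrices: "subspace (invariant_matrices G)"
  by (simp add: subspace_def invariant_matrices_eq_commuting commuting_matrices_iff)

lemma proj_invariant_in: "proj_invariant G S \<in> invariant_matrices G"
  and inner_proj_invariant: "Q \<in> invariant_matrices G \<Longrightarrow> Q \<bullet> proj_invariant G S = Q \<bullet> S"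
proof -
  let ?W = "invariant_matrices G"
  have W: "closed ?W" "convex ?W" "?W \<noteq> {}"
    using subspace_invariant_matrices subspace_0 by (auto intro: closed_subspace subspace_imp_convex)
  show P: "proj_invariant G S \<in> ?W"
    unfolding proj_invariant_def by (rule closest_point_in_set[OF W(1,3)])
  have le: "(S - proj_invariant G S) \<bullet> (R - proj_invariant G S) \<le> 0" if "R \<in> ?W" for R
    unfolding proj_invariant_def by (rule closest_point_dot[OF W(2,1) that])
  assume Q: "Q \<in> ?W"
  have "(S - proj_invariant G S) \<bullet> Q \<le> 0"
    using le[of "proj_invariant G S + Q"] subspace_invariant_matrices P Q by (simp add: subspace_add)
  moreover have "- ((S - proj_invariant G S) \<bullet> Q) \<le> 0"
    using le[of "proj_invariant G S - Q"] subspace_invariant_matrices P Q by (simp add: subspace_diff)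
  ultimately show "Q \<bullet> proj_invariant G S = Q \<bullet> S"
    by (simp add: inner_diff_left inner_commute[of Q])
qed

end

lemma quadratic_form_le_spectral_norm: "x \<bullet> (S *v x) \<le> spectral_norm S * (norm x)\<^sup>2"
proof -
  have "x \<bullet> (S *v x) \<le> norm x * norm (S *v x)" by (rule norm_cauchy_schwarz)
  also have "\<dots> \<le> norm x * (spectral_norm S * norm x)"
    unfolding spectral_norm_def
    by (intro mult_left_mono onorm) (auto intro: linear_conv_bounded_linear[THEN iffD1] matrix_vector_mul_linear)
  finally show ?thesis by (simp add: power2_eq_square mult_ac)
qed

theorem theorem3p2:
  fixes G :: "('p::finite \<Rightarrow> 'p) set"
    and \<Sigma> :: "real ^ 'p ^ 'p"
    and \<psi> \<delta> :: real
    and n :: nat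
    and M :: "'w measure"
    and X :: "nat \<Rightarrow> 'w \<Rightarrow> real ^ 'p"
  assumes "subgroup G (BijGroup UNIV)"
    and "covariance_matrix \<Sigma>"
    and "\<Sigma> \<in> invariant_matrices G"
    and "\<psi> = spectral_norm \<Sigma>"
    and "prob_space M"
    and "prob_space.indep_vars M (\<lambda>_. borel) X {1..n}"
    and "\<And>k. k \<in> {1..n} \<Longrightarrow> has_gaussian_law M (X k) \<Sigma>"
    and "\<delta> > 0"
    and "\<delta> \<le> 8 * \<psi>"
    and "real n \<ge> (MAX i\<in>active_irreps G.
           64 * real (irrep_multiplicity G i) * \<psi>\<^sup>2 / (real (irrep_dim i) * \<delta>\<^sup>2))"
  shows "measure M {\<omega> \<in> space M.
           frobenius_norm (\<Sigma> - proj_invariant G (empirical_covariance n X \<omega>))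
             \<ge> \<delta> * sqrt (real CARD('p))}
         \<le> real (card (active_irreps G)) *
           exp (- (real n * real (MIN i\<in>active_irreps G. irrep_dim i) * \<delta>\<^sup>2 / (128 * \<psi>\<^sup>2)))"
proof -
  interpret P: prob_space M by fact
  interpret permutation_group G by (rule permutation_group.intro) fact
  have \<psi>: "0 < \<psi>" using assms(8,9) by simp
  let ?cl = "\<lambda>V. irrep_equivalence `` {V}"
  let ?act = "active_irreps G"
  note finA = finite_active_irreps
  have act: "?cl V \<in> ?act" if "irreducible_subspace G V" for V
    unfolding active_irreps_eq using that by (intro quotientI) simp
  have D0: "irreducible_decomposition G (SOME D. irreducible_decomposition G D UNIV) (UNIV :: (complex ^ 'p) set)"
    using irreducible_decomposition_exists[OF assms(1)] by (rule someI_ex)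
  have mult: "0 < irrep_multiplicity G (?cl V)" if V: "irreducible_subspace G V" for V
    unfolding irrep_multiplicity_def card_gt_0_iff
    using dim_intertwiners_le(2)[OF V D0] D0 by (simp add: irreducible_decomposition_def)
  have large: "64 * real (irrep_multiplicity G (?cl V)) * \<psi>\<^sup>2 / (real (vec.dim V) * \<delta>\<^sup>2) \<le> real n"
    if V: "irreducible_subspace G V" for V
  proof -
    have "64 * real (irrep_multiplicity G (?cl V)) * \<psi>\<^sup>2 / (real (irrep_dim (?cl V)) * \<delta>\<^sup>2) \<le>
        (MAX i\<in>?act. 64 * real (irrep_multiplicity G i) * \<psi>\<^sup>2 / (real (irrep_dim i) * \<delta>\<^sup>2))"
      using finA act[OF V] by (intro Max_ge) auto
    then show ?thesis using assms(10) by (simp add: irrep_dim_eq[OF V])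
  qed
  have "invariant_subspace G (UNIV :: (complex ^ 'p) set)"
    by (simp add: invariant_subspace_def)
  from orthogonal_irreducible_decomposition[OF this]
  obtain D :: "(complex ^ 'p) set set" where D: "finite D" "\<And>V. V \<in> D \<Longrightarrow> irreducible_subspace G V"
    "(\<Sum>V\<in>D. orth_proj V) = orth_proj UNIV" by blast
  have PU: "orth_proj (UNIV :: (complex ^ 'p) set) = mat 1"
    using orth_proj_id[of "UNIV :: (complex ^ 'p) set"] by (simp add: matrix_eq)
  \<comment> \<open>For \<open>Y\<close> the identity matrix this also gives the sum of the dimensions.\<close>
  have pythagoras: "(norm Y)\<^sup>2 = (\<Sum>V\<in>D. (norm (Y ** orth_proj V))\<^sup>2)" for Y :: "complex ^ 'p ^ 'p"
  proof -
    have "(norm (Y ** orth_proj V))\<^sup>2 = Y \<bullet> (Y ** orth_proj V)" if "V \<in> D" for V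
      using inner_matrix_mult_right[of Y "orth_proj V" "Y ** orth_proj V"] irreducibleD(2)[OF D(2)[OF that]]
      unfolding power2_norm_eq_inner
      by (simp add: orth_proj_self_adjoint orth_proj_idem matrix_mul_assoc[symmetric])
    then have "(\<Sum>V\<in>D. (norm (Y ** orth_proj V))\<^sup>2) = (\<Sum>V\<in>D. Y \<bullet> (Y ** orth_proj V))"
      by (intro sum.cong) auto
    also have "\<dots> = Y \<bullet> (Y ** (\<Sum>V\<in>D. orth_proj V))"
    proof -
      have "(\<Sum>V\<in>D. Y ** orth_proj V) = Y ** (\<Sum>V\<in>D. orth_proj V)"
        using D(1) by (induction D rule: finite_induct) (auto simp: matrix_add_ldistrib)
      then show ?thesis by (simp flip: inner_sum_right)
    qed
    also have "\<dots> = (norm Y)\<^sup>2" unfolding power2_norm_eq_inner by (simp add: D(3) PU)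
    finally show ?thesis ..
  qed
  have total_dim: "real CARD('p) = (\<Sum>V\<in>D. real (vec.dim V))"
  proof -
    have "(norm (mat 1 :: complex ^ 'p ^ 'p))\<^sup>2 = real CARD('p)"
    proof -
      have "real (vec.dim (UNIV :: (complex ^ 'p) set)) = real CARD('p)"
        by (simp add: vec.dim_UNIV card_cart_basis)
      then show ?thesis using norm_orth_proj_eq_dim[of "UNIV :: (complex ^ 'p) set"] by (simp add: PU)
    qed
    then show ?thesis
      using pythagoras[of "mat 1"] irreducibleD(2)[OF D(2)] by (simp add: norm_orth_proj_eq_dim)
  qed
  have "D \<noteq> {}" using total_dim by auto
  then obtain V0 where V0: "V0 \<in> D" by blast
  have n: "0 < n"
  proof -
    have "0 < 64 * real (irrep_multiplicity G (?cl V0)) * \<psi>\<^sup>2 / (real (vec.dim V0) * \<delta>\<^sup>2)"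
      using mult[OF D(2)[OF V0]] irreducibleD(5)[OF D(2)[OF V0]] \<psi> assms(8) by simp
    then show ?thesis using large[OF D(2)[OF V0]] by linarith
  qed
  interpret gaussian_sample M X \<Sigma> \<psi> n
    using assms(5-7) \<psi> n quadratic_form_le_spectral_norm[of _ \<Sigma>]
    by (intro gaussian_sample.intro) (auto simp: assms(4))
  have "\<forall>V\<in>D. \<exists>B. finite B \<and> card B \<le> 2 * irrep_multiplicity G (?cl V) \<and>
    (\<forall>M\<in>invariant_matrices G. (norm (of_real_matrix M ** orth_proj V))\<^sup>2 = (\<Sum>b\<in>B. (re_matrix b \<bullet> M)\<^sup>2)) \<and>
    (\<forall>b\<in>B. re_matrix b \<in> invariant_matrices G) \<and>
    (\<forall>v y. norm ((\<Sum>b\<in>B. v b *\<^sub>R re_matrix b) *v y) \<le> sqrt ((\<Sum>b\<in>B. (v b)\<^sup>2) / real (vec.dim V)) * norm y) \<and>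
    (\<forall>v. (norm (\<Sum>b\<in>B. v b *\<^sub>R re_matrix b))\<^sup>2 \<le> (\<Sum>b\<in>B. (v b)\<^sup>2))"
  proof
    fix V assume "V \<in> D"
    from D(2)[OF this] obtain B where "finite B" "card B \<le> 2 * irrep_multiplicity G (?cl V)"
      "\<And>M. M \<in> invariant_matrices G \<Longrightarrow> (norm (of_real_matrix M ** orth_proj V))\<^sup>2 = (\<Sum>b\<in>B. (re_matrix b \<bullet> M)\<^sup>2)"
      "\<And>b. b \<in> B \<Longrightarrow> re_matrix b \<in> invariant_matrices G"
      "\<And>v y. norm ((\<Sum>b\<in>B. v b *\<^sub>R re_matrix b) *v y) \<le> sqrt ((\<Sum>b\<in>B. (v b)\<^sup>2) / real (vec.dim V)) * norm y"
      "\<And>v. (norm (\<Sum>b\<in>B. v b *\<^sub>R re_matrix b))\<^sup>2 \<le> (\<Sum>b\<in>B. (v b)\<^sup>2)"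
      by (rule intertwiner_basis) (rule that; assumption)
    then show "\<exists>B. finite B \<and> card B \<le> 2 * irrep_multiplicity G (?cl V) \<and>
      (\<forall>M\<in>invariant_matrices G. (norm (of_real_matrix M ** orth_proj V))\<^sup>2 = (\<Sum>b\<in>B. (re_matrix b \<bullet> M)\<^sup>2)) \<and>
      (\<forall>b\<in>B. re_matrix b \<in> invariant_matrices G) \<and>
      (\<forall>v y. norm ((\<Sum>b\<in>B. v b *\<^sub>R re_matrix b) *v y) \<le> sqrt ((\<Sum>b\<in>B. (v b)\<^sup>2) / real (vec.dim V)) * norm y) \<and>
      (\<forall>v. (norm (\<Sum>b\<in>B. v b *\<^sub>R re_matrix b))\<^sup>2 \<le> (\<Sum>b\<in>B. (v b)\<^sup>2))"
      by (intro exI[of _ B]) blast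
  qed
  from bchoice[OF this] obtain B where B0: "\<forall>V\<in>D. finite (B V) \<and> card (B V) \<le> 2 * irrep_multiplicity G (?cl V) \<and>
    (\<forall>M\<in>invariant_matrices G. (norm (of_real_matrix M ** orth_proj V))\<^sup>2 = (\<Sum>b\<in>B V. (re_matrix b \<bullet> M)\<^sup>2)) \<and>
    (\<forall>b\<in>B V. re_matrix b \<in> invariant_matrices G) \<and>
    (\<forall>v y. norm ((\<Sum>b\<in>B V. v b *\<^sub>R re_matrix b) *v y) \<le> sqrt ((\<Sum>b\<in>B V. (v b)\<^sup>2) / real (vec.dim V)) * norm y) \<and>
    (\<forall>v. (norm (\<Sum>b\<in>B V. v b *\<^sub>R re_matrix b))\<^sup>2 \<le> (\<Sum>b\<in>B V. (v b)\<^sup>2))" by blast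
  have B: "finite (B V)" "card (B V) \<le> 2 * irrep_multiplicity G (?cl V)"
      "\<And>M. M \<in> invariant_matrices G \<Longrightarrow> (norm (of_real_matrix M ** orth_proj V))\<^sup>2 = (\<Sum>b\<in>B V. (re_matrix b \<bullet> M)\<^sup>2)"
      "\<And>b. b \<in> B V \<Longrightarrow> re_matrix b \<in> invariant_matrices G"
      "\<And>v y. norm ((\<Sum>b\<in>B V. v b *\<^sub>R re_matrix b) *v y) \<le> sqrt ((\<Sum>b\<in>B V. (v b)\<^sup>2) / real (vec.dim V)) * norm y"
      "\<And>v. (norm (\<Sum>b\<in>B V. v b *\<^sub>R re_matrix b))\<^sup>2 \<le> (\<Sum>b\<in>B V. (v b)\<^sup>2)"
    if "V \<in> D" for V
    using bspec[OF B0 that] by blast+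
  \<comment> \<open>\<open>|D P V|\<^sup>2\<close>, normalised so that deviations of the size in question correspond to the value \<open>1\<close>\<close>
  define a where "a V \<omega> = (\<Sum>b\<in>B V. (re_matrix b \<bullet> deviation \<omega>)\<^sup>2) / (real (vec.dim V) * \<delta>\<^sup>2)" for V \<omega>
  have a_meas: "a V \<in> borel_measurable M" for V
    unfolding a_def by measurable
  have a_nonneg: "0 \<le> a V \<omega>" for V \<omega>
    by (simp add: a_def sum_nonneg)
  define q where "q m = exp (- (real n * real m * \<delta>\<^sup>2 / (128 * \<psi>\<^sup>2)))" for m :: nat
  define k where "k m = nat \<lfloor>real n * real m * \<delta>\<^sup>2 / (64 * \<psi>\<^sup>2)\<rfloor>" for m :: nat
  have moment: "(\<integral>\<^sup>+ \<omega>. ennreal (a V \<omega> ^ k (vec.dim V)) \<partial>M) \<le> ennreal (q (vec.dim V))" if V: "V \<in> D" for V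
    unfolding a_def k_def q_def
    using sum_squares_deviation_tail_moment[OF B(1)[OF V] _ assms(8,9) mult[OF D(2)[OF V]] B(2)[OF V] large[OF D(2)[OF V]]
      B(5)[OF V] B(6)[OF V]] irreducibleD(5)[OF D(2)[OF V]] by simp
  define E where "E c = {\<omega> \<in> space M. real (card {V\<in>D. ?cl V = c}) \<le> (\<Sum>V\<in>{V\<in>D. ?cl V = c}. a V \<omega>)}" for c
  have dim_cl: "vec.dim V = irrep_dim c" if "V \<in> D" "?cl V = c" for V c
    using irrep_dim_eq[OF D(2)[OF that(1)]] that(2) by simp
  have prob_E: "measure M (E c) \<le> q (irrep_dim c)" if c: "c \<in> ?cl ` D" for c
    unfolding E_def
  proof (rule measure_sum_ge_card_le[OF assms(5)])
    show "finite {V\<in>D. ?cl V = c}" "{V\<in>D. ?cl V = c} \<noteq> {}" using D(1) c by auto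
    show "(\<integral>\<^sup>+ \<omega>. ennreal (a V \<omega> ^ k (irrep_dim c)) \<partial>M) \<le> ennreal (q (irrep_dim c))" if "V \<in> {V\<in>D. ?cl V = c}" for V
      using moment[of V] dim_cl[of V c] that by simp
  qed (auto simp: a_meas a_nonneg q_def)
  have E_sets: "E c \<in> sets M" for c
    unfolding E_def using a_meas by measurable
  let ?bad = "{\<omega> \<in> space M. \<delta> * sqrt (real CARD('p)) \<le> frobenius_norm (\<Sigma> - proj_invariant G (empirical_covariance n X \<omega>))}"
  have norm_eq: "(frobenius_norm (\<Sigma> - proj_invariant G (empirical_covariance n X \<omega>)))\<^sup>2 = (\<Sum>V\<in>D. real (vec.dim V) * \<delta>\<^sup>2 * a V \<omega>)" for \<omega>
  proof -
    let ?D = "\<Sigma> - proj_invariant G (empirical_covariance n X \<omega>)"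
    have inv: "?D \<in> invariant_matrices G"
      by (rule subspace_diff[OF subspace_invariant_matrices assms(3) proj_invariant_in])
    have "(frobenius_norm ?D)\<^sup>2 = (\<Sum>V\<in>D. (norm (of_real_matrix ?D ** orth_proj V))\<^sup>2)"
      using pythagoras[of "of_real_matrix ?D"] by (simp add: frobenius_norm_eq_norm norm_of_real_matrix)
    also have "\<dots> = (\<Sum>V\<in>D. real (vec.dim V) * \<delta>\<^sup>2 * a V \<omega>)"
    proof (rule sum.cong[OF refl])
      fix V assume V: "V \<in> D"
      have "re_matrix b \<bullet> ?D = re_matrix b \<bullet> deviation \<omega>" if "b \<in> B V" for b
        using inner_proj_invariant[OF B(4)[OF V that]] by (simp add: deviation_def inner_diff_right)
      then have "(norm (of_real_matrix ?D ** orth_proj V))\<^sup>2 = (\<Sum>b\<in>B V. (re_matrix b \<bullet> deviation \<omega>)\<^sup>2)"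
        unfolding B(3)[OF V inv] by (intro sum.cong) auto
      then show "(norm (of_real_matrix ?D ** orth_proj V))\<^sup>2 = real (vec.dim V) * \<delta>\<^sup>2 * a V \<omega>"
        using irreducibleD(5)[OF D(2)[OF V]] assms(8) by (simp add: a_def del: vec.dim_eq_0)
    qed
    finally show ?thesis .
  qed
  have "?bad \<subseteq> (\<Union>c\<in>?cl ` D. E c)"
  proof
    fix \<omega> assume bad: "\<omega> \<in> ?bad"
    show "\<omega> \<in> (\<Union>c\<in>?cl ` D. E c)"
    proof (rule ccontr)
      assume not: "\<omega> \<notin> (\<Union>c\<in>?cl ` D. E c)"
      \<comment> \<open>Within one class the dimensions agree, so the averages can be weighted by them.\<close>
      have less: "(\<Sum>V\<in>{V\<in>D. ?cl V = c}. real (vec.dim V) * \<delta>\<^sup>2 * a V \<omega>) < (\<Sum>V\<in>{V\<in>D. ?cl V = c}. real (vec.dim V) * \<delta>\<^sup>2)"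
        if c: "c \<in> ?cl ` D" for c
      proof -
        have "(\<Sum>V\<in>{V\<in>D. ?cl V = c}. a V \<omega>) < real (card {V\<in>D. ?cl V = c})"
          using not bad c by (auto simp: E_def not_le)
        moreover have "0 < real (irrep_dim c) * \<delta>\<^sup>2"
          using c irreducibleD(5)[OF D(2)] irrep_dim_eq[OF D(2)] assms(8) by auto
        ultimately have "real (irrep_dim c) * \<delta>\<^sup>2 * (\<Sum>V\<in>{V\<in>D. ?cl V = c}. a V \<omega>) < real (irrep_dim c) * \<delta>\<^sup>2 * real (card {V\<in>D. ?cl V = c})"
          by (rule mult_strict_left_mono)
        then show ?thesis
          using dim_cl by (simp add: sum_distrib_left mult.commute)
      qed
      have group: "(\<Sum>V\<in>D. f V) = (\<Sum>c\<in>?cl ` D. \<Sum>V\<in>{V\<in>D. ?cl V = c}. f V)" for f :: "(complex ^ 'p) set \<Rightarrow> real"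
        by (rule sum.image_gen[OF D(1)])
      have "(\<Sum>V\<in>D. real (vec.dim V) * \<delta>\<^sup>2 * a V \<omega>) < (\<Sum>V\<in>D. real (vec.dim V) * \<delta>\<^sup>2)"
        unfolding group by (rule sum_strict_mono) (use D(1) \<open>D \<noteq> {}\<close> less in auto)
      also have "\<dots> = (\<delta> * sqrt (real CARD('p)))\<^sup>2"
        by (simp add: power_mult_distrib total_dim sum_distrib_left sum_nonneg mult.commute)
      also have "\<dots> \<le> (frobenius_norm (\<Sigma> - proj_invariant G (empirical_covariance n X \<omega>)))\<^sup>2"
        using bad assms(8) by (intro power_mono) auto
      finally show False by (simp add: norm_eq)
    qed
  qed
  then have "measure M ?bad \<le> measure M (\<Union>c\<in>?cl ` D. E c)"
    using E_sets D(1) by (intro P.finite_measure_mono) auto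
  also have "\<dots> \<le> (\<Sum>c\<in>?cl ` D. measure M (E c))"
    using E_sets D(1) by (intro measure_UNION_le) auto
  also have "\<dots> \<le> (\<Sum>c\<in>?cl ` D. q (MIN i\<in>?act. irrep_dim i))"
  proof (rule sum_mono)
    fix c assume c: "c \<in> ?cl ` D"
    then have "c \<in> ?act" using act D(2) by auto
    then have "(MIN i\<in>?act. irrep_dim i) \<le> irrep_dim c"
      using finA by (intro Min_le) auto
    then have "q (irrep_dim c) \<le> q (MIN i\<in>?act. irrep_dim i)"
      unfolding q_def by (simp add: divide_right_mono mult_right_mono mult_left_mono)
    then show "measure M (E c) \<le> q (MIN i\<in>?act. irrep_dim i)" using prob_E[OF c] by linarith
  qed
  also have "\<dots> \<le> real (card ?act) * q (MIN i\<in>?act. irrep_dim i)"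
  proof -
    have "card (?cl ` D) \<le> card ?act"
      using act D(2) by (intro card_mono finA) auto
    then show ?thesis by (simp add: q_def mult_right_mono)
  qed
  finally show ?thesis by (simp only: q_def)
qed

end
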